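(* Let $m\ge 3$ and let $2\le a_1\le a_2\le\dots\le a_m$ be integers. Let $V\subset\mathbb{C}^m$ be a Brieskorn complete intersection, defined by the $m-2$ polynomials $$q_{i1}x_1^{a_1}+\cdots+q_{im}x_m^{a_m}\qquad (q_{ij}\in\mathbb{C},\ i=3,\dots,m),$$ and assume that $V$ is a complete intersection surface with an isolated singularity at the origin $p\in\mathbb{C}^m$. Let $\mathfrak m$ be the maximal ideal of the analytic local ring $\mathcal{O}_{V,p}$ and let $Q=(x_{m-1},x_m)\subset\mathcal{O}_{V,p}$ (which is a minimal reduction of $\mathfrak m$). Then: (1) $$\operatorname{nr}(\mathfrak m)=\bar r(\mathfrak m)=\left\lfloor a_{m-1}\sum_{i=1}^{m-2}\frac{a_i-1}{a_i}\right\rfloor .$$ (2) For every integer $n\ge 0$, the images of the monomials $\prod_{i=1}^{m-2}x_i^{u_i}$ such that $$\sum_{i=1}^{m-2}\frac{u_i}{a_i}\ge\frac{n+1}{a_{m-1}}\quad\text{and}\quad 0\le u_i\le a_i-1\quad (i=1,\dots,m-2)$$ in the vector space $\overline{\mathfrak m^{n+1}}/Q\,\overline{\mathfrak m^{n}}$ form a basis. In particular, $\dim_{\mathbb{C}}\bigl(\overline{\mathfrak m^{n+1}}/Q\,\overline{\mathfrak m^{n}}\bigr)$ is a non-increasing function of $n$.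
   Context: For an ideal $I$ of a Noetherian local ring, $\overline I$ denotes its integral closure, and $I^0$ is the whole ring. An ideal $Q\subset I$ is a reduction of $I$ if $I^{n+1}=QI^n$ for some $n\ge 0$; it is a minimal reduction if it is minimal with respect to inclusion among reductions. For an integrally closed ideal $I\subset\mathcal{O}_{V,p}$ with $\sqrt I=\mathfrak m$ and a minimal reduction $Q$ of $I$, the normal reduction numbers are $$\operatorname{nr}(I)=\min\{n\in\mathbb{Z}_{\ge0}\mid \overline{I^{n+1}}=Q\,\overline{I^n}\},$$ $$\bar r(I)=\min\{n\in\mathbb{Z}_{\ge0}\mid \overline{I^{N+1}}=Q\,\overline{I^N}\text{ for every }N\ge n\};$$ these are independent of the choice of the minimal reduction $Q$. Under the stated assumptions on $V$, every maximal minor of the matrix $(q_{ij})$ is nonzero; hence, after replacing the defining polynomials by linear combinations generating the same ideal, one may take them to be $x_i^{a_i}+p_ix_{m-1}^{a_{m-1}}+q_ix_m^{a_m}$ $(i=1,\dots,m-2)$ with $p_i,q_i\neq0$ and $p_iq_j\neq p_jq_i$ for $i\neq j$. The local ring $\mathcal{O}_{V,p}$ is the quotient of the convergent power series ring $\mathbb{C}\{x_1,\dots,x_m\}$ by the ideal generated by the defining polynomials; $x_i$ also denotes its image in $\mathcal{O}_{V,p}$. *)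

theory Defs
  imports
    "HOL-Algebra.Algebra"
    "HOL-Analysis.Analysis"
    "HOL-Library.Poly_Mapping"
    "Jordan_Normal_Form.DL_Rank"
begin

section \<open>Integral closure, reductions and normal reduction numbers\<close>

text \<open>Powers of ideals are the powers \<open>I [^]\<^bsub>ideals_set R\<^esub> n\<close> in the monoid of ideals of
  \<open>R\<close> under the ideal product; its unit is \<open>carrier R\<close>, so the zeroth power of
  an ideal is the whole ring.\<close>

definition integral_closure :: "('a, 'b) ring_scheme \<Rightarrow> 'a set \<Rightarrow> 'a set" where
  "integral_closure R I = {x \<in> carrier R. \<exists>n\<ge>1. \<exists>c.
     (\<forall>i\<in>{1..n::nat}. c i \<in> I [^]\<^bsub>ideals_set R\<^esub> i) \<and>
     x [^]\<^bsub>R\<^esub> n \<oplus>\<^bsub>R\<^esub> (\<Oplus>\<^bsub>R\<^esub>i\<in>{1..n}. c i \<otimes>\<^bsub>R\<^esub> x [^]\<^bsub>R\<^esub> (n - i)) = \<zero>\<^bsub>R\<^esub>}"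

definition reduction :: "('a, 'b) ring_scheme \<Rightarrow> 'a set \<Rightarrow> 'a set \<Rightarrow> bool" where
  "reduction R I Q \<longleftrightarrow> ideal Q R \<and> Q \<subseteq> I \<and>
     (\<exists>n::nat. I [^]\<^bsub>ideals_set R\<^esub> (n + 1) = Q \<cdot>\<^bsub>R\<^esub> (I [^]\<^bsub>ideals_set R\<^esub> n))"

definition minimal_reduction :: "('a, 'b) ring_scheme \<Rightarrow> 'a set \<Rightarrow> 'a set \<Rightarrow> bool" where
  "minimal_reduction R I Q \<longleftrightarrow> reduction R I Q \<and> (\<forall>J. reduction R I J \<and> J \<subseteq> Q \<longrightarrow> J = Q)"

definition closed_power :: "('a, 'b) ring_scheme \<Rightarrow> 'a set \<Rightarrow> nat \<Rightarrow> 'a set" where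
  "closed_power R I n = integral_closure R (I [^]\<^bsub>ideals_set R\<^esub> n)"

text \<open>The two normal reduction numbers of \<open>I\<close>, computed with a minimal reduction \<open>Q\<close> of \<open>I\<close>.\<close>

definition nr :: "('a, 'b) ring_scheme \<Rightarrow> 'a set \<Rightarrow> 'a set \<Rightarrow> nat" where
  "nr R I Q = (LEAST n. closed_power R I (n + 1) = Q \<cdot>\<^bsub>R\<^esub> closed_power R I n)"

definition r_bar :: "('a, 'b) ring_scheme \<Rightarrow> 'a set \<Rightarrow> 'a set \<Rightarrow> nat" where
  "r_bar R I Q = (LEAST n. \<forall>N\<ge>n. closed_power R I (N + 1) = Q \<cdot>\<^bsub>R\<^esub> closed_power R I N)"

text \<open>For an algebra \<open>R\<close> over a field, with structure map \<open>h\<close>, and ideals \<open>N \<subseteq> W\<close> of \<open>R\<close>, this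
  is the vector space \<open>W / N\<close>. Its elements are cosets of \<open>N\<close>, so it sits inside the
  ring \<open>R Quot N\<close> and inherits addition and scalar multiplication from there; the fields
  \<open>monoid.mult\<close> and \<open>one\<close> are only present because module records extend ring records.\<close>

definition quot_space ::
  "('k \<Rightarrow> 'a) \<Rightarrow> ('a, 'b) ring_scheme \<Rightarrow> 'a set \<Rightarrow> 'a set \<Rightarrow> ('k, 'a set) module" where
  "quot_space h R W N =
     \<lparr>carrier = (\<lambda>w. N +>\<^bsub>R\<^esub> w) ` W,
      monoid.mult = monoid.mult (R Quot N), one = one (R Quot N),
      ring.zero = ring.zero (R Quot N), ring.add = ring.add (R Quot N),
      module.smult = (\<lambda>k v. (N +>\<^bsub>R\<^esub> h k) \<otimes>\<^bsub>R Quot N\<^esub> v)\<rparr>"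


section \<open>Convergent power series\<close>

text \<open>A power series in the variables \<open>x\<^sub>1, \<dots>, x\<^sub>m\<close> is its coefficient function on exponent
  vectors \<open>\<alpha> :: nat \<Rightarrow>\<^sub>0 nat\<close>, which vanishes unless \<open>\<alpha>\<close> is supported on \<open>{1..m}\<close>. It is
  convergent if it converges absolutely at some point \<open>(r, \<dots>, r)\<close> with \<open>r > 0\<close>.\<close>

type_synonym series = "(nat \<Rightarrow>\<^sub>0 nat) \<Rightarrow> complex"

definition convergent_series :: "nat \<Rightarrow> series set" where
  "convergent_series m = {f. (\<forall>\<alpha>. f \<alpha> \<noteq> 0 \<longrightarrow> Poly_Mapping.keys \<alpha> \<subseteq> {1..m}) \<and>
     (\<exists>r>0. (\<lambda>\<alpha>. norm (f \<alpha>) * r ^ (\<Sum>j=1..m. Poly_Mapping.lookup \<alpha> j)) summable_on UNIV)}"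

definition conv_ring :: "nat \<Rightarrow> series ring" where
  "conv_ring m =
     \<lparr>carrier = convergent_series m,
      monoid.mult = (\<lambda>f g \<gamma>. \<Sum>(\<alpha>, \<beta>)\<in>{(\<alpha>, \<beta>). \<alpha> + \<beta> = \<gamma>}. f \<alpha> * g \<beta>),
      one = (\<lambda>\<alpha>. if \<alpha> = 0 then 1 else 0),
      ring.zero = (\<lambda>_. 0),
      ring.add = (\<lambda>f g \<alpha>. f \<alpha> + g \<alpha>)\<rparr>"

definition series_const :: "complex \<Rightarrow> series" where
  "series_const c = (\<lambda>\<alpha>. if \<alpha> = 0 then c else 0)"

definition series_var :: "nat \<Rightarrow> series" where
  "series_var j = (\<lambda>\<alpha>. if \<alpha> = Poly_Mapping.single j 1 then 1 else 0)"


section \<open>Isolated complete intersection singularities\<close>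

text \<open>Points of \<open>\<complex>\<^sup>m\<close> are the extensional functions on \<open>{1..m}\<close>. The Jacobian matrix of
  \<open>f\<^sub>0, \<dots>, f\<^sub>k\<^sub>-\<^sub>1\<close> is a \<open>k \<times> m\<close> matrix whose column \<open>c\<close> (counted from \<open>0\<close>) holds the
  derivatives with respect to the coordinate \<open>c + 1\<close>.\<close>

definition complex_space :: "nat \<Rightarrow> (nat \<Rightarrow> complex) set" where
  "complex_space m = ({1..m} \<rightarrow>\<^sub>E UNIV)"

definition origin :: "nat \<Rightarrow> nat \<Rightarrow> complex" where
  "origin m = (\<lambda>j\<in>{1..m}. 0)"

definition zero_locus ::
  "nat \<Rightarrow> nat \<Rightarrow> (nat \<Rightarrow> (nat \<Rightarrow> complex) \<Rightarrow> complex) \<Rightarrow> (nat \<Rightarrow> complex) set" where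
  "zero_locus m k f = {x \<in> complex_space m. \<forall>i<k. f i x = 0}"

definition partial :: "nat \<Rightarrow> ((nat \<Rightarrow> complex) \<Rightarrow> complex) \<Rightarrow> (nat \<Rightarrow> complex) \<Rightarrow> complex" where
  "partial j g x = deriv (\<lambda>t. g (x(j := t))) (x j)"

definition jacobian_matrix ::
  "nat \<Rightarrow> nat \<Rightarrow> (nat \<Rightarrow> (nat \<Rightarrow> complex) \<Rightarrow> complex) \<Rightarrow> (nat \<Rightarrow> complex) \<Rightarrow> complex mat" where
  "jacobian_matrix m k f x = Matrix.mat k m (\<lambda>(i, c). partial (c + 1) (f i) x)"

definition singular_point ::
  "nat \<Rightarrow> nat \<Rightarrow> (nat \<Rightarrow> (nat \<Rightarrow> complex) \<Rightarrow> complex) \<Rightarrow> (nat \<Rightarrow> complex) \<Rightarrow> bool" where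
  "singular_point m k f x \<longleftrightarrow>
     x \<in> zero_locus m k f \<and> vec_space.rank k (jacobian_matrix m k f x) < k"

text \<open>The usual definition of an isolated complete intersection singularity of codimension \<open>k\<close>:
  the Jacobian matrix has full rank \<open>k\<close> at every point of the zero locus near, but
  different from, the origin. This already forces the zero locus, every component of which
  has dimension at least \<open>m - k\<close> at the origin, to be a complete intersection of dimension
  \<open>m - k\<close> there (when \<open>k < m\<close>); for \<open>k = m - 2\<close> it is a surface.\<close>

definition isolated_ci_singularity ::
  "nat \<Rightarrow> nat \<Rightarrow> (nat \<Rightarrow> (nat \<Rightarrow> complex) \<Rightarrow> complex) \<Rightarrow> bool" where
  "isolated_ci_singularity m k f \<longleftrightarrow>
     singular_point m k f (origin m) \<and>
     (\<exists>\<epsilon>>0. \<forall>x. singular_point m k f x \<and> (\<forall>j\<in>{1..m}. norm (x j) < \<epsilon>) \<longrightarrow> x = origin m)"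


section \<open>Brieskorn complete intersections\<close>

text \<open>The defining polynomials, with indices \<open>i = 3, \<dots>, m\<close>, occur both as functions on \<open>\<complex>\<^sup>m\<close>
  and as elements of the ring of convergent power series.\<close>

definition brieskorn_fun ::
  "nat \<Rightarrow> (nat \<Rightarrow> nat) \<Rightarrow> (nat \<Rightarrow> nat \<Rightarrow> complex) \<Rightarrow> nat \<Rightarrow> (nat \<Rightarrow> complex) \<Rightarrow> complex" where
  "brieskorn_fun m a q i x = (\<Sum>j=1..m. q i j * x j ^ a j)"

definition brieskorn_series ::
  "nat \<Rightarrow> (nat \<Rightarrow> nat) \<Rightarrow> (nat \<Rightarrow> nat \<Rightarrow> complex) \<Rightarrow> nat \<Rightarrow> series" where
  "brieskorn_series m a q i =
     (\<Oplus>\<^bsub>conv_ring m\<^esub>j\<in>{1..m}. series_const (q i j) \<otimes>\<^bsub>conv_ring m\<^esub> series_var j [^]\<^bsub>conv_ring m\<^esub> a j)"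

definition brieskorn_ideal ::
  "nat \<Rightarrow> (nat \<Rightarrow> nat) \<Rightarrow> (nat \<Rightarrow> nat \<Rightarrow> complex) \<Rightarrow> series set" where
  "brieskorn_ideal m a q = Idl\<^bsub>conv_ring m\<^esub> (brieskorn_series m a q ` {3..m})"

definition brieskorn_ring ::
  "nat \<Rightarrow> (nat \<Rightarrow> nat) \<Rightarrow> (nat \<Rightarrow> nat \<Rightarrow> complex) \<Rightarrow> series set ring" where
  "brieskorn_ring m a q = conv_ring m Quot brieskorn_ideal m a q"

definition brieskorn_coord ::
  "nat \<Rightarrow> (nat \<Rightarrow> nat) \<Rightarrow> (nat \<Rightarrow> nat \<Rightarrow> complex) \<Rightarrow> nat \<Rightarrow> series set" where
  "brieskorn_coord m a q j = brieskorn_ideal m a q +>\<^bsub>conv_ring m\<^esub> series_var j"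

definition brieskorn_const ::
  "nat \<Rightarrow> (nat \<Rightarrow> nat) \<Rightarrow> (nat \<Rightarrow> nat \<Rightarrow> complex) \<Rightarrow> complex \<Rightarrow> series set" where
  "brieskorn_const m a q c = brieskorn_ideal m a q +>\<^bsub>conv_ring m\<^esub> series_const c"

text \<open>The graded pieces \<open>W\<^sub>n\<^sub>+\<^sub>1 / Q W\<^sub>n\<close>, where \<open>W\<^sub>n\<close> is the integral closure of the
  \<open>n\<close>-th power of the ideal \<open>M\<close>.\<close>

definition brieskorn_quot ::
  "nat \<Rightarrow> (nat \<Rightarrow> nat) \<Rightarrow> (nat \<Rightarrow> nat \<Rightarrow> complex) \<Rightarrow> series set set \<Rightarrow> series set set \<Rightarrow> nat \<Rightarrow>
     (complex, series set set) module" where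
  "brieskorn_quot m a q M Q n = (let A = brieskorn_ring m a q in
     quot_space (brieskorn_const m a q) A
       (closed_power A M (n + 1)) (Q \<cdot>\<^bsub>A\<^esub> closed_power A M n))"

definition brieskorn_monomial ::
  "nat \<Rightarrow> (nat \<Rightarrow> nat) \<Rightarrow> (nat \<Rightarrow> nat \<Rightarrow> complex) \<Rightarrow> (nat \<Rightarrow> nat) \<Rightarrow> series set" where
  "brieskorn_monomial m a q u = (let A = brieskorn_ring m a q in
     \<Otimes>\<^bsub>A\<^esub>i\<in>{1..m-2}. brieskorn_coord m a q i [^]\<^bsub>A\<^esub> u i)"

text \<open>Exponent vectors on \<open>{1..m-2}\<close>, again as extensional functions, so that distinct members
  are distinct exponent vectors.\<close>

definition brieskorn_exponents :: "nat \<Rightarrow> (nat \<Rightarrow> nat) \<Rightarrow> nat \<Rightarrow> (nat \<Rightarrow> nat) set" where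
  "brieskorn_exponents m a n =
     {u \<in> (\<Pi>\<^sub>E i\<in>{1..m-2}. {0..a i - 1}).
        (\<Sum>i=1..m-2. real (u i) / real (a i)) \<ge> (real n + 1) / real (a (m - 1))}"

end

theory Submission
  imports Defs
begin

text \<open>The minors of the coefficient matrix that matter are nonzero because a kernel vector with two
  vanishing entries would span a curve of singular points. Hence the equations take the form
  \<open>x\<^sub>i\<^bsup>a i\<^esup> + p\<^sub>i y\<^bsup>b\<^esup> + r\<^sub>i z\<^bsup>c\<^esup> = 0\<close> with \<open>p\<^sub>i \<noteq> 0\<close>, where \<open>y, z\<close> are the last two variables and
  \<open>b \<le> c\<close> their exponents. Then the local ring is free over the series in \<open>y, z\<close> with basis the monomials
  \<open>x\<^bsup>u\<^esup>\<close>, \<open>u\<^sub>i < a i\<close>, and the key fact is that the integral closure of \<open>\<mm>\<^bsup>n\<^esup>\<close> is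
  spanned by the monomials of weight at least \<open>n\<close>, where \<open>x\<^sub>i\<close> has weight \<open>b / a i\<close> and \<open>y, z\<close> have
  weight \<open>1\<close>.

  An element that is integral over \<open>\<mm>\<^bsup>n\<^esup>\<close> vanishes to order \<open>n\<close> along all arcs on the surface.
  Averaging over the group \<open>\<Prod>\<^sub>i \<mu>\<^bsub>a i\<^esub>\<close>, which acts on the \<open>x\<^sub>i\<close> by roots of unity, separates the monomials
  \<open>x\<^bsup>u\<^esup>\<close>, so every monomial of its normal form has weight at least \<open>n\<close>. Conversely, an element \<open>f\<close> of weight
  at least \<open>n\<close> is a root of \<open>\<Prod>\<^sub>\<sigma> (T - \<sigma> f)\<close>, whose coefficients are invariant, hence series in
  \<open>y, z\<close> of the order required for an integral equation. The quotients, and with them the reduction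
  numbers, can then be read off from the normal forms.\<close>

section \<open>The ring of power series\<close>

text \<open>The weight filtration on the quotient ring is not defined through representatives but as
  order of vanishing along all formal arcs of the surface. This order is multiplicative and blind to
  the defining ideal, and it tests integral equations directly because formal series in one variable
  are integrally closed. Once it is identified with the least weight in a normal form, uniqueness of
  normal forms follows too: elements of the ideal vanish to every order. All orders are scaled by
  \<open>L\<close>, the product of the a_i with i \<le> m-2, to make the weights b / a_i integral.
  The obstacle is cancellation of lowest terms along one arc. Arcs with y = s^L and z = t s^L let
  the slope t vary: monomials of equal weight and equal group character then differ in their power
  of t. The condition on p_i gives x_i a nonzero leading coefficient for all but finitely many t.
  Multiplication by y or z keeps a monomial reduced and raises its weight by exactly 1, so Q times
  step n of the filtration misses precisely the x^u of weight at least n+1. The heaviest x^u has u_i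
  = a_i - 1; the floor of its weight is the reduction number.\<close>

abbreviation (input) lookup where "lookup \<equiv> Poly_Mapping.lookup"
abbreviation (input) keys where "keys \<equiv> Poly_Mapping.keys"
abbreviation (input) single where "single \<equiv> Poly_Mapping.single"

text \<open>Exponent vectors may involve any variables, so that one type serves for every \<open>m\<close>.\<close>

typedef pseries = "UNIV :: ((nat \<Rightarrow>\<^sub>0 nat) \<Rightarrow> complex) set"
  morphisms cf Pser ..

lemma cf_Pser [simp]: "cf (Pser f) = f"
  by (simp add: Pser_inverse)

lemma Pser_cf [simp]: "Pser (cf f) = f"
  by (simp add: cf_inverse)

lemma pseries_eqI: "(\<And>\<alpha>. cf f \<alpha> = cf g \<alpha>) \<Longrightarrow> f = g"
  by (metis cf_inject ext)

definition splits :: "(nat \<Rightarrow>\<^sub>0 nat) \<Rightarrow> ((nat \<Rightarrow>\<^sub>0 nat) \<times> (nat \<Rightarrow>\<^sub>0 nat)) set" where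
  "splits \<gamma> = {(\<alpha>, \<beta>). \<alpha> + \<beta> = \<gamma>}"

lemma splits_iff [simp]: "(\<alpha>, \<beta>) \<in> splits \<gamma> \<longleftrightarrow> \<alpha> + \<beta> = \<gamma>"
  by (simp add: splits_def)

lemma finite_bounded_lookup:
  assumes "finite K"
  shows "finite {\<alpha> :: nat \<Rightarrow>\<^sub>0 nat. keys \<alpha> \<subseteq> K \<and> (\<forall>j. lookup \<alpha> j \<le> N)}"
    (is "finite ?S")
proof -
  have "finite {f. \<forall>j. (j \<in> K \<longrightarrow> f j \<in> {..N}) \<and> (j \<notin> K \<longrightarrow> f j = (0::nat))}"
    using assms by (intro finite_set_of_finite_funs) auto
  moreover have "lookup ` ?S \<subseteq> {f. \<forall>j. (j \<in> K \<longrightarrow> f j \<in> {..N}) \<and> (j \<notin> K \<longrightarrow> f j = 0)}"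
    by (auto simp: in_keys_iff subset_iff)
  ultimately have "finite (lookup ` ?S)"
    by (rule finite_subset[rotated])
  then show ?thesis
    by (rule finite_imageD) (auto simp: inj_on_def poly_mapping_eqI)
qed

lemma lookup_le_sum_keys:
  "lookup \<gamma> j \<le> (\<Sum>i\<in>keys \<gamma>. lookup \<gamma> i)" for \<gamma> :: "nat \<Rightarrow>\<^sub>0 nat"
proof (cases "j \<in> keys \<gamma>")
  case True
  then show ?thesis by (intro member_le_sum) auto
qed (auto simp: in_keys_iff)

lemma finite_splits [simp]: "finite (splits \<gamma>)"
proof -
  let ?S = "{\<alpha> :: nat \<Rightarrow>\<^sub>0 nat. keys \<alpha> \<subseteq> keys \<gamma>
    \<and> (\<forall>j. lookup \<alpha> j \<le> (\<Sum>i\<in>keys \<gamma>. lookup \<gamma> i))}"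
  have fin: "finite ?S" by (rule finite_bounded_lookup) simp
  have *: "\<alpha> \<in> ?S \<and> \<beta> \<in> ?S" if "\<alpha> + \<beta> = \<gamma>" for \<alpha> \<beta>
  proof -
    have "lookup \<alpha> j + lookup \<beta> j = lookup \<gamma> j" for j
      using that by (metis lookup_add)
    then have "lookup \<alpha> j \<le> lookup \<gamma> j"
      and "lookup \<beta> j \<le> lookup \<gamma> j" for j
      by (metis le_add1, metis le_add2)
    then show ?thesis
      using lookup_le_sum_keys[of \<gamma>] by (auto simp: in_keys_iff intro: order_trans) (metis gr0I not_le)+
  qed
  then have "splits \<gamma> \<subseteq> ?S \<times> ?S" unfolding splits_def by blast
  then show ?thesis using fin by (meson finite_SigmaI finite_subset)
qed

instantiation pseries :: comm_ring_1
begin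

definition zero_pseries where "0 = Pser (\<lambda>_. 0)"
definition one_pseries where "1 = Pser (\<lambda>\<alpha>. if \<alpha> = 0 then 1 else 0)"
definition plus_pseries where "f + g = Pser (\<lambda>\<alpha>. cf f \<alpha> + cf g \<alpha>)"
definition minus_pseries where "f - g = Pser (\<lambda>\<alpha>. cf f \<alpha> - cf g \<alpha>)"
definition uminus_pseries where "- f = Pser (\<lambda>\<alpha>. - cf f \<alpha>)"
definition times_pseries where "f * g = Pser (\<lambda>\<gamma>. \<Sum>(\<alpha>, \<beta>)\<in>splits \<gamma>. cf f \<alpha> * cf g \<beta>)"

instance
proof
  fix f g h :: pseries
  show "f * g * h = f * (g * h)"
  proof (rule pseries_eqI)
    fix \<gamma>
    have "cf (f * g * h) \<gamma> = (\<Sum>p\<in>splits \<gamma>. \<Sum>r\<in>splits (fst p). cf f (fst r) * cf g (snd r) * cf h (snd p))"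
      by (simp add: times_pseries_def sum_distrib_right case_prod_beta)
    also have "\<dots> = (\<Sum>(p, r)\<in>Sigma (splits \<gamma>) (\<lambda>p. splits (fst p)). cf f (fst r) * cf g (snd r) * cf h (snd p))"
      by (intro sum.Sigma) auto
    \<comment> \<open>Both sums run over the ways of writing \<gamma> as an ordered sum of three
      exponents; only the bracketing changes.\<close>
    also have "\<dots> = (\<Sum>(p, r)\<in>Sigma (splits \<gamma>) (\<lambda>p. splits (snd p)). cf f (fst p) * (cf g (fst r) * cf h (snd r)))"
      by (rule sum.reindex_bij_witness[where i = "\<lambda>(p, r). ((fst p + fst r, snd r), (fst p, fst r))"
            and j = "\<lambda>(p, r). ((fst r, snd r + snd p), (snd r, snd p))"])
         (auto simp: splits_def add.assoc)
    also have "\<dots> = cf (f * (g * h)) \<gamma>"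
      by (subst sum.Sigma[symmetric]) (auto simp: times_pseries_def sum_distrib_left case_prod_beta)
    finally show "cf (f * g * h) \<gamma> = cf (f * (g * h)) \<gamma>" .
  qed
  show "f * g = g * f"
  proof (rule pseries_eqI)
    fix \<gamma>
    show "cf (f * g) \<gamma> = cf (g * f) \<gamma>"
      unfolding times_pseries_def cf_Pser
      by (rule sum.reindex_bij_witness[where i = prod.swap and j = prod.swap])
         (auto simp: splits_def add.commute)
  qed
  show "1 * f = f"
  proof (rule pseries_eqI)
    fix \<gamma>
    have "cf (1 * f) \<gamma> = (\<Sum>(\<alpha>, \<beta>)\<in>{(0, \<gamma>)}. cf 1 \<alpha> * cf f \<beta>)"
      unfolding times_pseries_def cf_Pser
      by (rule sum.mono_neutral_right) (auto simp: one_pseries_def split: if_splits)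
    then show "cf (1 * f) \<gamma> = cf f \<gamma>" by (simp add: one_pseries_def)
  qed
  show "(f + g) * h = f * h + g * h"
    by (rule pseries_eqI)
       (simp add: times_pseries_def plus_pseries_def sum.distrib algebra_simps case_prod_beta)
  show "(0::pseries) \<noteq> 1"
    by (simp add: zero_pseries_def one_pseries_def Pser_inject fun_eq_iff)
qed (rule pseries_eqI; simp add: plus_pseries_def minus_pseries_def uminus_pseries_def zero_pseries_def)+

end

lemma cf_zero [simp]: "cf 0 \<alpha> = 0"
  and cf_one: "cf 1 \<alpha> = (if \<alpha> = 0 then 1 else 0)"
  and cf_add [simp]: "cf (f + g) \<alpha> = cf f \<alpha> + cf g \<alpha>"
  and cf_diff [simp]: "cf (f - g) \<alpha> = cf f \<alpha> - cf g \<alpha>"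
  and cf_minus [simp]: "cf (- f) \<alpha> = - cf f \<alpha>"
  and cf_mult: "cf (f * g) \<alpha> = (\<Sum>(\<beta>, \<gamma>)\<in>splits \<alpha>. cf f \<beta> * cf g \<gamma>)"
  by (simp_all add: zero_pseries_def one_pseries_def plus_pseries_def minus_pseries_def
      uminus_pseries_def times_pseries_def)

lemma cf_sum: "cf (sum F I) \<alpha> = (\<Sum>i\<in>I. cf (F i) \<alpha>)"
  by (induction I rule: infinite_finite_induct) auto

definition mon :: "(nat \<Rightarrow>\<^sub>0 nat) \<Rightarrow> pseries" where
  "mon \<alpha> = Pser (\<lambda>\<beta>. if \<beta> = \<alpha> then 1 else 0)"

definition cst :: "complex \<Rightarrow> pseries" where
  "cst c = Pser (\<lambda>\<beta>. if \<beta> = 0 then c else 0)"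

abbreviation var :: "nat \<Rightarrow> pseries" where
  "var j \<equiv> mon (single j 1)"

lemma cf_mon: "cf (mon \<alpha>) \<beta> = (if \<beta> = \<alpha> then 1 else 0)"
  by (simp add: mon_def)

lemma cf_cst: "cf (cst c) \<beta> = (if \<beta> = 0 then c else 0)"
  by (simp add: cst_def)

lemma cf_cst_mult [simp]: "cf (cst c * f) \<gamma> = c * cf f \<gamma>"
proof -
  have "cf (cst c * f) \<gamma> = (\<Sum>(\<alpha>, \<beta>)\<in>{(0, \<gamma>)}. cf (cst c) \<alpha> * cf f \<beta>)"
    unfolding cf_mult by (rule sum.mono_neutral_right) (auto simp: cf_cst split: if_splits)
  then show ?thesis by (simp add: cf_cst)
qed

lemma cf_mon_mult_add [simp]: "cf (mon \<alpha> * f) (\<alpha> + \<beta>) = cf f \<beta>"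
proof -
  have "cf (mon \<alpha> * f) (\<alpha> + \<beta>) = (\<Sum>(\<alpha>', \<beta>)\<in>{(\<alpha>, \<beta>)}. cf (mon \<alpha>) \<alpha>' * cf f \<beta>)"
    unfolding cf_mult by (rule sum.mono_neutral_right) (auto simp: cf_mon split: if_splits)
  then show ?thesis by (simp add: cf_mon)
qed

lemma cf_mon_mult_eq_0: "\<nexists>\<beta>. \<gamma> = \<alpha> + \<beta> \<Longrightarrow> cf (mon \<alpha> * f) \<gamma> = 0"
  unfolding cf_mult by (rule sum.neutral) (use splits_iff in \<open>fastforce simp: cf_mon split: if_splits\<close>)

lemma mon_mult: "mon \<alpha> * mon \<beta> = mon (\<alpha> + \<beta>)"
proof (rule pseries_eqI)
  fix \<gamma>
  show "cf (mon \<alpha> * mon \<beta>) \<gamma> = cf (mon (\<alpha> + \<beta>)) \<gamma>"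
    by (cases "\<exists>\<delta>. \<gamma> = \<alpha> + \<delta>") (auto simp: cf_mon cf_mon_mult_eq_0)
qed

lemma mon_0: "mon 0 = 1" and cst_1: "cst 1 = 1" and cst_0 [simp]: "cst 0 = 0"
  by (auto intro!: pseries_eqI simp: cf_mon cf_one cf_cst)

lemma mon_power: "mon (single j d) ^ n = mon (single j (n * d))"
  by (induction n) (auto simp: mon_0 mon_mult single_add[symmetric])

lemma var_power: "var j ^ n = mon (single j n)"
  using mon_power[of j 1 n] by simp

lemma cst_mult: "cst (c * d) = cst c * cst d"
  and cst_add: "cst (c + d) = cst c + cst d"
  and cst_minus: "cst (- c) = - cst c"
  by (auto intro!: pseries_eqI simp: cf_cst)

lemma cf_mult_0 [simp]: "cf (f * g) 0 = cf f 0 * cf g 0"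
proof -
  have "splits 0 = {(0, 0)}"
    by (auto simp: splits_def) (metis (mono_tags, lifting) add_is_0 lookup_add lookup_zero poly_mapping_eqI)+
  then show ?thesis by (simp add: cf_mult)
qed

text \<open>The set \<open>I\<close> indexes finitely many monomials \<open>x\<^bsup>e i\<^esup>\<close>; each monomial of \<open>f\<close> that is
  divisible by one of them is charged to the first such index.\<close>

definition dvx :: "(nat \<Rightarrow> nat \<Rightarrow>\<^sub>0 nat) \<Rightarrow> nat set \<Rightarrow> (nat \<Rightarrow>\<^sub>0 nat) \<Rightarrow> nat \<Rightarrow> bool" where
  "dvx e I \<alpha> i \<longleftrightarrow> i \<in> I \<and> (\<exists>\<beta>. \<alpha> = e i + \<beta>) \<and> (\<forall>j\<in>I. (\<exists>\<beta>. \<alpha> = e j + \<beta>) \<longrightarrow> i \<le> j)"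

definition quotx :: "(nat \<Rightarrow> nat \<Rightarrow>\<^sub>0 nat) \<Rightarrow> nat set \<Rightarrow> nat \<Rightarrow> pseries \<Rightarrow> pseries" where
  "quotx e I i f = Pser (\<lambda>\<alpha>. if dvx e I (e i + \<alpha>) i then cf f (e i + \<alpha>) else 0)"

definition restx :: "(nat \<Rightarrow> nat \<Rightarrow>\<^sub>0 nat) \<Rightarrow> nat set \<Rightarrow> pseries \<Rightarrow> pseries" where
  "restx e I f = Pser (\<lambda>\<alpha>. if \<exists>i\<in>I. \<exists>\<beta>. \<alpha> = e i + \<beta> then 0 else cf f \<alpha>)"

lemma cf_quotx: "cf (quotx e I i f) \<alpha> = (if dvx e I (e i + \<alpha>) i then cf f (e i + \<alpha>) else 0)"
  by (simp add: quotx_def)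

lemma cf_restx: "cf (restx e I f) \<alpha> = (if \<exists>i\<in>I. \<exists>\<beta>. \<alpha> = e i + \<beta> then 0 else cf f \<alpha>)"
  by (simp add: restx_def)

text \<open>Each coefficient of f is used exactly once, either in one quotient or in the rest. Hence
  nothing cancels, and norm bounds and orders pass from f to the pieces.\<close>

lemma quotx_decompose:
  assumes "finite I"
  shows "f = (\<Sum>i\<in>I. mon (e i) * quotx e I i f) + restx e I f"
proof (rule pseries_eqI)
  fix \<alpha>
  have *: "cf (mon (e i) * quotx e I i f) \<alpha> = (if dvx e I \<alpha> i then cf f \<alpha> else 0)" for i
  proof (cases "\<exists>\<beta>. \<alpha> = e i + \<beta>")
    case True
    then obtain \<beta> where "\<alpha> = e i + \<beta>" ..
    then show ?thesis by (simp only: cf_mon_mult_add cf_quotx)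
  qed (auto simp: cf_mon_mult_eq_0 dvx_def)
  show "cf f \<alpha> = cf ((\<Sum>i\<in>I. mon (e i) * quotx e I i f) + restx e I f) \<alpha>"
  proof (cases "\<exists>i\<in>I. \<exists>\<beta>. \<alpha> = e i + \<beta>")
    case True
    define i where "i = (LEAST i. i \<in> I \<and> (\<exists>\<beta>. \<alpha> = e i + \<beta>))"
    have "i \<in> I \<and> (\<exists>\<beta>. \<alpha> = e i + \<beta>)"
      unfolding i_def by (rule LeastI_ex) (use True in auto)
    moreover have "i \<le> j" if "j \<in> I" "\<exists>\<beta>. \<alpha> = e j + \<beta>" for j
      unfolding i_def by (rule Least_le) (use that in auto)
    ultimately have "dvx e I \<alpha> j \<longleftrightarrow> j = i" for j
      unfolding dvx_def by (metis order_antisym)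
    then show ?thesis
      using True assms \<open>i \<in> I \<and> _\<close> by (simp add: cf_sum * cf_restx)
  next
    case False
    then show ?thesis by (auto simp: cf_sum * cf_restx dvx_def)
  qed
qed

section \<open>Convergence\<close>

text \<open>A bound on the weighted l1 norm of the coefficients. The weight \<open>w\<close> is a
  parameter because \<open>division\<close> contracts for a weight other than the degree.\<close>

definition bnd :: "((nat \<Rightarrow>\<^sub>0 nat) \<Rightarrow> nat) \<Rightarrow> real \<Rightarrow> pseries \<Rightarrow> real \<Rightarrow> bool" where
  "bnd w r f C \<longleftrightarrow> (\<forall>F. finite F \<longrightarrow> (\<Sum>\<alpha>\<in>F. norm (cf f \<alpha>) * r ^ w \<alpha>) \<le> C)"

lemma bnd_nonneg: "bnd w r f C \<Longrightarrow> 0 \<le> C"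
  unfolding bnd_def by (metis finite.emptyI sum.empty)

lemma bnd_mono: "bnd w r f C \<Longrightarrow> C \<le> D \<Longrightarrow> bnd w r f D"
  unfolding bnd_def by (meson order_trans)

lemma bnd_coeff: "bnd w r f C \<Longrightarrow> norm (cf f \<alpha>) * r ^ w \<alpha> \<le> C"
  unfolding bnd_def by (drule spec[of _ "{\<alpha>}"]) simp

lemma bnd_add: "bnd w r f C \<Longrightarrow> bnd w r g D \<Longrightarrow> 0 \<le> r \<Longrightarrow> bnd w r (f + g) (C + D)"
  unfolding bnd_def
proof (intro allI impI)
  fix F :: "(nat \<Rightarrow>\<^sub>0 nat) set"
  assume f: "\<forall>F. finite F \<longrightarrow> (\<Sum>\<alpha>\<in>F. norm (cf f \<alpha>) * r ^ w \<alpha>) \<le> C"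
    and g: "\<forall>F. finite F \<longrightarrow> (\<Sum>\<alpha>\<in>F. norm (cf g \<alpha>) * r ^ w \<alpha>) \<le> D" and "0 \<le> r" "finite F"
  have "(\<Sum>\<alpha>\<in>F. norm (cf (f + g) \<alpha>) * r ^ w \<alpha>)
      \<le> (\<Sum>\<alpha>\<in>F. norm (cf f \<alpha>) * r ^ w \<alpha> + norm (cf g \<alpha>) * r ^ w \<alpha>)"
    unfolding distrib_right[symmetric] cf_add
    by (intro sum_mono mult_right_mono norm_triangle_ineq) (use \<open>0 \<le> r\<close> in auto)
  also have "\<dots> \<le> C + D"
    using f g \<open>finite F\<close> by (simp add: sum.distrib add_mono)
  finally show "(\<Sum>\<alpha>\<in>F. norm (cf (f + g) \<alpha>) * r ^ w \<alpha>) \<le> C + D" .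
qed

lemma bnd_0: "bnd w r 0 0"
  by (simp add: bnd_def)

lemma bnd_sum:
  assumes "\<And>i. i \<in> I \<Longrightarrow> bnd w r (f i) (C i)" "0 \<le> r"
  shows "bnd w r (sum f I) (sum C I)"
  using assms by (induction I rule: infinite_finite_induct) (auto intro: bnd_0 bnd_add)

lemma bnd_uminus: "bnd w r f C \<Longrightarrow> bnd w r (- f) C"
  by (simp add: bnd_def)

lemma bnd_mult:
  assumes w: "\<And>\<alpha> \<beta>. w (\<alpha> + \<beta>) = w \<alpha> + w \<beta>" and f: "bnd w r f C" and g: "bnd w r g D" and "0 \<le> r"
  shows "bnd w r (f * g) (C * D)"
  unfolding bnd_def
proof (intro allI impI)
  fix F :: "(nat \<Rightarrow>\<^sub>0 nat) set"
  assume "finite F"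
  define a where "a = (\<lambda>\<alpha>. norm (cf f \<alpha>) * r ^ w \<alpha>)"
  define b where "b = (\<lambda>\<alpha>. norm (cf g \<alpha>) * r ^ w \<alpha>)"
  have nn: "0 \<le> a \<alpha>" "0 \<le> b \<alpha>" for \<alpha>
    using \<open>0 \<le> r\<close> by (auto simp: a_def b_def)
  define S where "S = (\<Union>\<gamma>\<in>F. splits \<gamma>)"
  have finS: "finite S" using \<open>finite F\<close> by (auto simp: S_def)
  have "(\<Sum>\<gamma>\<in>F. norm (cf (f * g) \<gamma>) * r ^ w \<gamma>) \<le> (\<Sum>\<gamma>\<in>F. \<Sum>(\<alpha>, \<beta>)\<in>splits \<gamma>. a \<alpha> * b \<beta>)"
  proof (rule sum_mono)
    fix \<gamma>
    have "norm (cf (f * g) \<gamma>) \<le> (\<Sum>(\<alpha>, \<beta>)\<in>splits \<gamma>. norm (cf f \<alpha>) * norm (cf g \<beta>))"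
      unfolding cf_mult by (rule order_trans[OF norm_sum]) (simp add: norm_mult case_prod_beta)
    then have "norm (cf (f * g) \<gamma>) * r ^ w \<gamma>
        \<le> (\<Sum>(\<alpha>, \<beta>)\<in>splits \<gamma>. norm (cf f \<alpha>) * norm (cf g \<beta>)) * r ^ w \<gamma>"
      using \<open>0 \<le> r\<close> by (intro mult_right_mono) auto
    also have "\<dots> = (\<Sum>(\<alpha>, \<beta>)\<in>splits \<gamma>. a \<alpha> * b \<beta>)"
      unfolding sum_distrib_right by (rule sum.cong) (auto simp: a_def b_def w power_add)
    finally show "norm (cf (f * g) \<gamma>) * r ^ w \<gamma> \<le> (\<Sum>(\<alpha>, \<beta>)\<in>splits \<gamma>. a \<alpha> * b \<beta>)" .
  qed
  also have "\<dots> = (\<Sum>(\<alpha>, \<beta>)\<in>S. a \<alpha> * b \<beta>)"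
    unfolding S_def using \<open>finite F\<close>
    by (subst sum.UNION_disjoint) auto
  \<comment> \<open>All terms are nonnegative, so \<open>S\<close> may grow to the rectangle of its
    projections, over which the sum factors.\<close>
  also have "\<dots> \<le> (\<Sum>(\<alpha>, \<beta>)\<in>fst ` S \<times> snd ` S. a \<alpha> * b \<beta>)"
    by (rule sum_mono2) (use finS nn in \<open>auto simp: image_iff intro: mult_nonneg_nonneg\<close>, force+)
  also have "\<dots> = sum a (fst ` S) * sum b (snd ` S)"
    by (simp add: sum_product sum.cartesian_product)
  also have "\<dots> \<le> C * D"
  proof (rule mult_mono)
    show "sum a (fst ` S) \<le> C" "sum b (snd ` S) \<le> D"
      using f g finS by (auto simp: bnd_def a_def b_def)
  qed (use nn bnd_nonneg[OF f] in \<open>auto intro: sum_nonneg\<close>)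
  finally show "(\<Sum>\<gamma>\<in>F. norm (cf (f * g) \<gamma>) * r ^ w \<gamma>) \<le> C * D" .
qed

lemma bnd_mon: "0 \<le> r \<Longrightarrow> bnd w r (mon \<alpha>) (r ^ w \<alpha>)"
  unfolding bnd_def
proof (intro allI impI)
  fix F :: "(nat \<Rightarrow>\<^sub>0 nat) set" assume "0 \<le> r" "finite F"
  have "(\<Sum>\<beta>\<in>F. norm (cf (mon \<alpha>) \<beta>) * r ^ w \<beta>) = (\<Sum>\<beta>\<in>F. if \<beta> = \<alpha> then r ^ w \<alpha> else 0)"
    by (rule sum.cong) (auto simp: cf_mon)
  then show "(\<Sum>\<beta>\<in>F. norm (cf (mon \<alpha>) \<beta>) * r ^ w \<beta>) \<le> r ^ w \<alpha>"
    using \<open>finite F\<close> \<open>0 \<le> r\<close> by (simp add: sum.delta)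
qed

lemma bnd_cst_mult: "bnd w r f C \<Longrightarrow> bnd w r (cst c * f) (norm c * C)"
  unfolding bnd_def by (simp add: norm_mult mult.assoc sum_distrib_left[symmetric] mult_left_mono)

text \<open>Comparison that may change series, radius and weight at once. A factor \<theta> below 1
  is what a smaller radius yields in \<open>cs_inverse\<close>.\<close>

lemma bnd_le_coeffs:
  assumes "bnd w r f C" "\<And>\<alpha>. norm (cf g \<alpha>) * s ^ v \<alpha> \<le> \<theta> * (norm (cf f \<alpha>) * r ^ w \<alpha>)" "0 \<le> \<theta>"
  shows "bnd v s g (\<theta> * C)"
  unfolding bnd_def
proof (intro allI impI)
  fix F :: "(nat \<Rightarrow>\<^sub>0 nat) set" assume "finite F"
  have "(\<Sum>\<alpha>\<in>F. norm (cf g \<alpha>) * s ^ v \<alpha>) \<le> \<theta> * (\<Sum>\<alpha>\<in>F. norm (cf f \<alpha>) * r ^ w \<alpha>)"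
    unfolding sum_distrib_left by (intro sum_mono assms)
  also have "\<dots> \<le> \<theta> * C"
    using assms \<open>finite F\<close> by (intro mult_left_mono) (auto simp: bnd_def)
  finally show "(\<Sum>\<alpha>\<in>F. norm (cf g \<alpha>) * s ^ v \<alpha>) \<le> \<theta> * C" .
qed

lemma bnd_quotx:
  assumes w: "\<And>\<alpha> \<beta>. w (\<alpha> + \<beta>) = w \<alpha> + w \<beta>" and f: "bnd w r f C" and "0 < r"
  shows "bnd w r (quotx e I i f) (C / r ^ w (e i))"
  unfolding bnd_def
proof (intro allI impI)
  fix F :: "(nat \<Rightarrow>\<^sub>0 nat) set" assume "finite F"
  have "(\<Sum>\<alpha>\<in>F. norm (cf (quotx e I i f) \<alpha>) * r ^ w \<alpha>) * r ^ w (e i)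
      \<le> (\<Sum>\<alpha>\<in>F. norm (cf f (e i + \<alpha>)) * r ^ w (e i + \<alpha>))"
    unfolding sum_distrib_right by (rule sum_mono) (use \<open>0 < r\<close> in \<open>auto simp: cf_quotx w power_add\<close>)
  also have "\<dots> = (\<Sum>\<alpha>\<in>(+) (e i) ` F. norm (cf f \<alpha>) * r ^ w \<alpha>)"
    by (subst sum.reindex) auto
  also have "\<dots> \<le> C"
    using f \<open>finite F\<close> by (auto simp: bnd_def)
  finally show "(\<Sum>\<alpha>\<in>F. norm (cf (quotx e I i f) \<alpha>) * r ^ w \<alpha>) \<le> C / r ^ w (e i)"
    using \<open>0 < r\<close> by (simp add: pos_le_divide_eq)
qed

text \<open>Coefficientwise convergence suffices: each coefficient of a product or a quotient
  depends on finitely many coefficients of the argument.\<close>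

definition csums :: "(nat \<Rightarrow> pseries) \<Rightarrow> pseries \<Rightarrow> bool" where
  "csums t P \<longleftrightarrow> (\<forall>\<alpha>. (\<lambda>n. cf (t n) \<alpha>) sums cf P \<alpha>)"

lemma csums_mult: "csums t P \<Longrightarrow> csums (\<lambda>n. f * t n) (f * P)"
  unfolding csums_def cf_mult case_prod_beta
  by (intro allI sums_sum sums_mult) auto

lemma csums_sum: "(\<And>i. i \<in> I \<Longrightarrow> csums (\<lambda>n. t n i) (P i)) \<Longrightarrow> csums (\<lambda>n. \<Sum>i\<in>I. t n i) (\<Sum>i\<in>I. P i)"
  unfolding csums_def cf_sum by (intro allI sums_sum) auto

lemma csums_quotx: "csums t P \<Longrightarrow> csums (\<lambda>n. quotx e I i (t n)) (quotx e I i P)"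
  unfolding csums_def cf_quotx by auto

text \<open>\<open>Z\<close> carries coefficient conditions that \<open>T\<close> preserves, such as support or order, over to the sum.\<close>

lemma neumann_series:
  assumes r: "0 < r" and f: "bnd w r f C"
    and T: "\<And>g D. bnd w r g D \<Longrightarrow> bnd w r (T g) (D / 2)"
    and cT: "\<And>t P. csums t P \<Longrightarrow> csums (\<lambda>n. T (t n)) (T P)"
    and Z: "Z f" "\<And>g. Z g \<Longrightarrow> Z (T g)"
  obtains P where "P = f + T P" "bnd w r P (2 * C)"
    "\<And>\<alpha>. (\<And>g. Z g \<Longrightarrow> cf g \<alpha> = 0) \<Longrightarrow> cf P \<alpha> = 0"
proof -
  define t where "t n = (T ^^ n) f" for n
  have tS: "t (Suc n) = T (t n)" for n by (simp add: t_def)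
  have t0: "t 0 = f" by (simp add: t_def)
  have tb: "bnd w r (t n) (C * (1 / 2) ^ n)" for n
  proof (induction n)
    case (Suc n)
    then show ?case using T[OF Suc] by (simp add: tS)
  qed (simp add: t0 f)
  have Zt: "Z (t n)" for n by (induction n) (auto simp: t0 tS Z)
  have sm: "summable (\<lambda>n. norm (cf (t n) \<alpha>))" for \<alpha>
  proof (rule summable_comparison_test')
    show "summable (\<lambda>n. C / r ^ w \<alpha> * (1 / 2) ^ n)"
      by (intro summable_mult summable_geometric) auto
    fix n
    show "norm (norm (cf (t n) \<alpha>)) \<le> C / r ^ w \<alpha> * (1 / 2) ^ n"
      using bnd_coeff[OF tb, of n \<alpha>] r by (simp add: field_simps)
  qed
  define P where "P = Pser (\<lambda>\<alpha>. suminf (\<lambda>n. cf (t n) \<alpha>))"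
  have P: "csums t P"
    unfolding csums_def P_def cf_Pser by (intro allI summable_sums summable_norm_cancel[OF sm])
  \<comment> \<open>The shifted series has two descriptions: drop the first term of the sum, or
    apply \<open>T\<close> termwise. Comparing them gives the fixed point equation.\<close>
  have "csums (\<lambda>n. t (Suc n)) (P - f)"
    using P unfolding csums_def by (subst sums_Suc_iff[of "\<lambda>n. cf (t n) \<alpha>" for \<alpha>]) (simp add: t0)
  moreover have "csums (\<lambda>n. t (Suc n)) (T P)"
    unfolding tS by (rule cT[OF P])
  ultimately have "P - f = T P"
    unfolding csums_def by (intro pseries_eqI) (metis sums_unique2)
  then have eq: "P = f + T P" by (simp add: algebra_simps)
  have bP: "bnd w r P (2 * C)"
    unfolding bnd_def
  proof (intro allI impI)
    fix F :: "(nat \<Rightarrow>\<^sub>0 nat) set" assume F: "finite F"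
    have smF: "summable (\<lambda>n. \<Sum>\<alpha>\<in>F. norm (cf (t n) \<alpha>) * r ^ w \<alpha>)"
      by (intro summable_sum summable_mult2 sm)
    have "(\<Sum>\<alpha>\<in>F. norm (cf P \<alpha>) * r ^ w \<alpha>) \<le> (\<Sum>\<alpha>\<in>F. suminf (\<lambda>n. norm (cf (t n) \<alpha>)) * r ^ w \<alpha>)"
      unfolding P_def cf_Pser using r by (intro sum_mono mult_right_mono summable_norm sm) auto
    also have "\<dots> = (\<Sum>\<alpha>\<in>F. suminf (\<lambda>n. norm (cf (t n) \<alpha>) * r ^ w \<alpha>))"
      by (intro sum.cong suminf_mult2 sm) auto
    also have "\<dots> = suminf (\<lambda>n. \<Sum>\<alpha>\<in>F. norm (cf (t n) \<alpha>) * r ^ w \<alpha>)"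
      by (intro suminf_sum[symmetric] summable_mult2 sm)
    also have "\<dots> \<le> suminf (\<lambda>n. C * (1 / 2) ^ n)"
      using tb F by (intro suminf_le smF) (auto simp: bnd_def intro: summable_mult summable_geometric)
    also have "\<dots> = 2 * C"
      by (subst suminf_mult) (auto simp: suminf_geometric intro: summable_geometric)
    finally show "(\<Sum>\<alpha>\<in>F. norm (cf P \<alpha>) * r ^ w \<alpha>) \<le> 2 * C" .
  qed
  have "cf P \<alpha> = 0" if "\<And>g. Z g \<Longrightarrow> cf g \<alpha> = 0" for \<alpha>
    using that[OF Zt] by (simp add: P_def)
  with eq bP show ?thesis by (rule that)
qed

unbundle no vec_syntax
no_notation Matrix.vec_index (infixl \<open>$\<close> 100)
unbundle fps_syntax

declare One_nat_def [simp del]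

section \<open>Order of a series and the ring of convergent series\<close>

definition deg :: "nat \<Rightarrow> (nat \<Rightarrow>\<^sub>0 nat) \<Rightarrow> nat" where
  "deg m \<alpha> = (\<Sum>j=1..m. lookup \<alpha> j)"

text \<open>The support condition is built in, so \<open>ordge m 0 f\<close> says exactly that f is
  a series in the first m variables.\<close>

definition ordge :: "nat \<Rightarrow> nat \<Rightarrow> pseries \<Rightarrow> bool" where
  "ordge m d f \<longleftrightarrow> (\<forall>\<alpha>. cf f \<alpha> \<noteq> 0 \<longrightarrow> keys \<alpha> \<subseteq> {1..m} \<and> d \<le> deg m \<alpha>)"

definition cs :: "nat \<Rightarrow> pseries set" where
  "cs m = {f. cf f \<in> convergent_series m}"

lemma deg_add: "deg m (\<alpha> + \<beta>) = deg m \<alpha> + deg m \<beta>"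
  by (simp add: deg_def lookup_add sum.distrib)

lemma deg_0 [simp]: "deg m 0 = 0"
  by (simp add: deg_def)

lemma deg_single: "j \<in> {1..m} \<Longrightarrow> deg m (single j n) = n"
  by (simp add: deg_def lookup_single when_def)

lemma lookup_le_deg: "j \<in> {1..m} \<Longrightarrow> lookup \<alpha> j \<le> deg m \<alpha>"
  unfolding deg_def by (rule member_le_sum) auto

lemma keys_add_nat: "keys (\<alpha> + \<beta>) = keys \<alpha> \<union> keys \<beta>"
  for \<alpha> \<beta> :: "nat \<Rightarrow>\<^sub>0 nat"
  by (auto simp: in_keys_iff lookup_add)

lemma deg_eq_0: "keys \<alpha> \<subseteq> {1..m} \<Longrightarrow> deg m \<alpha> = 0 \<Longrightarrow> \<alpha> = 0"
  by (rule poly_mapping_eqI) (metis deg_def finite_atLeastAtMost in_keys_iff lookup_zero subsetD sum_eq_0_iff)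

lemma add_single_iff: "(\<exists>\<beta>. \<alpha> = single j n + \<beta>) \<longleftrightarrow> n \<le> lookup \<alpha> j"
  for \<alpha> :: "nat \<Rightarrow>\<^sub>0 nat"
proof
  assume "n \<le> lookup \<alpha> j"
  then have "\<alpha> = single j n + (\<alpha> - single j n)"
    by (intro poly_mapping_eqI) (auto simp: lookup_add lookup_minus lookup_single when_def)
  then show "\<exists>\<beta>. \<alpha> = single j n + \<beta>" ..
qed (auto simp: lookup_add)

lemma ordge_cf: "ordge m d f \<Longrightarrow> d \<le> deg m \<alpha> \<or> cf f \<alpha> = 0"
  by (auto simp: ordge_def)

lemma ordge_mono: "ordge m d f \<Longrightarrow> d' \<le> d \<Longrightarrow> ordge m d' f"
  by (meson ordge_def order_trans)

lemma ordge_add: "ordge m d f \<Longrightarrow> ordge m d g \<Longrightarrow> ordge m d (f + g)"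
  unfolding ordge_def by (metis add.left_neutral cf_add)

lemma ordge_0 [simp]: "ordge m d 0"
  by (simp add: ordge_def)

lemma ordge_uminus: "ordge m d f \<Longrightarrow> ordge m d (- f)"
  by (simp add: ordge_def)

lemma ordge_sum: "(\<And>i. i \<in> I \<Longrightarrow> ordge m d (F i)) \<Longrightarrow> ordge m d (sum F I)"
  by (induction I rule: infinite_finite_induct) (auto intro: ordge_add)

lemma ordge_mult:
  assumes "ordge m d f" "ordge m d' g"
  shows "ordge m (d + d') (f * g)"
  unfolding ordge_def
proof (intro allI impI)
  fix \<alpha>
  assume "cf (f * g) \<alpha> \<noteq> 0"
  then obtain p where "p \<in> splits \<alpha>" "(case p of (\<beta>, \<gamma>) \<Rightarrow> cf f \<beta> * cf g \<gamma>) \<noteq> 0"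
    unfolding cf_mult by (meson sum.not_neutral_contains_not_neutral)
  then obtain \<beta> \<gamma> where *: "\<beta> + \<gamma> = \<alpha>" "cf f \<beta> \<noteq> 0" "cf g \<gamma> \<noteq> 0"
    by (cases p) auto
  then show "keys \<alpha> \<subseteq> {1..m} \<and> d + d' \<le> deg m \<alpha>"
    using assms unfolding ordge_def keys_add_nat *(1)[symmetric] deg_add by (metis Un_least add_mono)
qed

lemma ordge_cst: "ordge m 0 (cst c)"
  by (auto simp: ordge_def cf_cst)

lemma ordge_mon: "keys \<alpha> \<subseteq> {1..m} \<Longrightarrow> d \<le> deg m \<alpha> \<Longrightarrow> ordge m d (mon \<alpha>)"
  by (auto simp: ordge_def cf_mon)

lemma ordge_quotx: "ordge m d f \<Longrightarrow> ordge m (d - deg m (e i)) (quotx e I i f)"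
  unfolding ordge_def cf_quotx
  by (metis Un_subset_iff deg_add diff_add_inverse diff_le_mono keys_add_nat)

lemma ordge_restx: "ordge m d f \<Longrightarrow> ordge m d (restx e I f)"
  unfolding ordge_def by (auto simp: cf_restx split: if_splits)

lemma ordge_1_iff: "ordge m 1 f \<longleftrightarrow> ordge m 0 f \<and> cf f 0 = 0"
proof (intro iffI conjI)
  assume f: "ordge m 0 f \<and> cf f 0 = 0"
  show "ordge m 1 f"
    unfolding ordge_def
  proof (intro allI impI conjI)
    fix \<alpha> assume "cf f \<alpha> \<noteq> 0"
    then show k: "keys \<alpha> \<subseteq> {1..m}" using f by (auto simp: ordge_def)
    show "1 \<le> deg m \<alpha>" using deg_eq_0[OF k] f \<open>cf f \<alpha> \<noteq> 0\<close> by (cases "deg m \<alpha>") auto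
  qed
qed (use ordge_cf[of m 1 f 0] in \<open>auto intro: ordge_mono\<close>)

text \<open>A nonnegative family is summable iff its finite partial sums are bounded, which replaces
  summability by \<open>bnd\<close>.\<close>

lemma cs_iff: "f \<in> cs m \<longleftrightarrow> ordge m 0 f \<and> (\<exists>r>0. \<exists>C. bnd (deg m) r f C)"
proof -
  have "(\<lambda>\<alpha>. norm (cf f \<alpha>) * r ^ deg m \<alpha>) summable_on UNIV \<longleftrightarrow> (\<exists>C. bnd (deg m) r f C)"
    if "r > 0" for r
  proof
    assume "(\<lambda>\<alpha>. norm (cf f \<alpha>) * r ^ deg m \<alpha>) summable_on UNIV"
    then have "bnd (deg m) r f (infsum (\<lambda>\<alpha>. norm (cf f \<alpha>) * r ^ deg m \<alpha>) UNIV)"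
      unfolding bnd_def using that by (auto intro!: finite_sum_le_infsum)
    then show "\<exists>C. bnd (deg m) r f C" ..
  next
    assume "\<exists>C. bnd (deg m) r f C"
    then show "(\<lambda>\<alpha>. norm (cf f \<alpha>) * r ^ deg m \<alpha>) summable_on UNIV"
      using that by (intro nonneg_bdd_above_summable_on) (auto simp: bnd_def bdd_above_def)
  qed
  then show ?thesis
    unfolding cs_def convergent_series_def ordge_def deg_def by auto
qed

lemma cs_I: "ordge m 0 f \<Longrightarrow> r > 0 \<Longrightarrow> bnd (deg m) r f C \<Longrightarrow> f \<in> cs m"
  by (auto simp: cs_iff)

lemma cs_ordge: "f \<in> cs m \<Longrightarrow> ordge m 0 f"
  by (auto simp: cs_iff)

lemma bnd_smaller: "bnd w r f C \<Longrightarrow> 0 < s \<Longrightarrow> s \<le> r \<Longrightarrow> bnd w s f C"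
  using bnd_le_coeffs[of w r f C f s w 1] by (simp add: mult_left_mono power_mono)

lemma cs_2:
  assumes "f \<in> cs m" "g \<in> cs m"
  obtains r C D where "r > 0" "bnd (deg m) r f C" "bnd (deg m) r g D"
proof -
  obtain r C s D where *: "r > 0" "bnd (deg m) r f C" "s > 0" "bnd (deg m) s g D"
    using assms by (auto simp: cs_iff)
  show ?thesis
    by (rule that[of "min r s" C D]) (use * bnd_smaller in \<open>auto simp: min_def\<close>)
qed

lemma cs_add [intro]: "f \<in> cs m \<Longrightarrow> g \<in> cs m \<Longrightarrow> f + g \<in> cs m"
  by (rule cs_2[of f m g]) (auto simp: cs_iff intro!: ordge_add bnd_add dest: less_imp_le)

lemma cs_mult [intro]: "f \<in> cs m \<Longrightarrow> g \<in> cs m \<Longrightarrow> f * g \<in> cs m"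
proof (rule cs_2[of f m g])
  fix r C D
  assume "f \<in> cs m" "g \<in> cs m" "r > 0" "bnd (deg m) r f C" "bnd (deg m) r g D"
  then show "f * g \<in> cs m"
    using ordge_mult[of m 0 f 0 g] by (intro cs_I[of m _ r "C * D"] bnd_mult) (auto simp: deg_add dest: cs_ordge)
qed

lemma cs_uminus [intro]: "f \<in> cs m \<Longrightarrow> - f \<in> cs m"
  by (auto simp: cs_iff intro!: ordge_uminus bnd_uminus)

lemma cs_diff [intro]: "f \<in> cs m \<Longrightarrow> g \<in> cs m \<Longrightarrow> f - g \<in> cs m"
  using cs_add[of f m "- g"] by (auto simp: cs_uminus)

lemma cs_cst [intro]: "cst c \<in> cs m"
  by (rule cs_I[of _ _ 1 "norm c * 1"])
     (use bnd_cst_mult[OF bnd_mon[of 1 "deg m" 0], of c] in \<open>auto simp: ordge_cst mon_0\<close>)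

lemma cs_0 [intro]: "0 \<in> cs m" and cs_1 [intro]: "1 \<in> cs m"
  using cs_cst[of 0 m] cs_cst[of 1 m] by (simp_all add: cst_1)

lemma cs_mon [intro]: "keys \<alpha> \<subseteq> {1..m} \<Longrightarrow> mon \<alpha> \<in> cs m"
  by (rule cs_I[of _ _ 1, OF _ _ bnd_mon]) (auto intro: ordge_mon)

lemma cs_var [intro]: "j \<in> {1..m} \<Longrightarrow> var j \<in> cs m"
  by (intro cs_mon) auto

lemma cs_sum [intro]: "(\<And>i. i \<in> I \<Longrightarrow> F i \<in> cs m) \<Longrightarrow> sum F I \<in> cs m"
  by (induction I rule: infinite_finite_induct) auto

lemma cs_prod [intro]: "(\<And>i. i \<in> I \<Longrightarrow> F i \<in> cs m) \<Longrightarrow> prod F I \<in> cs m"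
  by (induction I rule: infinite_finite_induct) auto

lemma cs_power [intro]: "f \<in> cs m \<Longrightarrow> f ^ n \<in> cs m"
  by (induction n) auto

lemma cs_quotx [intro]: "f \<in> cs m \<Longrightarrow> quotx e I i f \<in> cs m"
  unfolding cs_iff using ordge_quotx[of m 0 f] bnd_quotx[of "deg m"] deg_add by auto metis

lemma cs_le_coeffs:
  assumes "f \<in> cs m" "\<And>\<alpha>. norm (cf g \<alpha>) \<le> norm (cf f \<alpha>)"
  shows "g \<in> cs m"
proof -
  obtain r C where f: "ordge m 0 f" "r > 0" "bnd (deg m) r f C"
    using assms by (auto simp: cs_iff)
  show ?thesis
  proof (rule cs_I)
    show "ordge m 0 g"
      using f(1) assms(2) unfolding ordge_def by (metis norm_le_zero_iff norm_zero)
    show "bnd (deg m) r g (1 * C)"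
      using f assms by (intro bnd_le_coeffs[OF f(3)]) (auto intro: mult_right_mono)
  qed fact
qed

lemma cs_restx [intro]: "f \<in> cs m \<Longrightarrow> restx e I f \<in> cs m"
  by (rule cs_le_coeffs) (auto simp: cf_restx)

text \<open>Geometric series: f is its constant term times 1 - h, where h has no constant term and
  hence small norm on a small polydisc.\<close>

lemma cs_inverse:
  assumes f: "f \<in> cs m" and f0: "cf f 0 \<noteq> 0"
  obtains g where "g \<in> cs m" "f * g = 1"
proof -
  define h where "h = 1 - cst (1 / cf f 0) * f"
  have h: "h \<in> cs m" using f by (auto simp: h_def)
  then obtain r C where rC: "r > 0" "bnd (deg m) r h C" by (auto simp: cs_iff)
  have "ordge m 1 h"
    using cs_ordge[OF h] f0 by (simp add: ordge_1_iff h_def cf_one cf_cst)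
  \<comment> \<open>Chosen to have \<theta> * C \<le> 1/2. Every monomial of h has degree at least
    1, so scaling the radius by \<theta> \<le> 1 scales the norm of h by at most \<theta>.\<close>
  define \<theta> where "\<theta> = 1 / (2 * C + 1)"
  have C: "0 \<le> C" by (rule bnd_nonneg[OF rC(2)])
  then have \<theta>: "0 < \<theta>" "\<theta> \<le> 1" "\<theta> * C \<le> 1 / 2" by (auto simp: \<theta>_def field_simps)
  have "bnd (deg m) (\<theta> * r) h (\<theta> * C)"
  proof (rule bnd_le_coeffs[OF rC(2)])
    fix \<alpha>
    show "norm (cf h \<alpha>) * (\<theta> * r) ^ deg m \<alpha> \<le> \<theta> * (norm (cf h \<alpha>) * r ^ deg m \<alpha>)"
    proof (cases "cf h \<alpha> = 0")
      case False
      then have "1 \<le> deg m \<alpha>" using \<open>ordge m 1 h\<close> by (auto simp: ordge_def)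
      then have "\<theta> ^ deg m \<alpha> \<le> \<theta>" using \<theta> power_decreasing[of 1 "deg m \<alpha>" \<theta>] by simp
      then have "\<theta> ^ deg m \<alpha> * (norm (cf h \<alpha>) * r ^ deg m \<alpha>) \<le> \<theta> * (norm (cf h \<alpha>) * r ^ deg m \<alpha>)"
        using rC(1) by (intro mult_right_mono) auto
      then show ?thesis by (simp add: power_mult_distrib algebra_simps)
    qed simp
  qed (use \<theta> in auto)
  then have bh: "bnd (deg m) (\<theta> * r) h (1 / 2)" using \<theta> bnd_mono by blast
  obtain P where P: "P = 1 + h * P" "bnd (deg m) (\<theta> * r) P (2 * 1)"
      "\<And>\<alpha>. (\<And>g. ordge m 0 g \<Longrightarrow> cf g \<alpha> = 0) \<Longrightarrow> cf P \<alpha> = 0"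
  proof (rule neumann_series[of "\<theta> * r" "deg m" 1 1 "(*) h" "ordge m 0"])
    show "bnd (deg m) (\<theta> * r) 1 1"
      using bnd_mon[of "\<theta> * r" "deg m" 0] \<theta> rC by (simp add: mon_0)
    show "bnd (deg m) (\<theta> * r) (h * g) (D / 2)" if "bnd (deg m) (\<theta> * r) g D" for g D
      using bnd_mult[OF deg_add bh that] \<theta> rC by simp
    show "ordge m 0 (h * g)" if "ordge m 0 g" for g
      using ordge_mult[OF \<open>ordge m 1 h\<close> that] ordge_mono by blast
    show "ordge m 0 1" using ordge_cst[of m 1] by (simp add: cst_1)
  qed (use \<theta> rC csums_mult in auto)
  have "ordge m 0 P"
    unfolding ordge_def
  proof (intro allI impI conjI)
    fix \<alpha> assume "cf P \<alpha> \<noteq> 0"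
    then show "keys \<alpha> \<subseteq> {1..m}" using P(3)[of \<alpha>] by (auto simp: ordge_def)
  qed simp
  then have "P \<in> cs m" using P(2) \<theta> rC by (intro cs_I[of m P "\<theta> * r"]) auto
  moreover have "f * (cst (1 / cf f 0) * P) = 1"
    using P(1) by (simp add: h_def algebra_simps)
  ultimately show ?thesis by (intro that[of "cst (1 / cf f 0) * P"]) auto
qed

section \<open>Substituting univariate series\<close>

text \<open>Orders of univariate series are expressed by divisibility, which treats the zero series
  as having infinite order; \<open>subdegree 0\<close> is 0.\<close>

lemma fps_X_power_dvd_iff: "fps_X ^ n dvd (f :: 'a::field fps) \<longleftrightarrow> (\<forall>i<n. f $ i = 0)"
proof
  assume "fps_X ^ n dvd f"
  then show "\<forall>i<n. f $ i = 0"
    by (auto simp: dvd_def fps_X_power_mult_nth)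
next
  assume *: "\<forall>i<n. f $ i = 0"
  have "f = fps_X ^ n * fps_shift n f"
    using * by (intro fps_ext) (auto simp: fps_X_power_mult_nth)
  then show "fps_X ^ n dvd f" by (metis dvdI)
qed

definition mev :: "nat \<Rightarrow> (nat \<Rightarrow> complex fps) \<Rightarrow> (nat \<Rightarrow>\<^sub>0 nat) \<Rightarrow> complex fps" where
  "mev m \<eta> \<alpha> = (\<Prod>j=1..m. \<eta> j ^ lookup \<alpha> j)"

definition exps :: "nat \<Rightarrow> nat \<Rightarrow> (nat \<Rightarrow>\<^sub>0 nat) set" where
  "exps m n = {\<alpha>. keys \<alpha> \<subseteq> {1..m} \<and> deg m \<alpha> \<le> n}"

text \<open>Substitution of series \<eta> j without constant term: monomials of degree above n
  cannot reach the n-th coefficient, so finite sums suffice and no convergence is involved.\<close>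

definition ev :: "nat \<Rightarrow> (nat \<Rightarrow> complex fps) \<Rightarrow> pseries \<Rightarrow> complex fps" where
  "ev m \<eta> f = Abs_fps (\<lambda>n. \<Sum>\<alpha>\<in>exps m n. cf f \<alpha> * mev m \<eta> \<alpha> $ n)"

lemma finite_exps [simp]: "finite (exps m n)"
proof (rule finite_subset)
  show "exps m n \<subseteq> {\<alpha>. keys \<alpha> \<subseteq> {1..m} \<and> (\<forall>j. lookup \<alpha> j \<le> n)}"
  proof (auto simp: exps_def)
    fix \<alpha> j assume "keys \<alpha> \<subseteq> {1..m}" "deg m \<alpha> \<le> n"
    then show "lookup \<alpha> j \<le> n"
      using lookup_le_deg[of j m \<alpha>] by (metis in_keys_iff le_trans subsetD zero_le)
  qed
qed (rule finite_bounded_lookup, simp)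

lemma mev_add: "mev m \<eta> (\<alpha> + \<beta>) = mev m \<eta> \<alpha> * mev m \<eta> \<beta>"
  by (simp add: mev_def lookup_add power_add prod.distrib)

lemma mev_0 [simp]: "mev m \<eta> 0 = 1"
  by (simp add: mev_def)

lemma mev_single: "j \<in> {1..m} \<Longrightarrow> mev m \<eta> (single j n) = \<eta> j ^ n"
proof -
  assume j: "j \<in> {1..m}"
  have "mev m \<eta> (single j n) = (\<Prod>i=1..m. if i = j then \<eta> j ^ n else 1)"
    unfolding mev_def by (rule prod.cong) (auto simp: lookup_single when_def)
  then show ?thesis using j by simp
qed

lemma mev_dvd:
  assumes "\<And>j. j \<in> {1..m} \<Longrightarrow> fps_X ^ v j dvd \<eta> j"
  shows "fps_X ^ (\<Sum>j=1..m. v j * lookup \<alpha> j) dvd mev m \<eta> \<alpha>"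
  unfolding mev_def power_sum power_mult
  by (intro prod_dvd_prod dvd_power_same assms)

lemma mev_nth_0:
  assumes "\<And>j. j \<in> {1..m} \<Longrightarrow> fps_X dvd \<eta> j" "n < deg m \<alpha>"
  shows "mev m \<eta> \<alpha> $ n = 0"
  using mev_dvd[of m "\<lambda>_. 1" \<eta> \<alpha>] assms by (simp add: fps_X_power_dvd_iff deg_def)

context
  fixes m :: nat and \<eta> :: "nat \<Rightarrow> complex fps"
  assumes \<eta>: "\<And>j. j \<in> {1..m} \<Longrightarrow> fps_X dvd \<eta> j"
begin

text \<open>The truncation degree may be raised freely. This puts all factors in
  \<open>ev_mult\<close> over one index set.\<close>

lemma ev_nth: "n \<le> N \<Longrightarrow> ev m \<eta> f $ n = (\<Sum>\<alpha>\<in>exps m N. cf f \<alpha> * mev m \<eta> \<alpha> $ n)"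
  unfolding ev_def fps_nth_Abs_fps
  by (rule sum.mono_neutral_left[OF finite_exps]) (auto simp: exps_def intro!: mev_nth_0[OF \<eta>])

lemma ev_mult: "ev m \<eta> (f * g) = ev m \<eta> f * ev m \<eta> g"
proof (rule fps_ext)
  fix n
  let ?E = "exps m n"
  let ?t = "\<lambda>\<alpha> \<beta>. cf f \<alpha> * cf g \<beta> * (mev m \<eta> \<alpha> * mev m \<eta> \<beta>) $ n"
  have "ev m \<eta> (f * g) $ n = (\<Sum>\<gamma>\<in>?E. \<Sum>(\<alpha>, \<beta>)\<in>splits \<gamma>. ?t \<alpha> \<beta>)"
    unfolding ev_def fps_nth_Abs_fps cf_mult sum_distrib_right
    by (intro sum.cong) (auto simp: mev_add)
  also have "\<dots> = (\<Sum>(\<gamma>, \<alpha>, \<beta>)\<in>Sigma ?E splits. ?t \<alpha> \<beta>)"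
    by (subst sum.Sigma) auto
  also have "\<dots> = (\<Sum>(\<alpha>, \<beta>)\<in>{(\<alpha>, \<beta>). \<alpha> + \<beta> \<in> ?E}. ?t \<alpha> \<beta>)"
    by (rule sum.reindex_bij_witness[where i = "\<lambda>(\<alpha>, \<beta>). (\<alpha> + \<beta>, \<alpha>, \<beta>)" and j = snd]) auto
  \<comment> \<open>The added pairs have total degree above n and so contribute nothing at
    n.\<close>
  also have "\<dots> = (\<Sum>(\<alpha>, \<beta>)\<in>?E \<times> ?E. ?t \<alpha> \<beta>)"
  proof (rule sum.mono_neutral_left)
    show "{(\<alpha>, \<beta>). \<alpha> + \<beta> \<in> ?E} \<subseteq> ?E \<times> ?E"
      by (auto simp: exps_def keys_add_nat deg_add)
    show "\<forall>p\<in>?E \<times> ?E - {(\<alpha>, \<beta>). \<alpha> + \<beta> \<in> ?E}. (case p of (\<alpha>, \<beta>) \<Rightarrow> ?t \<alpha> \<beta>) = 0"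
    proof
      fix p assume "p \<in> ?E \<times> ?E - {(\<alpha>, \<beta>). \<alpha> + \<beta> \<in> ?E}"
      then obtain \<alpha> \<beta> where p: "p = (\<alpha>, \<beta>)" "\<alpha> \<in> ?E" "\<beta> \<in> ?E" "\<alpha> + \<beta> \<notin> ?E" by auto
      then have "n < deg m (\<alpha> + \<beta>)" by (auto simp: exps_def keys_add_nat)
      then show "(case p of (\<alpha>, \<beta>) \<Rightarrow> ?t \<alpha> \<beta>) = 0"
        using mev_nth_0[of m \<eta> n "\<alpha> + \<beta>", OF \<eta>] p by (simp add: mev_add)
    qed
  qed auto
  also have "\<dots> = (\<Sum>\<alpha>\<in>?E. \<Sum>\<beta>\<in>?E. \<Sum>i\<le>n. (cf f \<alpha> * mev m \<eta> \<alpha> $ i) * (cf g \<beta> * mev m \<eta> \<beta> $ (n - i)))"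
    by (simp add: sum.cartesian_product[symmetric] fps_mult_nth sum_distrib_left atLeast0AtMost algebra_simps)
  also have "\<dots> = (\<Sum>i\<le>n. (\<Sum>\<alpha>\<in>?E. cf f \<alpha> * mev m \<eta> \<alpha> $ i) * (\<Sum>\<beta>\<in>?E. cf g \<beta> * mev m \<eta> \<beta> $ (n - i)))"
    unfolding sum_product by (subst sum.swap, subst sum.swap[of _ _ "{..n}"]) (simp add: sum.swap[of _ "{..n}"])
  also have "\<dots> = (\<Sum>i\<le>n. ev m \<eta> f $ i * ev m \<eta> g $ (n - i))"
    by (intro sum.cong arg_cong2[where f = times] ev_nth[symmetric]) auto
  finally show "ev m \<eta> (f * g) $ n = (ev m \<eta> f * ev m \<eta> g) $ n"
    by (simp add: fps_mult_nth atLeast0AtMost)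
qed

lemma ev_add: "ev m \<eta> (f + g) = ev m \<eta> f + ev m \<eta> g"
  by (rule fps_ext) (simp add: ev_def algebra_simps sum.distrib)

lemma ev_0 [simp]: "ev m \<eta> 0 = 0"
  by (rule fps_ext) (simp add: ev_def)

lemma ev_uminus: "ev m \<eta> (- f) = - ev m \<eta> f"
  by (rule fps_ext) (simp add: ev_def sum_negf)

lemma ev_diff: "ev m \<eta> (f - g) = ev m \<eta> f - ev m \<eta> g"
  using ev_add[of f "- g"] by (simp add: ev_uminus)

lemma ev_sum: "ev m \<eta> (sum F I) = (\<Sum>i\<in>I. ev m \<eta> (F i))"
  by (induction I rule: infinite_finite_induct) (auto simp: ev_add)

lemma ev_mon: "keys \<alpha> \<subseteq> {1..m} \<Longrightarrow> ev m \<eta> (mon \<alpha>) = mev m \<eta> \<alpha>"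
proof (rule fps_ext)
  fix n assume \<alpha>: "keys \<alpha> \<subseteq> {1..m}"
  have "ev m \<eta> (mon \<alpha>) $ n = (\<Sum>\<beta>\<in>exps m n. if \<beta> = \<alpha> then mev m \<eta> \<alpha> $ n else 0)"
    unfolding ev_def fps_nth_Abs_fps by (rule sum.cong) (auto simp: cf_mon)
  also have "\<dots> = mev m \<eta> \<alpha> $ n"
    using \<alpha> mev_nth_0[of m \<eta> n \<alpha>, OF \<eta>] sum.delta[OF finite_exps, of \<alpha> "\<lambda>_. mev m \<eta> \<alpha> $ n" m n]
    by (cases "n < deg m \<alpha>") (simp_all add: exps_def)
  finally show "ev m \<eta> (mon \<alpha>) $ n = mev m \<eta> \<alpha> $ n" .
qed

lemma ev_one [simp]: "ev m \<eta> 1 = 1"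
  using ev_mon[of 0] by (simp add: mon_0)

lemma ev_power: "ev m \<eta> (f ^ n) = ev m \<eta> f ^ n"
  by (induction n) (auto simp: ev_mult)

lemma ev_var: "j \<in> {1..m} \<Longrightarrow> ev m \<eta> (var j) = \<eta> j"
  by (subst ev_mon) (auto simp: mev_single)

lemma ev_cst: "ev m \<eta> (cst c) = fps_const c"
proof (rule fps_ext)
  fix n
  have "ev m \<eta> (cst c) $ n = (\<Sum>\<beta>\<in>exps m n. if \<beta> = 0 then c * (1 :: complex fps) $ n else 0)"
    unfolding ev_def fps_nth_Abs_fps by (rule sum.cong) (auto simp: cf_cst)
  then show "ev m \<eta> (cst c) $ n = fps_const c $ n"
    using finite_exps[of m n] by (cases n) (simp_all add: sum.delta, simp_all add: exps_def)
qed

lemma ev_nth_zero: "ev m \<eta> f $ 0 = cf f 0"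
proof -
  have "exps m 0 = {0}" using deg_eq_0 by (auto simp: exps_def)
  then show ?thesis by (simp add: ev_def)
qed

lemma ev_dvd:
  assumes "\<And>\<alpha>. keys \<alpha> \<subseteq> {1..m} \<Longrightarrow> cf f \<alpha> \<noteq> 0 \<Longrightarrow> fps_X ^ K dvd mev m \<eta> \<alpha>"
  shows "fps_X ^ K dvd ev m \<eta> f"
  unfolding fps_X_power_dvd_iff ev_def fps_nth_Abs_fps
proof (intro allI impI sum.neutral ballI)
  fix i \<alpha> assume "i < K" "\<alpha> \<in> exps m i"
  then show "cf f \<alpha> * mev m \<eta> \<alpha> $ i = 0"
    using assms[of \<alpha>] by (cases "cf f \<alpha> = 0") (auto simp: fps_X_power_dvd_iff exps_def)
qed

end

section \<open>Roots of univariate power series\<close>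

lemma fps_X_power_dvd_power:
  fixes f :: "'a::field fps"
  assumes "fps_X ^ (n * v) dvd f ^ n" "0 < n"
  shows "fps_X ^ v dvd f"
proof (cases "f = 0")
  case False
  then have "n * v \<le> subdegree (f ^ n)"
    using assms by (subst (asm) fps_dvd_iff) auto
  then have "v \<le> subdegree f" using assms by simp
  then show ?thesis using False by (subst fps_dvd_iff) auto
qed simp

lemma fps_nth_root_exists:
  fixes h :: "complex fps"
  assumes "h $ 0 \<noteq> 0" "0 < n"
  obtains g where "g ^ n = h"
proof -
  obtain w where w: "h $ 0 = w ^ n" using assms exists_complex_root[of n "h $ 0"] by blast
  obtain k where n: "n = Suc k" using assms gr0_implies_Suc by blast
  have "fps_radical (\<lambda>_ _. w) (Suc k) h ^ Suc k = h"
    using power_radical[of h "\<lambda>_ _. w" k] assms w n by simp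
  then show ?thesis using that n by blast
qed

text \<open>The monomial of lower order is split off; it has an n-th root since n divides L. The
  cofactor has nonzero constant term, hence also a root, unless the binomial degenerates to a
  monomial.\<close>

lemma fps_binomial_root_exists:
  fixes A B :: complex
  assumes "0 < n" "n dvd L" "b \<le> c"
  obtains g where "g ^ n = fps_const A * fps_X ^ (L * b) + fps_const B * fps_X ^ (L * c)"
proof -
  obtain l where L: "L = n * l" using assms by blast
  have const: "\<exists>z. z ^ n = w" for w :: complex
    using exists_complex_root[of n w] assms by auto
  have mono: "\<exists>g. g ^ n = fps_const w * fps_X ^ (L * d)" for w :: complex and d
  proof -
    obtain z where "z ^ n = w" using const by blast
    then have "(fps_const z * fps_X ^ (l * d)) ^ n = fps_const w * fps_X ^ (L * d)"
      by (simp add: power_mult_distrib fps_const_power L power_mult[symmetric] algebra_simps)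
    then show ?thesis ..
  qed
  consider "b = c" | "b < c" "A = 0" | "b < c" "A \<noteq> 0" using assms by linarith
  then show ?thesis
  proof cases
    case 1
    then show ?thesis
      using mono[of "A + B" b] that by (auto simp: fps_const_add[symmetric] distrib_right simp del: fps_const_add)
  next
    case 2
    then show ?thesis using mono[of B c] that by auto
  next
    case 3
    show ?thesis
    proof (cases "L = 0")
      case True
      then show ?thesis
        using mono[of "A + B" 0] that by (auto simp: fps_const_add[symmetric] distrib_right simp del: fps_const_add)
    next
      case False
      define h where "h = fps_const A + fps_const B * fps_X ^ (L * (c - b))"
      have "h $ 0 \<noteq> 0" using 3 False by (simp add: h_def)
      then obtain g where g: "g ^ n = h" using fps_nth_root_exists assms by blast
      have "(fps_X ^ (l * b) * g) ^ n = fps_X ^ (L * b) * h"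
        by (simp add: power_mult_distrib g L power_mult[symmetric] algebra_simps)
      also have "\<dots> = fps_const A * fps_X ^ (L * b) + fps_const B * (fps_X ^ (L * b) * fps_X ^ (L * (c - b)))"
        by (simp add: h_def algebra_simps)
      also have "fps_X ^ (L * b) * fps_X ^ (L * (c - b)) = (fps_X ^ (L * c) :: complex fps)"
        using \<open>b \<le> c\<close> by (simp add: power_add[symmetric] distrib_left[symmetric])
      finally show ?thesis by (rule that)
    qed
  qed
qed

section \<open>Scaling the variables by constants\<close>

definition chi :: "nat \<Rightarrow> (nat \<Rightarrow> complex) \<Rightarrow> (nat \<Rightarrow>\<^sub>0 nat) \<Rightarrow> complex" where
  "chi m \<zeta> \<alpha> = (\<Prod>j=1..m. \<zeta> j ^ lookup \<alpha> j)"

definition tw :: "nat \<Rightarrow> (nat \<Rightarrow> complex) \<Rightarrow> pseries \<Rightarrow> pseries" where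
  "tw m \<zeta> f = Pser (\<lambda>\<alpha>. chi m \<zeta> \<alpha> * cf f \<alpha>)"

lemma chi_add: "chi m \<zeta> (\<alpha> + \<beta>) = chi m \<zeta> \<alpha> * chi m \<zeta> \<beta>"
  by (simp add: chi_def lookup_add power_add prod.distrib)

lemma chi_mult: "chi m (\<lambda>j. \<zeta> j * \<tau> j) \<alpha> = chi m \<zeta> \<alpha> * chi m \<tau> \<alpha>"
  by (simp add: chi_def power_mult_distrib prod.distrib)

lemma cf_tw [simp]: "cf (tw m \<zeta> f) \<alpha> = chi m \<zeta> \<alpha> * cf f \<alpha>"
  by (simp add: tw_def)

lemma tw_mult: "tw m \<zeta> (f * g) = tw m \<zeta> f * tw m \<zeta> g"
  by (rule pseries_eqI)
     (auto simp: cf_mult sum_distrib_left chi_add algebra_simps intro!: sum.cong)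

lemma tw_1: "tw m \<zeta> 1 = 1"
  by (rule pseries_eqI) (simp add: cf_one chi_def)

lemma tw_add: "tw m \<zeta> (f + g) = tw m \<zeta> f + tw m \<zeta> g"
  by (rule pseries_eqI) (simp add: algebra_simps)

lemma tw_uminus: "tw m \<zeta> (- f) = - tw m \<zeta> f"
  by (rule pseries_eqI) simp

lemma tw_diff: "tw m \<zeta> (f - g) = tw m \<zeta> f - tw m \<zeta> g"
  by (rule pseries_eqI) (simp add: algebra_simps)

lemma tw_0 [simp]: "tw m \<zeta> 0 = 0"
  by (rule pseries_eqI) simp

lemma tw_sum: "tw m \<zeta> (sum F I) = (\<Sum>i\<in>I. tw m \<zeta> (F i))"
  by (induction I rule: infinite_finite_induct) (auto simp: tw_add)

lemma tw_prod: "tw m \<zeta> (prod F I) = (\<Prod>i\<in>I. tw m \<zeta> (F i))"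
  by (induction I rule: infinite_finite_induct) (auto simp: tw_mult tw_1)

lemma tw_tw: "tw m \<zeta> (tw m \<tau> f) = tw m (\<lambda>j. \<zeta> j * \<tau> j) f"
  by (rule pseries_eqI) (simp add: chi_mult)

text \<open>Twisting the series is the same as moving the arc, so a condition imposed on all arcs is
  invariant under twists that permute the arcs.\<close>

lemma ev_tw: "ev m \<eta> (tw m \<zeta> f) = ev m (\<lambda>j. fps_const (\<zeta> j) * \<eta> j) f"
proof -
  have "mev m (\<lambda>j. fps_const (\<zeta> j) * \<eta> j) \<alpha> = fps_const (chi m \<zeta> \<alpha>) * mev m \<eta> \<alpha>" for \<alpha>
  proof -
    have "(\<Prod>j\<in>S. fps_const (\<zeta> j ^ lookup \<alpha> j)) = fps_const (\<Prod>j\<in>S. \<zeta> j ^ lookup \<alpha> j)" for S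
      by (induction S rule: infinite_finite_induct) auto
    then show ?thesis
      by (simp add: mev_def chi_def power_mult_distrib prod.distrib fps_const_power)
  qed
  then show ?thesis by (intro fps_ext) (simp add: ev_def algebra_simps)
qed

lemma cs_tw:
  assumes "f \<in> cs m" "\<And>j. norm (\<zeta> j) = 1"
  shows "tw m \<zeta> f \<in> cs m"
  using assms by (intro cs_le_coeffs[OF assms(1)])
    (simp add: norm_mult chi_def prod_norm[symmetric] norm_power)

section \<open>Reduction to normal form\<close>

text \<open>The condition on \<open>p\<close> makes x_i vanish to order exactly \<open>wt i\<close>
  along generic arcs.\<close>

locale brieskorn_nf =
  fixes m :: nat and a :: "nat \<Rightarrow> nat" and p r :: "nat \<Rightarrow> complex"
  assumes m3: "3 \<le> m" and a2: "\<And>j. j \<in> {1..m} \<Longrightarrow> 2 \<le> a j" and a_mono: "mono_on {1..m} a"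
    and p_nz: "\<And>i. i \<in> {1..m-2} \<Longrightarrow> p i \<noteq> 0"
begin

definition G :: "nat \<Rightarrow> pseries" where
  "G i = var i ^ a i + (cst (p i) * var (m-1) ^ a (m-1) + cst (r i) * var m ^ a m)"

definition J :: "pseries set" where
  "J = {\<Sum>i=1..m-2. G i * F i | F. \<forall>i. F i \<in> cs m}"

definition reduced :: "pseries \<Rightarrow> bool" where
  "reduced N \<longleftrightarrow> (\<forall>\<alpha>. cf N \<alpha> \<noteq> 0 \<longrightarrow> (\<forall>i\<in>{1..m-2}. lookup \<alpha> i < a i))"

lemma in_vars [simp]: "m - 1 \<in> {1..m}" "m \<in> {1..m}" "i \<in> {1..m-2} \<Longrightarrow> i \<in> {1..m}"
  using m3 by auto

lemma a_pos [simp]: "j \<in> {1..m} \<Longrightarrow> 0 < a j"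
  using a2[of j] by auto

lemma a_le: "i \<in> {1..m-2} \<Longrightarrow> a i \<le> a (m - 1)" "a (m - 1) \<le> a m"
  using m3 by (auto intro!: mono_onD[OF a_mono])

lemma G_cs [intro]: "i \<in> {1..m-2} \<Longrightarrow> G i \<in> cs m"
  unfolding G_def by (intro cs_add cs_mult cs_cst cs_power cs_var) auto

lemma J_cs: "f \<in> J \<Longrightarrow> f \<in> cs m"
  unfolding J_def by auto

lemma J_add: "f \<in> J \<Longrightarrow> g \<in> J \<Longrightarrow> f + g \<in> J"
proof -
  assume "f \<in> J" "g \<in> J"
  then obtain F H where "f = (\<Sum>i=1..m-2. G i * F i)" "\<forall>i. F i \<in> cs m"
    "g = (\<Sum>i=1..m-2. G i * H i)" "\<forall>i. H i \<in> cs m" by (auto simp: J_def)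
  then have "f + g = (\<Sum>i=1..m-2. G i * (F i + H i))" "\<forall>i. F i + H i \<in> cs m"
    by (auto simp: algebra_simps sum.distrib)
  then show ?thesis unfolding J_def mem_Collect_eq by (intro exI[of _ "\<lambda>i. F i + H i"]) simp
qed

lemma J_mult: "f \<in> J \<Longrightarrow> g \<in> cs m \<Longrightarrow> f * g \<in> J"
proof -
  assume "f \<in> J" and g: "g \<in> cs m"
  then obtain F where "f = (\<Sum>i=1..m-2. G i * F i)" "\<forall>i. F i \<in> cs m" by (auto simp: J_def)
  then have "f * g = (\<Sum>i=1..m-2. G i * (F i * g))" "\<forall>i. F i * g \<in> cs m"
    using g by (auto simp: sum_distrib_right mult.assoc)
  then show ?thesis unfolding J_def mem_Collect_eq by (intro exI[of _ "\<lambda>i. F i * g"]) simp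
qed

lemma J_mult': "f \<in> J \<Longrightarrow> g \<in> cs m \<Longrightarrow> g * f \<in> J"
  using J_mult by (simp add: mult.commute)

lemma J_uminus: "f \<in> J \<Longrightarrow> - f \<in> J"
  using J_mult[of f "- 1"] cs_uminus[OF cs_1] by simp

lemma J_diff: "f \<in> J \<Longrightarrow> g \<in> J \<Longrightarrow> f - g \<in> J"
  using J_add[of f "- g"] J_uminus[of g] by simp

lemma J_0 [simp]: "0 \<in> J"
  unfolding J_def by (auto intro!: exI[of _ "\<lambda>_. 0"])

text \<open>The powers \<open>x\<^sub>i\<^bsup>a i\<^esup>\<close> of all variables but the last two are replaced by \<open>x\<^sub>i\<^bsup>a i\<^esup> - G i\<close>, iterated
  as a Neumann series. Giving the last two variables weight \<open>2\<close> makes this a contraction.\<close>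

lemma division:
  assumes f: "f \<in> cs m" and d: "ordge m d f"
  obtains N where "N \<in> cs m" "reduced N" "ordge m d N" "f - N \<in> J"
proof -
  define e where "e i = single i (a i)" for i
  define I where "I = {1..m-2}"
  define w where "w \<alpha> = deg m \<alpha> + lookup \<alpha> (m - 1) + lookup \<alpha> m" for \<alpha>
  define g where "g i = cst (p i) * var (m-1) ^ a (m-1) + cst (r i) * var m ^ a m" for i
  \<comment> \<open>A fixed point P = f + T P means f = P + \<Sum> g_i q_i with q_i the quotients of
    P. Decomposing P by \<open>quotx_decompose\<close> turns this into the rest of P plus \<Sum> G_i
    q_i.\<close>
  define T where "T h = - (\<Sum>i\<in>I. g i * quotx e I i h)" for h
  define K where "K = (\<Sum>i\<in>I. norm (p i) + norm (r i))"
  have K: "0 \<le> K" unfolding K_def by (rule sum_nonneg) simp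
  obtain r0 C where r0: "0 < r0" "bnd (deg m) r0 f C" using f by (auto simp: cs_iff)
  \<comment> \<open>The radius must stay within that of f, be at most 1 so that higher weight means
    smaller terms, and satisfy K * s \<le> 1/2, the contraction rate.\<close>
  define s where "s = min r0 (1 / (2 * K + 1))"
  have s: "0 < s" "s \<le> r0" "s \<le> 1" "K * s \<le> 1 / 2"
  proof -
    show "0 < s" "s \<le> r0" "s \<le> 1" using K r0 by (auto simp: s_def min_le_iff_disj)
    have "K * s \<le> K * (1 / (2 * K + 1))" using K by (intro mult_left_mono) (auto simp: s_def)
    also have "\<dots> \<le> 1 / 2" using K by (simp add: field_simps)
    finally show "K * s \<le> 1 / 2" .
  qed
  have w_add: "w (\<alpha> + \<beta>) = w \<alpha> + w \<beta>" for \<alpha> \<beta>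
    by (simp add: w_def deg_add lookup_add)
  have we: "w (e i) = a i" if "i \<in> I" for i
    using that m3 by (auto simp: w_def e_def deg_single lookup_single when_def I_def)
  have wy: "w (single (m-1) n) = 2 * n" "w (single m n) = 2 * n" for n
    using m3 deg_single[of "m-1" m n] deg_single[of m m n] by (auto simp: w_def lookup_single when_def)
  have g_bnd: "bnd w s (g i) ((norm (p i) + norm (r i)) * s ^ (2 * a (m-1)))" for i
  proof -
    have "bnd w s (g i) (norm (p i) * s ^ (2 * a (m-1)) + norm (r i) * s ^ (2 * a m))"
      unfolding g_def var_power using s
      by (intro bnd_add bnd_cst_mult) (use bnd_mon[of s w] wy in \<open>metis less_imp_le\<close>)+
    moreover have "norm (p i) * s ^ (2 * a (m-1)) + norm (r i) * s ^ (2 * a m)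
        \<le> (norm (p i) + norm (r i)) * s ^ (2 * a (m-1))"
      unfolding distrib_right using s a_le by (intro add_left_mono mult_left_mono power_decreasing) auto
    ultimately show ?thesis by (rule bnd_mono)
  qed
  have f_bnd: "bnd w s f C"
  proof -
    have "bnd w s f (1 * C)"
    proof (rule bnd_le_coeffs[OF bnd_smaller[OF r0(2) s(1,2)]])
      fix \<alpha>
      have "s ^ w \<alpha> \<le> s ^ deg m \<alpha>" using s by (intro power_decreasing) (auto simp: w_def)
      then show "norm (cf f \<alpha>) * s ^ w \<alpha> \<le> 1 * (norm (cf f \<alpha>) * s ^ deg m \<alpha>)"
        by (simp add: mult_left_mono)
    qed simp
    then show ?thesis by simp
  qed
  obtain P where P: "P = f + T P" "bnd w s P (2 * C)"
      "\<And>\<alpha>. (\<And>g. ordge m d g \<Longrightarrow> cf g \<alpha> = 0) \<Longrightarrow> cf P \<alpha> = 0"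
  proof (rule neumann_series[of s w f C T "ordge m d"])
    fix h D assume h: "bnd w s h D"
    have D: "0 \<le> D" by (rule bnd_nonneg[OF h])
    have "bnd w s (T h) (\<Sum>i\<in>I. (norm (p i) + norm (r i)) * s ^ (2 * a (m-1)) * (D / s ^ a i))"
      unfolding T_def
    proof (intro bnd_uminus bnd_sum)
      fix i assume "i \<in> I"
      then show "bnd w s (g i * quotx e I i h) ((norm (p i) + norm (r i)) * s ^ (2 * a (m-1)) * (D / s ^ a i))"
        using bnd_mult[OF w_add g_bnd[of i] bnd_quotx[OF w_add h s(1), of e I i]] we[of i] s(1) by simp
    qed (use s in auto)
    moreover have "(\<Sum>i\<in>I. (norm (p i) + norm (r i)) * s ^ (2 * a (m-1)) * (D / s ^ a i)) \<le> (\<Sum>i\<in>I. (norm (p i) + norm (r i)) * (s * D))"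
    proof (rule sum_mono)
      fix i assume "i \<in> I"
      then have i: "a i \<le> a (m-1)" "2 \<le> a (m-1)" using a_le a2[of "m-1"] in_vars by (auto simp: I_def)
      then have "s ^ (2 * a (m-1)) = s ^ (2 * a (m-1) - a i) * s ^ a i"
        by (simp add: power_add[symmetric])
      \<comment> \<open>Here 2b - a_i \<ge> b \<ge> 1. With the plain degree as weight the gain
        would be s^(b - a_i), which is 1 when a_i = b.\<close>
      moreover have "s ^ (2 * a (m-1) - a i) \<le> s ^ 1"
        using s i by (intro power_decreasing) auto
      ultimately have "s ^ (2 * a (m-1)) * (D / s ^ a i) \<le> s * D"
        using s D by (auto intro: mult_right_mono)
      then show "(norm (p i) + norm (r i)) * s ^ (2 * a (m-1)) * (D / s ^ a i) \<le> (norm (p i) + norm (r i)) * (s * D)"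
        unfolding mult.assoc by (intro mult_left_mono) auto
    qed
    moreover have "(\<Sum>i\<in>I. (norm (p i) + norm (r i)) * (s * D)) \<le> D / 2"
      unfolding sum_distrib_right[symmetric] K_def[symmetric]
      using mult_right_mono[OF s(4) D] by (simp add: algebra_simps)
    ultimately show "bnd w s (T h) (D / 2)" using bnd_mono by (meson order_trans)
  next
    fix t P assume "csums t P"
    then have "csums (\<lambda>n. \<Sum>i\<in>I. g i * quotx e I i (t n)) (\<Sum>i\<in>I. g i * quotx e I i P)"
      by (intro csums_sum csums_mult csums_quotx)
    then show "csums (\<lambda>n. T (t n)) (T P)"
      unfolding T_def csums_def cf_minus by (auto intro: sums_minus)
  next
    fix h assume h: "ordge m d h"
    show "ordge m d (T h)"
      unfolding T_def
    proof (intro ordge_uminus ordge_sum)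
      fix i assume "i \<in> I"
      then have i: "a i \<le> a (m-1)" "a (m-1) \<le> a m" "deg m (e i) = a i"
        using a_le by (auto simp: I_def e_def deg_single)
      have "ordge m (0 + a (m-1)) (cst (p i) * mon (single (m-1) (a (m-1))))"
        "ordge m (0 + a (m-1)) (cst (r i) * mon (single m (a m)))"
        using i deg_single[of m m "a m"] deg_single[of "m-1" m "a (m-1)"] in_vars
        by (intro ordge_mult ordge_cst ordge_mon; auto simp: I_def)+
      then have "ordge m (a (m-1)) (g i)"
        unfolding g_def var_power by (intro ordge_add) simp_all
      \<comment> \<open>Since a_i \<le> b, trading x_i^(a_i) for g_i does not lower the
        order.\<close>
      then have "ordge m (a (m-1) + (d - deg m (e i))) (g i * quotx e I i h)"
        by (intro ordge_mult ordge_quotx h)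
      then show "ordge m d (g i * quotx e I i h)"
        using i by (auto intro: ordge_mono)
    qed
  qed (use s f_bnd d in auto)
  have P_ord: "ordge m d P"
    unfolding ordge_def
  proof (intro allI impI)
    fix \<alpha> assume "cf P \<alpha> \<noteq> 0"
    then obtain g where "ordge m d g" "cf g \<alpha> \<noteq> 0" using P(3) by blast
    then show "keys \<alpha> \<subseteq> {1..m} \<and> d \<le> deg m \<alpha>" by (auto simp: ordge_def)
  qed
  \<comment> \<open>As \<open>w\<close> is at most twice the degree, a bound at radius s for
    \<open>w\<close> gives one at radius s^2 for the degree.\<close>
  have "bnd (deg m) (s ^ 2) P (1 * (2 * C))"
  proof (rule bnd_le_coeffs[OF P(2)])
    fix \<alpha> :: "nat \<Rightarrow>\<^sub>0 nat"
    have "lookup \<alpha> (m - 1) + lookup \<alpha> m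
        = (\<Sum>j\<in>{m-1, m}. lookup \<alpha> j)" using m3 by (subst sum.insert) auto
    also have "\<dots> \<le> deg m \<alpha>" unfolding deg_def using m3 by (intro sum_mono2) auto
    finally have "(s ^ 2) ^ deg m \<alpha> \<le> s ^ w \<alpha>"
      using s unfolding power_mult[symmetric] by (intro power_decreasing) (auto simp: w_def)
    then show "norm (cf P \<alpha>) * (s ^ 2) ^ deg m \<alpha> \<le> 1 * (norm (cf P \<alpha>) * s ^ w \<alpha>)"
      by (simp add: mult_left_mono)
  qed simp
  then have P_cs: "P \<in> cs m"
    using s P_ord by (intro cs_I) (auto intro: ordge_mono)
  define N where "N = restx e I P"
  have "f = N + (\<Sum>i\<in>I. G i * quotx e I i P)"
  proof -
    have "f = P + (\<Sum>i\<in>I. g i * quotx e I i P)"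
      using P(1) by (simp add: T_def algebra_simps)
    also have "\<dots> = N + (\<Sum>i\<in>I. mon (e i) * quotx e I i P) + (\<Sum>i\<in>I. g i * quotx e I i P)"
      unfolding N_def using quotx_decompose[of I P e] by (simp only: I_def finite_atLeastAtMost add.commute)
    also have "\<dots> = N + (\<Sum>i\<in>I. G i * quotx e I i P)"
      by (simp add: G_def g_def e_def var_power distrib_right sum.distrib)
    finally show ?thesis .
  qed
  then have "f - N \<in> J"
    unfolding J_def mem_Collect_eq I_def
    using P_cs by (intro exI[of _ "\<lambda>i. quotx e {1..m-2} i P"]) (auto simp: algebra_simps)
  moreover have "reduced N"
    unfolding reduced_def N_def cf_restx e_def add_single_iff I_def by (auto simp: not_le)
  moreover have "N \<in> cs m" "ordge m d N"
    using P_cs P_ord by (auto simp: N_def intro: ordge_restx)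
  ultimately show ?thesis using that by blast
qed

end

section \<open>Arcs and the order filtration\<close>

declare atLeastAtMost_iff [simp del]

context brieskorn_nf
begin

lemma not_in_vars [simp]: "m - 1 \<notin> {1..m-2}" "m \<notin> {1..m-2}" "m - 1 \<noteq> m" "m \<noteq> m - 1"
  using m3 by (auto simp: atLeastAtMost_iff)

lemma vars_split: "{1..m} = {1..m-2} \<union> {m-1, m}"
  using m3 by (auto simp: atLeastAtMost_iff)

definition L :: nat where
  "L = (\<Prod>i=1..m-2. a i)"

text \<open>An arc sends the last two variables to multiples of \<open>s\<^bsup>L\<^esup>\<close>, where \<open>s\<close> is \<open>fps_X\<close>, and lies on
  the surface. The exponent \<open>L\<close> makes all the roots needed for the other coordinates exist.\<close>

definition arc :: "complex \<Rightarrow> complex \<Rightarrow> (nat \<Rightarrow> complex fps) \<Rightarrow> bool" where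
  "arc y z \<eta> \<longleftrightarrow> \<eta> (m-1) = fps_const y * fps_X ^ L \<and> \<eta> m = fps_const z * fps_X ^ L \<and>
     (\<forall>i\<in>{1..m-2}. \<eta> i ^ a i
        + (fps_const (p i) * \<eta> (m-1) ^ a (m-1) + fps_const (r i) * \<eta> m ^ a m) = 0)"

text \<open>The orders of vanishing of the coordinates along a generic arc.\<close>

definition wt :: "nat \<Rightarrow> nat" where
  "wt j = (if j \<in> {1..m-2} then L div a j * a (m-1) else L)"

text \<open>\<open>L\<close> times the rational weight that gives the last two variables weight
  1.\<close>

definition Wt :: "(nat \<Rightarrow>\<^sub>0 nat) \<Rightarrow> nat" where
  "Wt \<alpha> = (\<Sum>j=1..m. wt j * lookup \<alpha> j)"

text \<open>Order at least K along every arc, generic or not. Invariance under J and under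
  \<open>grp\<close> is then immediate; \<open>wc_nf\<close> computes it from the normal
  form.\<close>

definition wc :: "nat \<Rightarrow> pseries \<Rightarrow> bool" where
  "wc K f \<longleftrightarrow> (\<forall>y z \<eta>. arc y z \<eta> \<longrightarrow> fps_X ^ K dvd ev m \<eta> f)"

lemma L_pos: "0 < L"
  unfolding L_def by (intro prod_pos) auto

lemma a_dvd_L: "i \<in> {1..m-2} \<Longrightarrow> a i dvd L"
  unfolding L_def by (intro dvd_prodI) auto

lemma wt_simps: "wt (m-1) = L" "wt m = L"
  using m3 by (auto simp: wt_def)

lemma a_wt: "i \<in> {1..m-2} \<Longrightarrow> a i * wt i = L * a (m-1)"
  using a_dvd_L[of i] by (simp add: wt_def mult.assoc[symmetric])

lemma wt_ge: "L \<le> wt j"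
proof (cases "j \<in> {1..m-2}")
  case True
  then have "L = L div a j * a j" using a_dvd_L by simp
  also have "\<dots> \<le> L div a j * a (m-1)" using a_le True by (intro mult_left_mono) auto
  finally show ?thesis using True by (simp add: wt_def)
qed (simp add: wt_def)

lemma wt_pos: "0 < wt j"
  using wt_ge[of j] L_pos by linarith

lemma deg_le_Wt: "L * deg m \<alpha> \<le> Wt \<alpha>"
  unfolding deg_def Wt_def sum_distrib_left by (intro sum_mono mult_right_mono wt_ge) auto

lemma Wt_add: "Wt (\<alpha> + \<beta>) = Wt \<alpha> + Wt \<beta>"
  by (simp add: Wt_def lookup_add distrib_left sum.distrib)

text \<open>The a_i-th power of the coordinate combines s^(L b) and s^(L c) with b \<le> c, so it
  has order at least L b; extracting the root divides this by a_i.\<close>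

lemma arc_dvd:
  assumes "arc y z \<eta>" "j \<in> {1..m}"
  shows "fps_X ^ wt j dvd \<eta> j"
proof (cases "j \<in> {1..m-2}")
  case True
  have y: "fps_X ^ (L * a (m-1)) dvd fps_const (p j) * \<eta> (m-1) ^ a (m-1)"
    using assms(1) by (auto simp: arc_def power_mult_distrib power_mult)
  have "(fps_X :: complex fps) ^ (L * a (m-1)) dvd fps_X ^ (L * a m)"
    using a_le(2) by (intro le_imp_power_dvd) auto
  then have z: "fps_X ^ (L * a (m-1)) dvd fps_const (r j) * \<eta> m ^ a m"
    using assms(1) by (auto simp: arc_def power_mult_distrib power_mult[symmetric] intro: dvd_mult)
  have "\<eta> j ^ a j = - (fps_const (p j) * \<eta> (m-1) ^ a (m-1) + fps_const (r j) * \<eta> m ^ a m)"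
    using assms True unfolding arc_def by (metis eq_neg_iff_add_eq_0)
  then have "fps_X ^ (a j * wt j) dvd \<eta> j ^ a j"
    using dvd_add[OF y z] a_wt[OF True] by (metis dvd_minus_iff)
  then show ?thesis by (rule fps_X_power_dvd_power) (rule a_pos[OF assms(2)])
next
  case False
  then have "j = m - 1 \<or> j = m" using assms(2) by (auto simp: vars_split)
  then show ?thesis using assms(1) wt_simps by (auto simp: arc_def)
qed

lemma arc_X_dvd: "arc y z \<eta> \<Longrightarrow> j \<in> {1..m} \<Longrightarrow> fps_X dvd \<eta> j"
  by (rule dvd_trans[OF dvd_power arc_dvd]) (use wt_pos in auto)

text \<open>Any y and z are allowed, including 0: every a_i divides L, so the binomials in s^(L b)
  and s^(L c) have the required roots.\<close>

lemma arc_exists: obtains \<eta> where "arc y z \<eta>"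
proof -
  have "\<exists>g. g ^ a i + (fps_const (p i) * (fps_const y * fps_X ^ L) ^ a (m-1)
      + fps_const (r i) * (fps_const z * fps_X ^ L) ^ a m) = 0" if i: "i \<in> {1..m-2}" for i
  proof -
    obtain g where "g ^ a i = fps_const (- (p i * y ^ a (m-1))) * fps_X ^ (L * a (m-1))
        + fps_const (- (r i * z ^ a m)) * fps_X ^ (L * a m)"
      by (rule fps_binomial_root_exists[of "a i" L "a (m-1)" "a m"]) (use a_dvd_L i a_le(2) in auto)
    then show ?thesis
      by (intro exI[of _ g])
         (simp add: power_mult_distrib power_mult fps_const_power mult.assoc[symmetric]
           fps_const_neg[symmetric] del: fps_const_neg)
  qed
  then obtain g where g: "\<And>i. i \<in> {1..m-2} \<Longrightarrow>
      g i ^ a i + (fps_const (p i) * (fps_const y * fps_X ^ L) ^ a (m-1)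
      + fps_const (r i) * (fps_const z * fps_X ^ L) ^ a m) = 0" by metis
  define \<eta> where "\<eta> j = (if j = m then fps_const z * fps_X ^ L
    else if j = m - 1 then fps_const y * fps_X ^ L else g j)" for j
  have "\<eta> i = g i" if "i \<in> {1..m-2}" for i
    using that by (auto simp: \<eta>_def)
  moreover have "\<eta> m = fps_const z * fps_X ^ L" "\<eta> (m-1) = fps_const y * fps_X ^ L"
    using m3 by (auto simp: \<eta>_def)
  ultimately have "arc y z \<eta>" unfolding arc_def using g by simp
  then show ?thesis by (rule that)
qed

lemma ev_G:
  assumes "arc y z \<eta>" "i \<in> {1..m-2}"
  shows "ev m \<eta> (G i) = 0"
proof -
  have "\<eta> i ^ a i + (fps_const (p i) * \<eta> (m-1) ^ a (m-1) + fps_const (r i) * \<eta> m ^ a m) = 0"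
    using assms unfolding arc_def by blast
  then show ?thesis
    using assms(2) arc_X_dvd[OF assms(1)] by (simp add: G_def ev_add ev_mult ev_power ev_var ev_cst)
qed

lemma ev_J:
  assumes "arc y z \<eta>" "f \<in> J"
  shows "ev m \<eta> f = 0"
proof -
  obtain F where "f = (\<Sum>i=1..m-2. G i * F i)" using assms by (auto simp: J_def)
  then show ?thesis
    using arc_X_dvd[OF assms(1)] ev_G[OF assms(1)] by (simp add: ev_sum ev_mult)
qed

lemma wc_J: "f \<in> J \<Longrightarrow> wc K f"
  unfolding wc_def using ev_J by auto

lemma
  assumes "arc y z \<eta>"
  shows ev_arc_add: "ev m \<eta> (f + g) = ev m \<eta> f + ev m \<eta> g"
    and ev_arc_mult: "ev m \<eta> (f * g) = ev m \<eta> f * ev m \<eta> g"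
    and ev_arc_uminus: "ev m \<eta> (- f) = - ev m \<eta> f"
    and ev_arc_power: "ev m \<eta> (f ^ n) = ev m \<eta> f ^ n"
    and ev_arc_sum: "ev m \<eta> (sum F I) = (\<Sum>i\<in>I. ev m \<eta> (F i))"
  using arc_X_dvd[OF assms] by (simp_all add: ev_add ev_mult ev_uminus ev_power ev_sum)

lemma wc_add: "wc K f \<Longrightarrow> wc K g \<Longrightarrow> wc K (f + g)"
  unfolding wc_def by (simp add: ev_arc_add dvd_add)

lemma wc_uminus: "wc K f \<Longrightarrow> wc K (- f)"
  unfolding wc_def by (simp add: ev_arc_uminus)

lemma wc_diff: "wc K f \<Longrightarrow> wc K g \<Longrightarrow> wc K (f - g)"
  using wc_add[of K f "- g"] wc_uminus by simp

lemma wc_cong_J: "f - g \<in> J \<Longrightarrow> wc K f \<longleftrightarrow> wc K g"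
  using wc_J[of "f - g" K] wc_add[of K "f - g" g] wc_diff[of K f "f - g"] by auto

lemma wc_mult: "wc K f \<Longrightarrow> wc K' g \<Longrightarrow> wc (K + K') (f * g)"
  unfolding wc_def by (simp add: ev_arc_mult power_add mult_dvd_mono)

lemma wc_0 [simp]: "wc 0 f"
  by (simp add: wc_def)

lemma wc_zero [simp]: "wc K 0"
  by (rule wc_J) simp

lemma wc_sum: "(\<And>i. i \<in> I \<Longrightarrow> wc K (F i)) \<Longrightarrow> wc K (sum F I)"
  by (induction I rule: infinite_finite_induct) (auto intro: wc_add)

lemma wc_prod: "finite I \<Longrightarrow> (\<And>i. i \<in> I \<Longrightarrow> wc K (F i)) \<Longrightarrow> wc (card I * K) (prod F I)"
  by (induction I rule: finite_induct) (auto intro: wc_mult)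

lemma wc_Wt:
  assumes "\<And>\<alpha>. cf f \<alpha> \<noteq> 0 \<Longrightarrow> K \<le> Wt \<alpha>"
  shows "wc K f"
  unfolding wc_def
proof (intro allI impI)
  fix y z \<eta> assume arc: "arc y z \<eta>"
  show "fps_X ^ K dvd ev m \<eta> f"
  proof (rule ev_dvd)
    fix \<alpha> assume "cf f \<alpha> \<noteq> 0"
    then have "K \<le> Wt \<alpha>" by (rule assms)
    moreover have "fps_X ^ Wt \<alpha> dvd mev m \<eta> \<alpha>"
      unfolding Wt_def using arc_dvd[OF arc] by (rule mev_dvd)
    ultimately show "fps_X ^ K dvd mev m \<eta> \<alpha>"
      by (meson dvd_trans le_imp_power_dvd)
  qed (use arc_X_dvd[OF arc] in auto)
qed

lemma wc_ordge: "ordge m d f \<Longrightarrow> wc (d * L) f"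
  by (rule wc_Wt) (metis deg_le_Wt mult.commute mult_le_mono2 order_trans ordge_def)

section \<open>The group of roots of unity acting on the surface\<close>

definition grp :: "(nat \<Rightarrow> complex) set" where
  "grp = {\<zeta>. (\<forall>i\<in>{1..m-2}. \<zeta> i ^ a i = 1) \<and> (\<forall>i. i \<notin> {1..m-2} \<longrightarrow> \<zeta> i = 1)}"

lemma finite_grp [simp]: "finite grp"
proof (rule finite_subset)
  let ?B = "\<Union>i\<in>{1..m-2}. {z::complex. z ^ a i = 1}"
  show "grp \<subseteq> {\<zeta>. \<forall>i. (i \<in> {1..m-2} \<longrightarrow> \<zeta> i \<in> ?B) \<and> (i \<notin> {1..m-2} \<longrightarrow> \<zeta> i = 1)}"
    unfolding grp_def by blast
  show "finite \<dots>"
    by (intro finite_set_of_finite_funs finite_UN_I finite_nth_roots) auto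
qed

lemma one_grp: "(\<lambda>_. 1) \<in> grp"
  by (simp add: grp_def)

lemma grp_mult: "\<zeta> \<in> grp \<Longrightarrow> \<tau> \<in> grp \<Longrightarrow> (\<lambda>j. \<zeta> j * \<tau> j) \<in> grp"
  by (simp add: grp_def power_mult_distrib)

lemma grp_norm: "\<zeta> \<in> grp \<Longrightarrow> norm (\<zeta> j) = 1"
proof (cases "j \<in> {1..m-2}")
  case True
  assume "\<zeta> \<in> grp"
  then have "\<zeta> j ^ a j = 1" using True by (simp add: grp_def)
  then have "norm (\<zeta> j) ^ a j = 1" by (metis norm_one norm_power)
  then show ?thesis using power_eq_1_iff[of "norm (\<zeta> j)" "a j"] a_pos[OF in_vars(3)[OF True]] by simp
qed (auto simp: grp_def)

text \<open>The translation that reindexes the averages and symmetric functions over the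
  group.\<close>

lemma bij_grp:
  assumes "\<tau> \<in> grp"
  shows "bij_betw (\<lambda>\<zeta> j. \<tau> j * \<zeta> j) grp grp"
proof -
  have nz: "\<tau> j \<noteq> 0" for j using grp_norm[OF assms, of j] by auto
  have inj: "inj_on (\<lambda>\<zeta> j. \<tau> j * \<zeta> j) grp"
    using nz by (auto simp: inj_on_def fun_eq_iff)
  moreover have "(\<lambda>\<zeta> j. \<tau> j * \<zeta> j) ` grp \<subseteq> grp"
    using grp_mult[OF assms] by auto
  ultimately show ?thesis
    unfolding bij_betw_def using endo_inj_surj[OF finite_grp] by blast
qed

lemma arc_tw: "arc y z \<eta> \<Longrightarrow> \<zeta> \<in> grp \<Longrightarrow> arc y z (\<lambda>j. fps_const (\<zeta> j) * \<eta> j)"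
proof -
  assume *: "arc y z \<eta>" "\<zeta> \<in> grp"
  have "\<zeta> (m-1) = 1" "\<zeta> m = 1" "\<forall>i\<in>{1..m-2}. \<zeta> i ^ a i = 1"
    using *(2) m3 by (auto simp: grp_def)
  then show ?thesis
    using *(1) by (auto simp: arc_def power_mult_distrib fps_const_power)
qed

lemma wc_tw: "wc K f \<Longrightarrow> \<zeta> \<in> grp \<Longrightarrow> wc K (tw m \<zeta> f)"
  unfolding wc_def ev_tw using arc_tw by blast

lemma G_tw:
  assumes "\<zeta> \<in> grp" "i \<in> {1..m-2}"
  shows "tw m \<zeta> (G i) = G i"
proof -
  have tw_mon: "tw m \<zeta> (mon \<alpha>) = cst (chi m \<zeta> \<alpha>) * mon \<alpha>" for \<alpha>
    by (rule pseries_eqI) (simp add: cf_mon)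
  have tw_cst: "tw m \<zeta> (cst c) = cst c" for c
    by (rule pseries_eqI) (simp add: cf_cst chi_def)
  have chi: "chi m \<zeta> (single j n) = \<zeta> j ^ n" if "j \<in> {1..m}" for j n
  proof -
    have "chi m \<zeta> (single j n) = (\<Prod>i=1..m. if i = j then \<zeta> j ^ n else 1)"
      unfolding chi_def by (rule prod.cong) (auto simp: lookup_single when_def)
    then show ?thesis using that by simp
  qed
  have "\<zeta> (m-1) = 1" "\<zeta> m = 1" "\<zeta> i ^ a i = 1"
    using assms m3 by (auto simp: grp_def)
  then show ?thesis
    using assms(2) unfolding G_def var_power tw_add tw_mult tw_mon tw_cst by (simp add: chi cst_1)
qed

lemma J_tw: "f \<in> J \<Longrightarrow> \<zeta> \<in> grp \<Longrightarrow> tw m \<zeta> f \<in> J"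
proof -
  assume "f \<in> J" and \<zeta>: "\<zeta> \<in> grp"
  then obtain F where "f = (\<Sum>i=1..m-2. G i * F i)" "\<forall>i. F i \<in> cs m" by (auto simp: J_def)
  then have "tw m \<zeta> f = (\<Sum>i=1..m-2. G i * tw m \<zeta> (F i))" "\<forall>i. tw m \<zeta> (F i) \<in> cs m"
    using \<zeta> by (auto simp: tw_sum tw_mult G_tw intro!: cs_tw grp_norm)
  then show ?thesis unfolding J_def mem_Collect_eq by (intro exI[of _ "\<lambda>i. tw m \<zeta> (F i)"]) simp
qed

text \<open>A primitive a_i-th root of unity placed in the single coordinate i distinguishes
  residues mod a_i.\<close>

lemma chi_separates:
  assumes "i \<in> {1..m-2}" "lookup \<alpha> i mod a i \<noteq> lookup \<beta> i mod a i"
  obtains \<tau> where "\<tau> \<in> grp" "chi m \<tau> \<alpha> \<noteq> chi m \<tau> \<beta>"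
proof -
  define \<omega> where "\<omega> = exp (2 * of_real pi * \<i> / of_nat (a i))"
  have ai: "1 \<le> a i" using a_pos[OF in_vars(3)[OF assms(1)]] by simp
  have pow: "\<omega> ^ n = exp (2 * of_real pi * \<i> * of_nat n / of_nat (a i))" for n
    by (simp add: \<omega>_def exp_of_nat_mult[symmetric] algebra_simps)
  define \<tau> where "\<tau> = (\<lambda>j. if j = i then \<omega> else 1)"
  have "\<omega> ^ a i = 1" unfolding pow using complex_root_unity_eq_1[OF ai, of "a i"] by simp
  then have "\<tau> \<in> grp" using assms(1) by (auto simp: grp_def \<tau>_def)
  moreover have chi: "chi m \<tau> \<gamma> = \<omega> ^ lookup \<gamma> i" for \<gamma>
  proof -
    have "chi m \<tau> \<gamma> = (\<Prod>j=1..m. if j = i then \<omega> ^ lookup \<gamma> i else 1)"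
      unfolding chi_def by (rule prod.cong) (auto simp: \<tau>_def)
    then show ?thesis using in_vars(3)[OF assms(1)] by simp
  qed
  have "chi m \<tau> \<alpha> \<noteq> chi m \<tau> \<beta>"
    unfolding chi pow complex_root_unity_eq[OF ai] by (rule assms(2))
  ultimately show ?thesis by (rule that)
qed

text \<open>Up to sign, the expression is the coefficient of s^(L b) in x_i^(a_i) on an arc with y =
  1 and z = t; the second term reaches that order only if b = c. As a polynomial in t it takes the
  value p_i at 0, so it has finitely many roots.\<close>

lemma generic_slopes: "infinite {t. \<forall>i\<in>{1..m-2}. p i + (if a (m-1) = a m then r i * t ^ a m else 0) \<noteq> 0}"
proof -
  define q where "q i = [:p i:] + (if a (m-1) = a m then Polynomial.monom (r i) (a m) else 0)" for i
  have pq: "poly (q i) t = p i + (if a (m-1) = a m then r i * t ^ a m else 0)" for i t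
    by (simp add: q_def poly_monom)
  have "q i \<noteq> 0" if "i \<in> {1..m-2}" for i
  proof -
    have "poly (q i) 0 = p i" using a_pos[of m] m3 by (simp add: pq)
    then show ?thesis using p_nz[OF that] by auto
  qed
  then have "finite (\<Union>i\<in>{1..m-2}. {t. poly (q i) t = 0})"
    by (intro finite_UN_I poly_roots_finite) auto
  then have "infinite (- (\<Union>i\<in>{1..m-2}. {t. poly (q i) t = 0}))"
    using infinite_UNIV_char_0 by (metis Compl_eq_Diff_UNIV Diff_infinite_finite)
  moreover have "- (\<Union>i\<in>{1..m-2}. {t. poly (q i) t = 0})
      = {t. \<forall>i\<in>{1..m-2}. p i + (if a (m-1) = a m then r i * t ^ a m else 0) \<noteq> 0}"
    by (auto simp: pq)
  ultimately show ?thesis by simp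
qed

text \<open>On such an arc the order bounds of \<open>arc_dvd\<close> are attained by the first m-2
  coordinates.\<close>

lemma generic_arc:
  assumes "\<forall>i\<in>{1..m-2}. p i + (if a (m-1) = a m then r i * t ^ a m else 0) \<noteq> 0"
  obtains \<eta> \<gamma> where "arc 1 t \<eta>" "\<And>j. j \<in> {1..m} \<Longrightarrow> \<eta> j = fps_X ^ wt j * \<gamma> j"
    "\<And>i. i \<in> {1..m-2} \<Longrightarrow> \<gamma> i $ 0 \<noteq> 0" "\<gamma> (m-1) = 1" "\<gamma> m = fps_const t"
proof -
  obtain \<eta> where arc: "arc 1 t \<eta>" by (rule arc_exists)
  then have "\<forall>j\<in>{1..m}. \<exists>g. \<eta> j = fps_X ^ wt j * g"
    using arc_dvd[OF arc] unfolding dvd_def by blast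
  then obtain \<gamma>0 where \<gamma>0: "\<And>j. j \<in> {1..m} \<Longrightarrow> \<eta> j = fps_X ^ wt j * \<gamma>0 j" by metis
  have Xnz: "(fps_X :: complex fps) ^ n \<noteq> 0" for n by simp
  have "fps_X ^ L * \<gamma>0 (m-1) = fps_X ^ L * 1"
    using \<gamma>0[of "m-1"] arc in_vars wt_simps by (simp add: arc_def)
  then have y: "\<gamma>0 (m-1) = 1" using Xnz by (simp only: mult_left_cancel not_False_eq_True)
  have "fps_X ^ L * \<gamma>0 m = fps_X ^ L * fps_const t"
    using \<gamma>0[of m] arc in_vars wt_simps by (simp add: arc_def mult.commute)
  then have z: "\<gamma>0 m = fps_const t" using Xnz by (simp only: mult_left_cancel not_False_eq_True)
  have nz: "\<gamma>0 i $ 0 \<noteq> 0" if i: "i \<in> {1..m-2}" for i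
  proof -
    \<comment> \<open>Removing s^(L b) from the equation of the surface leaves \<open>- h\<close> as
      the a_i-th power of \<gamma>0 i. Its constant term is the generic expression up to
      sign.\<close>
    define h where "h = fps_const (p i) + fps_const (r i * t ^ a m) * fps_X ^ (L * (a m - a (m-1)))"
    have "fps_X ^ (L * a (m-1)) * \<gamma>0 i ^ a i = \<eta> i ^ a i"
      using \<gamma>0[of i] i a_wt[OF i] by (simp add: power_mult_distrib power_mult[symmetric] mult.commute)
    also have "\<dots> = - (fps_const (p i) * \<eta> (m-1) ^ a (m-1) + fps_const (r i) * \<eta> m ^ a m)"
      using arc i unfolding arc_def by (metis eq_neg_iff_add_eq_0)
    also have "\<dots> = fps_X ^ (L * a (m-1)) * - h"
    proof -
      define U where "U = (fps_X :: complex fps) ^ (L * a (m-1))"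
      define V where "V = (fps_X :: complex fps) ^ (L * (a m - a (m-1)))"
      have "fps_X ^ (L * a m) = U * V"
        using a_le(2) by (simp add: U_def V_def power_add[symmetric] distrib_left[symmetric])
      then have "\<eta> (m-1) ^ a (m-1) = U" "\<eta> m ^ a m = fps_const (t ^ a m) * (U * V)"
        using arc unfolding arc_def U_def
        by (simp_all add: power_mult_distrib fps_const_power power_mult)
      moreover have expand: "- (x * U + y * (z * (U * V))) = U * - (x + y * z * V)" for x y z
        by (simp add: algebra_simps)
      ultimately show ?thesis
        unfolding h_def U_def[symmetric] V_def[symmetric] fps_const_mult[symmetric]
        by (simp only: expand)
    qed
    finally have "\<gamma>0 i ^ a i = - h" using Xnz by (simp only: mult_left_cancel not_False_eq_True)
    moreover have "h $ 0 \<noteq> 0"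
    proof -
      have "L * (a m - a (m-1)) = 0 \<longleftrightarrow> a (m-1) = a m" using L_pos a_le(2) by auto
      then have "h $ 0 = p i + (if a (m-1) = a m then r i * t ^ a m else 0)"
        unfolding h_def by simp
      then show ?thesis using assms i by metis
    qed
    ultimately have "(\<gamma>0 i ^ a i) $ 0 \<noteq> 0" by simp
    then show ?thesis using a_pos[of i] i by (simp add: fps_nth_power_0)
  qed
  show ?thesis by (rule that[OF arc \<gamma>0 nz y z])
qed

text \<open>Averaging over \<open>grp\<close> isolates the monomials of \<open>N\<close> with the same exponents in all but the
  last two variables; the lowest weight part of these is a polynomial in the slope of a generic arc.\<close>

lemma wc_reduced_le_Wt:
  assumes N: "N \<in> cs m" "reduced N" and wc: "wc K N" and "cf N \<alpha>1 \<noteq> 0"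
  shows "K \<le> Wt \<alpha>1"
proof (rule ccontr)
  assume "\<not> K \<le> Wt \<alpha>1"
  define D where "D = (LEAST d. \<exists>\<alpha>. cf N \<alpha> \<noteq> 0 \<and> Wt \<alpha> = d)"
  obtain \<alpha>0 where \<alpha>0: "cf N \<alpha>0 \<noteq> 0" "Wt \<alpha>0 = D"
  proof -
    have "\<exists>\<alpha>. cf N \<alpha> \<noteq> 0 \<and> Wt \<alpha> = D"
      unfolding D_def by (rule LeastI_ex) (use assms(4) in blast)
    then show ?thesis using that by blast
  qed
  have D_le: "D \<le> Wt \<alpha>" if "cf N \<alpha> \<noteq> 0" for \<alpha>
    unfolding D_def using that by (intro Least_le) blast
  have "D < K" using D_le[OF assms(4)] \<open>\<not> K \<le> Wt \<alpha>1\<close> by simp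
  have keys: "keys \<alpha> \<subseteq> {1..m}" if "cf N \<alpha> \<noteq> 0" for \<alpha>
    using cs_ordge[OF N(1)] that by (simp add: ordge_def)
  have chi_nz: "chi m \<zeta> \<alpha> \<noteq> 0" if "\<zeta> \<in> grp" for \<zeta> \<alpha>
  proof -
    have "\<zeta> j \<noteq> 0" for j using grp_norm[OF that, of j] by auto
    then show ?thesis by (simp add: chi_def)
  qed
  define same where "same \<alpha> \<longleftrightarrow> (\<forall>i\<in>{1..m-2}. lookup \<alpha> i = lookup \<alpha>0 i)" for \<alpha>
  \<comment> \<open>Up to the factor \<open>card grp\<close>, the projection to the character of
    \<alpha>0. Reduced exponents are below a_i, hence determined by their residues, so exactly the
    monomials satisfying \<open>same\<close> survive.\<close>
  define M where "M = (\<Sum>\<zeta>\<in>grp. cst (inverse (chi m \<zeta> \<alpha>0)) * tw m \<zeta> N)"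
  have cfM: "cf M \<alpha> = (if same \<alpha> then of_nat (card grp) * cf N \<alpha> else 0)" for \<alpha>
  proof -
    define S where "S = (\<Sum>\<zeta>\<in>grp. inverse (chi m \<zeta> \<alpha>0) * chi m \<zeta> \<alpha>)"
    have cfM: "cf M \<alpha> = S * cf N \<alpha>"
      by (simp add: M_def cf_sum S_def sum_distrib_right mult.assoc)
    show ?thesis
    proof (cases "same \<alpha>")
      case True
      have "chi m \<zeta> \<alpha> = chi m \<zeta> \<alpha>0" if "\<zeta> \<in> grp" for \<zeta>
        unfolding chi_def
      proof (rule prod.cong)
        fix j assume "j \<in> {1..m}"
        show "\<zeta> j ^ lookup \<alpha> j = \<zeta> j ^ lookup \<alpha>0 j"
          using True that by (cases "j \<in> {1..m-2}") (auto simp: same_def grp_def)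
      qed simp
      then have "S = (\<Sum>\<zeta>\<in>grp. 1)"
        unfolding S_def using chi_nz by (intro sum.cong) auto
      then show ?thesis using True cfM by simp
    next
      case False
      show ?thesis
      proof (cases "cf N \<alpha> = 0")
        case nz: False
        obtain i where i: "i \<in> {1..m-2}" "lookup \<alpha> i \<noteq> lookup \<alpha>0 i"
          using False by (auto simp: same_def)
        then have "lookup \<alpha> i mod a i \<noteq> lookup \<alpha>0 i mod a i"
          using N(2) nz \<alpha>0(1) by (simp add: reduced_def)
        then obtain \<tau> where \<tau>: "\<tau> \<in> grp" "chi m \<tau> \<alpha> \<noteq> chi m \<tau> \<alpha>0"
          using chi_separates i(1) by blast
        \<comment> \<open>Orthogonality of characters: translation by \<tau> leaves S unchanged but
          multiplies it by a number other than 1.\<close>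
        have "S = (\<Sum>\<zeta>\<in>grp. inverse (chi m (\<lambda>j. \<tau> j * \<zeta> j) \<alpha>0) * chi m (\<lambda>j. \<tau> j * \<zeta> j) \<alpha>)"
          unfolding S_def by (rule sum.reindex_bij_betw[OF bij_grp[OF \<tau>(1)], symmetric])
        also have "\<dots> = inverse (chi m \<tau> \<alpha>0) * chi m \<tau> \<alpha> * S"
          by (simp add: S_def chi_mult sum_distrib_left algebra_simps)
        finally have "chi m \<tau> \<alpha>0 * S = chi m \<tau> \<alpha> * S"
          using chi_nz[OF \<tau>(1), of \<alpha>0] by (simp add: field_simps)
        then have "S = 0" using \<tau>(2) by simp
        then show ?thesis using False cfM by simp
      qed (use False cfM in simp)
    qed
  qed
  have card_grp: "of_nat (card grp) \<noteq> (0::complex)"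
    using one_grp finite_grp by (auto simp: card_eq_0_iff)
  have wcM: "wc K M"
    unfolding M_def
  proof (rule wc_sum)
    fix \<zeta> assume "\<zeta> \<in> grp"
    then show "wc K (cst (inverse (chi m \<zeta> \<alpha>0)) * tw m \<zeta> N)"
      using wc_mult[OF wc_0 wc_tw[OF wc]] by simp
  qed
  define S where "S = {\<alpha> \<in> exps m D. same \<alpha> \<and> Wt \<alpha> = D}"
  have finS: "finite S" by (simp add: S_def)
  have "deg m \<alpha>0 \<le> Wt \<alpha>0" using deg_le_Wt[of \<alpha>0] L_pos by (metis One_nat_def Suc_leI le_trans mult_1 mult_le_mono1)
  then have \<alpha>0S: "\<alpha>0 \<in> S" using \<alpha>0 keys by (auto simp: S_def exps_def same_def)
  have split: "(\<Sum>j=1..m. h j) = (\<Sum>j=1..m-2. h j) + (h (m-1) + h m)" for h :: "nat \<Rightarrow> nat"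
  proof -
    have "(\<Sum>j=1..m. h j) = sum h {1..m-2} + sum h {m-1, m}"
      unfolding vars_split by (rule sum.union_disjoint) auto
    then show ?thesis by simp
  qed
  \<comment> \<open>The exponents of the x_i and the weight fix the sum of the last two exponents,
    so the exponent of z fixes the monomial. Thus the terms of \<open>q\<close> below do not
    collide.\<close>
  have S_eq: "\<alpha> = \<alpha>0" if "\<alpha> \<in> S" "lookup \<alpha> m = lookup \<alpha>0 m" for \<alpha>
  proof -
    have same: "same \<alpha>" "Wt \<alpha> = Wt \<alpha>0" "keys \<alpha> \<subseteq> {1..m}"
      using that \<alpha>0(2) by (auto simp: S_def exps_def)
    have "(\<Sum>j=1..m-2. wt j * lookup \<alpha> j) = (\<Sum>j=1..m-2. wt j * lookup \<alpha>0 j)"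
      using same(1) by (intro sum.cong) (auto simp: same_def)
    then have "L * lookup \<alpha> (m-1) = L * lookup \<alpha>0 (m-1)"
      using same(2) that(2) unfolding Wt_def split by (simp add: wt_simps)
    then have y: "lookup \<alpha> (m-1) = lookup \<alpha>0 (m-1)" using L_pos by simp
    show ?thesis
    proof (rule poly_mapping_eqI)
      fix j
      consider "j \<in> {1..m-2}" | "j = m - 1" | "j = m" | "j \<notin> {1..m}" by (auto simp: vars_split)
      then show "lookup \<alpha> j = lookup \<alpha>0 j"
      proof cases
        case 4
        then show ?thesis using same(3) keys[OF \<alpha>0(1)] by (metis in_keys_iff subsetD)
      qed (use same(1) y that(2) in \<open>auto simp: same_def\<close>)
    qed
  qed
  \<comment> \<open>Up to a nonzero factor, \<open>poly q t\<close> is the coefficient of s^D of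
    \<open>M\<close> along a generic arc of slope t.\<close>
  define q where "q = (\<Sum>\<alpha>\<in>S. Polynomial.monom (cf N \<alpha>) (lookup \<alpha> m))"
  have "poly q t = 0"
    if t: "\<forall>i\<in>{1..m-2}. p i + (if a (m-1) = a m then r i * t ^ a m else 0) \<noteq> 0" for t
  proof -
    obtain \<eta> \<gamma> where arc: "arc 1 t \<eta>" and \<gamma>: "\<And>j. j \<in> {1..m} \<Longrightarrow> \<eta> j = fps_X ^ wt j * \<gamma> j"
      and \<gamma>nz: "\<And>i. i \<in> {1..m-2} \<Longrightarrow> \<gamma> i $ 0 \<noteq> 0" and \<gamma>yz: "\<gamma> (m-1) = 1" "\<gamma> m = fps_const t"
      using generic_arc[OF t] by metis
    define u where "u = (\<Prod>i=1..m-2. (\<gamma> i $ 0) ^ lookup \<alpha>0 i)"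
    have mev: "mev m \<eta> \<alpha> = fps_X ^ Wt \<alpha> * (\<Prod>j=1..m. \<gamma> j ^ lookup \<alpha> j)" for \<alpha>
    proof -
      have "mev m \<eta> \<alpha> = (\<Prod>j=1..m. fps_X ^ (wt j * lookup \<alpha> j) * \<gamma> j ^ lookup \<alpha> j)"
        unfolding mev_def by (rule prod.cong) (auto simp: \<gamma> power_mult_distrib power_mult)
      then show ?thesis by (simp add: prod.distrib Wt_def power_sum)
    qed
    have prod0: "(\<Prod>j\<in>A. g j) $ 0 = (\<Prod>j\<in>A. g j $ 0)" for A and g :: "nat \<Rightarrow> complex fps"
      by (induction A rule: infinite_finite_induct) auto
    have mev_D: "mev m \<eta> \<alpha> $ D = (if Wt \<alpha> = D then u * t ^ lookup \<alpha> m else 0)"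
      if "same \<alpha>" "D \<le> Wt \<alpha>" for \<alpha>
    proof (cases "Wt \<alpha> = D")
      case True
      have "(\<Prod>j=1..m. (\<gamma> j $ 0) ^ lookup \<alpha> j)
          = (\<Prod>j=1..m-2. (\<gamma> j $ 0) ^ lookup \<alpha> j) * (\<Prod>j\<in>{m-1, m}. (\<gamma> j $ 0) ^ lookup \<alpha> j)"
        unfolding vars_split by (rule prod.union_disjoint) auto
      also have "(\<Prod>j=1..m-2. (\<gamma> j $ 0) ^ lookup \<alpha> j) = u"
        unfolding u_def using that(1) by (intro prod.cong) (auto simp: same_def)
      finally show ?thesis
        using True m3 by (simp add: mev fps_X_power_mult_nth prod0 fps_nth_power_0 \<gamma>yz)
    next
      case False
      then show ?thesis using that by (simp add: mev fps_X_power_mult_nth)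
    qed
    \<comment> \<open>Order at least K > D kills this coefficient, while minimality of D leaves only
      monomials of weight exactly D in it.\<close>
    have "0 = ev m \<eta> M $ D"
      using wcM arc \<open>D < K\<close> unfolding wc_def fps_X_power_dvd_iff by metis
    also have "\<dots> = (\<Sum>\<alpha>\<in>exps m D. if same \<alpha> \<and> Wt \<alpha> = D then of_nat (card grp) * cf N \<alpha> * (u * t ^ lookup \<alpha> m) else 0)"
      unfolding ev_def fps_nth_Abs_fps
    proof (rule sum.cong)
      fix \<alpha>
      show "cf M \<alpha> * mev m \<eta> \<alpha> $ D = (if same \<alpha> \<and> Wt \<alpha> = D then of_nat (card grp) * cf N \<alpha> * (u * t ^ lookup \<alpha> m) else 0)"
        using mev_D[of \<alpha>] D_le[of \<alpha>] by (cases "cf N \<alpha> = 0") (auto simp: cfM)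
    qed simp
    also have "\<dots> = (\<Sum>\<alpha>\<in>S. of_nat (card grp) * cf N \<alpha> * (u * t ^ lookup \<alpha> m))"
      unfolding S_def by (rule sum.inter_filter[symmetric]) simp
    also have "\<dots> = of_nat (card grp) * u * poly q t"
      by (simp add: q_def poly_sum poly_monom sum_distrib_left algebra_simps)
    finally show ?thesis
      using card_grp \<gamma>nz by (auto simp: u_def)
  qed
  then have "infinite {t. poly q t = 0}"
    by (intro infinite_super[OF _ generic_slopes] Collect_mono impI)
  then have "q = 0" using poly_roots_finite by blast
  have "coeff q (lookup \<alpha>0 m) = (\<Sum>\<alpha>\<in>S. if \<alpha> = \<alpha>0 then cf N \<alpha>0 else 0)"
    unfolding q_def coeff_sum by (rule sum.cong) (auto dest: S_eq)
  then show False using \<open>q = 0\<close> \<alpha>0S finS \<alpha>0(1) by simp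
qed

lemma wc_reduced_iff:
  "N \<in> cs m \<Longrightarrow> reduced N \<Longrightarrow> wc K N \<longleftrightarrow> (\<forall>\<alpha>. cf N \<alpha> \<noteq> 0 \<longrightarrow> K \<le> Wt \<alpha>)"
  using wc_reduced_le_Wt wc_Wt by blast

text \<open>An element of J vanishes along arcs to every order, so the weight of a monomial in it
  would exceed every bound.\<close>

lemma reduced_J_eq_0:
  assumes "reduced N" "N \<in> J"
  shows "N = 0"
proof (rule pseries_eqI)
  fix \<alpha>
  show "cf N \<alpha> = cf 0 \<alpha>"
    using wc_reduced_le_Wt[OF J_cs[OF assms(2)] assms(1) wc_J[OF assms(2)], of \<alpha> "Suc (Wt \<alpha>)"] by auto
qed

section \<open>Normal forms modulo the defining ideal\<close>

lemma reduced_add: "reduced f \<Longrightarrow> reduced g \<Longrightarrow> reduced (f + g)"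
  unfolding reduced_def by (metis add.left_neutral cf_add)

lemma reduced_uminus: "reduced f \<Longrightarrow> reduced (- f)"
  unfolding reduced_def by simp

lemma reduced_diff: "reduced f \<Longrightarrow> reduced g \<Longrightarrow> reduced (f - g)"
  using reduced_add[of f "- g"] reduced_uminus by simp

lemma reduced_cst_mult: "reduced f \<Longrightarrow> reduced (cst c * f)"
  unfolding reduced_def by simp

definition nf :: "pseries \<Rightarrow> pseries" where
  "nf f = (THE N. N \<in> cs m \<and> reduced N \<and> f - N \<in> J)"

lemma nf_unique: "N \<in> cs m \<Longrightarrow> reduced N \<Longrightarrow> f - N \<in> J \<Longrightarrow> nf f = N"
  unfolding nf_def
proof (rule the_equality)
  fix N' assume "N \<in> cs m" "reduced N" "f - N \<in> J" "N' \<in> cs m \<and> reduced N' \<and> f - N' \<in> J"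
  moreover from this have "N' - N \<in> J" using J_diff[of "f - N" "f - N'"] by (simp add: algebra_simps)
  ultimately have "N' - N = 0" by (intro reduced_J_eq_0 reduced_diff) auto
  then show "N' = N" by simp
qed auto

lemma nf:
  assumes "f \<in> cs m"
  shows nf_cs: "nf f \<in> cs m" and nf_reduced: "reduced (nf f)" and nf_J: "f - nf f \<in> J"
proof -
  obtain N where "N \<in> cs m" "reduced N" "f - N \<in> J" using division[OF assms cs_ordge[OF assms]] by blast
  then show "nf f \<in> cs m" "reduced (nf f)" "f - nf f \<in> J" using nf_unique by auto
qed

text \<open>\<open>division\<close> respects any prescribed order, and by uniqueness its result is
  the same normal form each time.\<close>

lemma nf_ordge: "f \<in> cs m \<Longrightarrow> ordge m d f \<Longrightarrow> ordge m d (nf f)"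
  using division[of f d] nf_unique by metis

lemma nf_eq_iff: "f \<in> cs m \<Longrightarrow> g \<in> cs m \<Longrightarrow> nf f = nf g \<longleftrightarrow> f - g \<in> J"
proof
  assume *: "f \<in> cs m" "g \<in> cs m" "nf f = nf g"
  then show "f - g \<in> J" using J_diff[OF nf_J[OF *(1)] nf_J[OF *(2)]] by simp
next
  assume *: "f \<in> cs m" "g \<in> cs m" "f - g \<in> J"
  then have "f - nf g \<in> J" using J_add[OF *(3) nf_J[OF *(2)]] by simp
  then show "nf f = nf g" using nf_unique nf_cs nf_reduced * by blast
qed

lemma nf_add: "f \<in> cs m \<Longrightarrow> g \<in> cs m \<Longrightarrow> nf (f + g) = nf f + nf g"
  using nf J_add[of "f - nf f" "g - nf g"] by (intro nf_unique reduced_add) (auto simp: algebra_simps)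

lemma nf_cst_mult: "f \<in> cs m \<Longrightarrow> nf (cst c * f) = cst c * nf f"
  using nf J_mult'[OF nf_J, of f "cst c"] by (intro nf_unique reduced_cst_mult) (auto simp: algebra_simps)

text \<open>The bridge between the two filtrations: an arc condition becomes a condition on the
  support of the normal form.\<close>

lemma wc_nf: "f \<in> cs m \<Longrightarrow> wc K f \<longleftrightarrow> (\<forall>\<alpha>. cf (nf f) \<alpha> \<noteq> 0 \<longrightarrow> K \<le> Wt \<alpha>)"
  using wc_cong_J[OF nf_J] wc_reduced_iff[OF nf_cs nf_reduced] by blast

end

section \<open>The local ring\<close>

lemma conv_ring_simps:
  "carrier (conv_ring m) = cf ` cs m"
  "cf f \<otimes>\<^bsub>conv_ring m\<^esub> cf g = cf (f * g)"
  "\<one>\<^bsub>conv_ring m\<^esub> = cf 1"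
  "cf f \<oplus>\<^bsub>conv_ring m\<^esub> cf g = cf (f + g)"
  "\<zero>\<^bsub>conv_ring m\<^esub> = cf 0"
proof -
  have "x \<in> cf ` cs m" if "x \<in> convergent_series m" for x
    using that by (intro image_eqI[of _ _ "Pser x"]) (auto simp: cs_def)
  then show "carrier (conv_ring m) = cf ` cs m"
    by (auto simp: conv_ring_def cs_def)
qed (auto simp: conv_ring_def fun_eq_iff cf_mult splits_def cf_one)

lemma cring_conv_ring: "cring (conv_ring m)"
proof (rule cringI)
  show "abelian_group (conv_ring m)"
  proof (rule abelian_groupI)
    fix x assume "x \<in> carrier (conv_ring m)"
    then obtain f where "x = cf f" "f \<in> cs m" by (auto simp: conv_ring_simps)
    then show "\<exists>y\<in>carrier (conv_ring m). y \<oplus>\<^bsub>conv_ring m\<^esub> x = \<zero>\<^bsub>conv_ring m\<^esub>"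
      by (intro bexI[of _ "cf (- f)"]) (auto simp: conv_ring_simps)
  qed (auto simp: conv_ring_simps add_ac intro!: imageI)
  show "Group.comm_monoid (conv_ring m)"
    by (rule comm_monoidI) (auto simp: conv_ring_simps mult_ac intro!: imageI)
qed (auto simp: conv_ring_simps distrib_right)

lemma (in brieskorn_nf) ideal_cf_J: "ideal (cf ` J) (conv_ring m)"
proof -
  interpret R: cring "conv_ring m" by (rule cring_conv_ring)
  show ?thesis
  proof (rule idealI[OF R.ring_axioms])
    show "subgroup (cf ` J) (add_monoid (conv_ring m))"
    proof (rule R.add.subgroupI)
      show "cf ` J \<subseteq> carrier (conv_ring m)" using J_cs by (auto simp: conv_ring_simps)
      show "cf ` J \<noteq> {}" using J_0 by blast
      fix x assume "x \<in> cf ` J"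
      then obtain f where f: "x = cf f" "f \<in> J" by auto
      then have "cf (- f) \<oplus>\<^bsub>conv_ring m\<^esub> x = \<zero>\<^bsub>conv_ring m\<^esub>" by (simp add: conv_ring_simps)
      then have "\<ominus>\<^bsub>conv_ring m\<^esub> x = cf (- f)"
        using f J_cs[OF f(2)] by (intro R.minus_equality) (auto simp: conv_ring_simps)
      then show "\<ominus>\<^bsub>conv_ring m\<^esub> x \<in> cf ` J" using J_uminus[OF f(2)] by simp
    qed (auto simp: conv_ring_simps intro!: imageI J_add)
  qed (auto simp: conv_ring_simps intro!: imageI intro: J_mult J_mult')
qed

text \<open>The original equations enter through this equality of ideals alone; the linear algebra
  behind it is supplied at the end.\<close>

locale brieskorn_alg = brieskorn_nf +
  fixes q :: "nat \<Rightarrow> nat \<Rightarrow> complex"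
  assumes ideal_eq: "brieskorn_ideal m a q = cf ` J"
begin

abbreviation A :: "series set ring" where
  "A \<equiv> brieskorn_ring m a q"

definition res :: "pseries \<Rightarrow> series set" where
  "res f = brieskorn_ideal m a q +>\<^bsub>conv_ring m\<^esub> cf f"

lemma ideal_J: "ideal (brieskorn_ideal m a q) (conv_ring m)"
  unfolding ideal_eq by (rule ideal_cf_J)

lemma cring_A: "cring A"
  unfolding brieskorn_ring_def by (rule ideal.quotient_is_cring[OF ideal_J cring_conv_ring])

lemma res_hom: "(+>\<^bsub>conv_ring m\<^esub>) (brieskorn_ideal m a q) \<in> Ring.ring_hom (conv_ring m) A"
  unfolding brieskorn_ring_def by (rule ideal.rcos_ring_hom[OF ideal_J])

lemma carrier_A: "carrier A = res ` cs m"
  by (auto simp: brieskorn_ring_def FactRing_def A_RCOSETS_def' conv_ring_simps res_def)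

lemma res_mult: "f \<in> cs m \<Longrightarrow> g \<in> cs m \<Longrightarrow> res f \<otimes>\<^bsub>A\<^esub> res g = res (f * g)"
  and res_add: "f \<in> cs m \<Longrightarrow> g \<in> cs m \<Longrightarrow> res f \<oplus>\<^bsub>A\<^esub> res g = res (f + g)"
  and res_one: "\<one>\<^bsub>A\<^esub> = res 1"
  using ring_hom_mult[OF res_hom, of "cf f" "cf g"] ring_hom_add[OF res_hom, of "cf f" "cf g"]
    ring_hom_one[OF res_hom]
  by (simp_all add: res_def conv_ring_simps)

lemma res_eq_iff:
  assumes "f \<in> cs m" "g \<in> cs m"
  shows "res f = res g \<longleftrightarrow> f - g \<in> J"
proof -
  have res: "res f = {cf (h + f) | h. h \<in> J}" for f
    unfolding res_def a_r_coset_def' ideal_eq by (auto simp: conv_ring_simps)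
  show ?thesis
  proof
    assume "res f = res g"
    moreover have "cf (0 + f) \<in> res f" unfolding res using J_0 by blast
    ultimately obtain h where "cf f = cf (h + g)" "h \<in> J" by (auto simp: res)
    then show "f - g \<in> J" by (auto simp: cf_inject)
  next
    assume J: "f - g \<in> J"
    have "\<exists>h'. cf (h + f) = cf (h' + g) \<and> h' \<in> J" if "h \<in> J" for h
      using J_add[OF that J] by (intro exI[of _ "h + (f - g)"]) (auto simp: algebra_simps)
    moreover have "\<exists>h'. cf (h + g) = cf (h' + f) \<and> h' \<in> J" if "h \<in> J" for h
      using J_diff[OF that J] by (intro exI[of _ "h - (f - g)"]) (auto simp: algebra_simps)
    ultimately show "res f = res g" unfolding res by blast
  qed
qed

lemma res_zero: "\<zero>\<^bsub>A\<^esub> = res 0"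
proof -
  interpret A: cring A by (rule cring_A)
  have c: "res 0 \<in> carrier A" by (auto simp: carrier_A)
  have "res 0 \<oplus>\<^bsub>A\<^esub> res 0 = res 0" using res_add[of 0 0] by auto
  then show ?thesis using c A.add.l_cancel_one by fastforce
qed

lemma res_in [intro]: "f \<in> cs m \<Longrightarrow> res f \<in> carrier A"
  by (auto simp: carrier_A)

lemma res_uminus: "f \<in> cs m \<Longrightarrow> \<ominus>\<^bsub>A\<^esub> res f = res (- f)"
proof -
  interpret A: cring A by (rule cring_A)
  assume "f \<in> cs m"
  then show ?thesis by (intro A.minus_equality) (simp_all add: res_add res_zero cs_uminus res_in)
qed

lemma res_pow: "f \<in> cs m \<Longrightarrow> res f [^]\<^bsub>A\<^esub> (n::nat) = res (f ^ n)"
proof -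
  interpret A: cring A by (rule cring_A)
  assume f: "f \<in> cs m"
  show ?thesis
    by (induction n) (auto simp: res_one res_mult f mult.commute cs_power)
qed

lemma res_finsum:
  "finite I \<Longrightarrow> (\<And>i. i \<in> I \<Longrightarrow> F i \<in> cs m) \<Longrightarrow> (\<Oplus>\<^bsub>A\<^esub>i\<in>I. res (F i)) = res (\<Sum>i\<in>I. F i)"
proof (induction I rule: finite_induct)
  case empty
  interpret A: cring A by (rule cring_A)
  show ?case by (simp add: res_zero)
next
  case (insert i I)
  interpret A: cring A by (rule cring_A)
  show ?case using insert by (subst A.finsum_insert) (simp_all add: res_add cs_sum Pi_def res_in)
qed

lemma res_finprod:
  "finite I \<Longrightarrow> (\<And>i. i \<in> I \<Longrightarrow> F i \<in> cs m) \<Longrightarrow> (\<Otimes>\<^bsub>A\<^esub>i\<in>I. res (F i)) = res (\<Prod>i\<in>I. F i)"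
proof (induction I rule: finite_induct)
  case empty
  interpret A: cring A by (rule cring_A)
  show ?case by (simp add: res_one)
next
  case (insert i I)
  interpret A: cring A by (rule cring_A)
  show ?case using insert by (subst A.finprod_insert) (simp_all add: res_mult cs_prod Pi_def res_in)
qed

lemma coord_eq: "brieskorn_coord m a q j = res (var j)"
  unfolding brieskorn_coord_def res_def
  by (rule arg_cong[where f = "\<lambda>x. _ +>\<^bsub>_\<^esub> x"]) (auto simp: series_var_def cf_mon fun_eq_iff)

lemma const_eq: "brieskorn_const m a q c = res (cst c)"
  unfolding brieskorn_const_def res_def
  by (rule arg_cong[where f = "\<lambda>x. _ +>\<^bsub>_\<^esub> x"]) (auto simp: series_const_def cf_cst fun_eq_iff)

definition is_ideal :: "pseries set \<Rightarrow> bool" where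
  "is_ideal H \<longleftrightarrow> 0 \<in> H \<and> H \<subseteq> cs m \<and> (\<forall>f\<in>H. \<forall>g\<in>H. f + g \<in> H) \<and> (\<forall>f\<in>H. \<forall>g\<in>cs m. g * f \<in> H)"

lemma ideal_res:
  assumes "is_ideal H"
  shows "ideal (res ` H) A"
proof -
  interpret A: cring A by (rule cring_A)
  show ?thesis
  proof (rule idealI[OF A.ring_axioms])
    show "subgroup (res ` H) (add_monoid A)"
    proof (rule A.add.subgroupI)
      fix x assume "x \<in> res ` H"
      then obtain f where f: "x = res f" "f \<in> H" "f \<in> cs m" using assms by (auto simp: is_ideal_def)
      have "- 1 * f \<in> H" using assms f(2) cs_uminus[OF cs_1] unfolding is_ideal_def by blast
      then show "\<ominus>\<^bsub>A\<^esub> x \<in> res ` H" using f by (simp add: res_uminus)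
    next
      fix x y assume "x \<in> res ` H" "y \<in> res ` H"
      then obtain f g where "x = res f" "y = res g" "f \<in> H" "g \<in> H" "f \<in> cs m" "g \<in> cs m"
        using assms by (auto simp: is_ideal_def)
      then show "x \<oplus>\<^bsub>A\<^esub> y \<in> res ` H" using assms by (auto simp: res_add is_ideal_def)
    qed (use assms in \<open>auto simp: is_ideal_def carrier_A\<close>)
  next
    fix x y assume "x \<in> res ` H" "y \<in> carrier A"
    then obtain f g where *: "x = res f" "y = res g" "f \<in> H" "f \<in> cs m" "g \<in> cs m"
      using assms by (auto simp: is_ideal_def carrier_A)
    then have "g * f \<in> H" using assms by (auto simp: is_ideal_def)
    then show "y \<otimes>\<^bsub>A\<^esub> x \<in> res ` H" "x \<otimes>\<^bsub>A\<^esub> y \<in> res ` H"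
      using * by (auto simp: res_mult mult.commute)
  qed
qed

lemma ideal_prod_res_subset:
  assumes "H \<subseteq> cs m" "\<And>f g. f \<in> H \<Longrightarrow> g \<in> H \<Longrightarrow> f + g \<in> H"
    and "H1 \<subseteq> cs m" "H2 \<subseteq> cs m" "\<And>f g. f \<in> H1 \<Longrightarrow> g \<in> H2 \<Longrightarrow> f * g \<in> H"
  shows "res ` H1 \<cdot>\<^bsub>A\<^esub> res ` H2 \<subseteq> res ` H"
proof
  fix x assume "x \<in> res ` H1 \<cdot>\<^bsub>A\<^esub> res ` H2"
  then show "x \<in> res ` H"
  proof (induction rule: ideal_prod.induct)
    case (prod i j)
    then obtain f g where "i = res f" "j = res g" "f \<in> H1" "g \<in> H2" by auto
    then show ?case using assms by (auto simp: res_mult subset_iff)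
  next
    case (sum s1 s2)
    then obtain f g where "s1 = res f" "s2 = res g" "f \<in> H" "g \<in> H" by auto
    then show ?case using assms(1,2) by (auto simp: res_add subset_iff)
  qed
qed

text \<open>The index set is nonempty because the inductive definition of \<open>ideal_prod\<close>
  starts from products and not from zero.\<close>

lemma ideal_prod_sum_mem:
  assumes "finite I" "I \<noteq> {}" "\<And>i. i \<in> I \<Longrightarrow> F i \<in> H1 \<and> K i \<in> H2" "H1 \<subseteq> cs m" "H2 \<subseteq> cs m"
  shows "res (\<Sum>i\<in>I. F i * K i) \<in> res ` H1 \<cdot>\<^bsub>A\<^esub> res ` H2"
  using assms
proof (induction I rule: finite_ne_induct)
  case (singleton i)
  then have "res (F i) \<otimes>\<^bsub>A\<^esub> res (K i) \<in> res ` H1 \<cdot>\<^bsub>A\<^esub> res ` H2"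
    by (intro ideal_prod.prod) auto
  then show ?case using singleton by (auto simp: res_mult subset_iff)
next
  case (insert i I)
  then have cs: "F j \<in> cs m" "K j \<in> cs m" if "j \<in> insert i I" for j using that by blast+
  have "res (F i) \<otimes>\<^bsub>A\<^esub> res (K i) \<in> res ` H1 \<cdot>\<^bsub>A\<^esub> res ` H2"
    using insert.prems by (intro ideal_prod.prod) auto
  then have "res (F i * K i) \<oplus>\<^bsub>A\<^esub> res (\<Sum>i\<in>I. F i * K i) \<in> res ` H1 \<cdot>\<^bsub>A\<^esub> res ` H2"
    using insert cs by (intro ideal_prod.sum) (auto simp: res_mult)
  moreover have "res (F i * K i) \<oplus>\<^bsub>A\<^esub> res (\<Sum>i\<in>I. F i * K i) = res (F i * K i + (\<Sum>i\<in>I. F i * K i))"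
    using cs by (intro res_add cs_sum cs_mult) auto
  ultimately show ?case using insert.hyps by simp
qed

section \<open>Powers of the maximal ideal\<close>

definition ord :: "nat \<Rightarrow> pseries set" where
  "ord n = {f \<in> cs m. ordge m n f}"

lemma is_ideal_ord: "is_ideal (ord n)"
  unfolding is_ideal_def ord_def using ordge_mult[of m 0 _ n] cs_ordge by (auto intro: ordge_add)

lemma monomial_divisor:
  assumes "d \<le> deg m \<alpha>"
  shows "\<exists>\<epsilon> \<beta>. \<alpha> = \<epsilon> + \<beta> \<and> deg m \<epsilon> = d \<and> keys \<epsilon> \<subseteq> {1..m}"
  using assms
proof (induction d)
  case 0
  then show ?case by (intro exI[of _ 0] exI[of _ \<alpha>]) auto
next
  case (Suc d)
  then obtain \<epsilon> \<beta> where *: "\<alpha> = \<epsilon> + \<beta>" "deg m \<epsilon> = d" "keys \<epsilon> \<subseteq> {1..m}" by auto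
  then have "deg m \<beta> \<noteq> 0" using Suc.prems by (auto simp: deg_add)
  then obtain j where j: "j \<in> {1..m}" "lookup \<beta> j \<noteq> 0"
    unfolding deg_def by (meson sum.not_neutral_contains_not_neutral)
  then obtain \<beta>' where "\<beta> = single j 1 + \<beta>'"
    using add_single_iff[of \<beta> j 1] by auto
  then show ?case
    using * j(1) by (intro exI[of _ "\<epsilon> + single j 1"] exI[of _ \<beta>'])
      (auto simp: add.assoc deg_add deg_single keys_add_nat)
qed

text \<open>Dividing a series of order n + d by all monomials of degree d leaves no rest, and the
  quotients have order n.\<close>

lemma ord_prod: "res ` ord n \<cdot>\<^bsub>A\<^esub> res ` ord d = res ` ord (n + d)"
proof
  show "res ` ord n \<cdot>\<^bsub>A\<^esub> res ` ord d \<subseteq> res ` ord (n + d)"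
    by (rule ideal_prod_res_subset) (auto simp: ord_def intro: ordge_mult ordge_add)
  show "res ` ord (n + d) \<subseteq> res ` ord n \<cdot>\<^bsub>A\<^esub> res ` ord d"
  proof clarify
    fix f assume f: "f \<in> ord (n + d)"
    let ?E = "{\<epsilon>. deg m \<epsilon> = d \<and> keys \<epsilon> \<subseteq> {1..m}}"
    have "?E \<subseteq> exps m d" by (auto simp: exps_def)
    then have "finite ?E" using finite_exps finite_subset by blast
    \<comment> \<open>The monomials are numbered because \<open>quotx\<close> charges a term to the
      least index that divides it.\<close>
    then obtain e where e: "bij_betw e {0..<card ?E} ?E" using ex_bij_betw_nat_finite by blast
    let ?I = "{0..<card ?E}"
    have e_mem: "deg m (e i) = d" "keys (e i) \<subseteq> {1..m}" if "i \<in> ?I" for i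
      using bij_betwE[OF e] that by auto
    have "single 1 d \<in> ?E" using m3 deg_single[of 1 m d] by (auto simp: atLeastAtMost_iff)
    then have "?E \<noteq> {}" by blast
    then have ne: "?I \<noteq> {}" using \<open>finite ?E\<close> by (simp add: card_gt_0_iff)
    have "restx e ?I f = 0"
    proof (rule pseries_eqI)
      fix \<alpha>
      show "cf (restx e ?I f) \<alpha> = cf 0 \<alpha>"
      proof (cases "d \<le> deg m \<alpha>")
        case True
        then obtain \<epsilon> \<beta> where *: "\<alpha> = \<epsilon> + \<beta>" "\<epsilon> \<in> ?E" using monomial_divisor by blast
        then have "\<epsilon> \<in> e ` ?I" by (simp only: bij_betw_imp_surj_on[OF e])
        then have "\<exists>i\<in>?I. \<exists>\<beta>. \<alpha> = e i + \<beta>" using *(1) by blast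
        then show ?thesis by (simp only: cf_restx if_True cf_zero)
      next
        case False
        then have "cf f \<alpha> = 0" using f by (auto simp: ord_def ordge_def)
        then show ?thesis by (simp add: cf_restx)
      qed
    qed
    then have "f = (\<Sum>i\<in>?I. quotx e ?I i f * mon (e i))"
      using quotx_decompose[of ?I f e] by (simp add: mult.commute)
    moreover have "res (\<Sum>i\<in>?I. quotx e ?I i f * mon (e i)) \<in> res ` ord n \<cdot>\<^bsub>A\<^esub> res ` ord d"
    proof (rule ideal_prod_sum_mem)
      fix i assume i: "i \<in> ?I"
      have "quotx e ?I i f \<in> ord n"
        using f e_mem[OF i] ordge_quotx[of m "n + d" f e i ?I] by (auto simp: ord_def)
      moreover have "mon (e i) \<in> ord d"
        using e_mem[OF i] by (auto simp: ord_def intro!: ordge_mon)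
      ultimately show "quotx e ?I i f \<in> ord n \<and> mon (e i) \<in> ord d" by simp
    qed (use ne in \<open>auto simp: ord_def\<close>)
    ultimately show "res f \<in> res ` ord n \<cdot>\<^bsub>A\<^esub> res ` ord d" by simp
  qed
qed

lemma ord_pow: "res ` ord n [^]\<^bsub>ideals_set A\<^esub> (i::nat) = res ` ord (n * i)"
proof (induction i)
  case 0
  then show ?case by (auto simp: nat_pow_def ideals_set_def ord_def carrier_A dest: cs_ordge)
next
  case (Suc i)
  have "res ` ord n [^]\<^bsub>ideals_set A\<^esub> Suc i = (res ` ord n [^]\<^bsub>ideals_set A\<^esub> i) \<cdot>\<^bsub>A\<^esub> res ` ord n"
    by (simp add: nat_pow_def ideals_set_def)
  also have "\<dots> = res ` ord (n * Suc i)"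
    unfolding Suc ord_prod by (simp add: add.commute)
  finally show ?case .
qed

text \<open>Arcs start at the origin, so evaluation along one reads off the constant term.\<close>

lemma J_const: "f \<in> J \<Longrightarrow> cf f 0 = 0"
proof -
  assume f: "f \<in> J"
  obtain \<eta> where arc: "arc 1 1 \<eta>" by (rule arc_exists)
  show ?thesis using ev_nth_zero[of m \<eta> f] ev_J[OF arc f] arc_X_dvd[OF arc] by simp
qed

lemma ord_1_iff: "f \<in> ord 1 \<longleftrightarrow> f \<in> cs m \<and> cf f 0 = 0"
  unfolding ord_def using ordge_1_iff cs_ordge by blast

text \<open>Series with nonzero constant term are units by \<open>cs_inverse\<close>, so a maximal
  ideal lies in the image of \<open>ord 1\<close>. That image is proper by
  \<open>J_const\<close>.\<close>

lemma maximal_eq: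
  assumes "maximalideal M A"
  shows "M = res ` ord 1"
proof -
  interpret A: cring A by (rule cring_A)
  interpret M: maximalideal M A by fact
  have sub: "M \<subseteq> res ` ord 1"
  proof
    fix x assume x: "x \<in> M"
    then obtain f where f: "x = res f" "f \<in> cs m" using M.a_subset carrier_A by blast
    have "cf f 0 = 0"
    proof (rule ccontr)
      assume "cf f 0 \<noteq> 0"
      then obtain g where "g \<in> cs m" "f * g = 1" using cs_inverse f(2) by blast
      then have "\<one>\<^bsub>A\<^esub> \<in> M" using M.I_r_closed[OF x, of "res g"] f by (auto simp: res_mult res_one)
      then show False using M.one_imp_carrier M.I_notcarr by simp
    qed
    then show "x \<in> res ` ord 1" using f by (auto simp: ord_1_iff)
  qed
  have "res 1 \<notin> res ` ord 1"
  proof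
    assume "res 1 \<in> res ` ord 1"
    then obtain f where "res 1 = res f" "f \<in> cs m" "cf f 0 = 0" using ord_1_iff by blast
    then have "1 - f \<in> J" "cf f 0 = 0" using res_eq_iff by auto
    then show False using J_const[of "1 - f"] by (simp add: cf_one)
  qed
  then have "res ` ord 1 \<noteq> carrier A" using res_in[OF cs_1] by blast
  moreover have "res ` ord 1 \<subseteq> carrier A" by (auto simp: ord_1_iff)
  ultimately show ?thesis
    using M.I_maximal[OF ideal_res[OF is_ideal_ord] sub] by auto
qed

end

section \<open>Integral closures of the powers\<close>

text \<open>If F had order d < K, the i-th term of the sum would have order at least K i + d (N - i)
  > d N and could not cancel F^N.\<close>

lemma fps_integral_dvd:
  fixes F :: "complex fps"
  assumes "1 \<le> N" and E: "\<And>i. i \<in> {1..N} \<Longrightarrow> fps_X ^ (K * i) dvd E i"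
    and eq: "F ^ N + (\<Sum>i=1..N. E i * F ^ (N - i)) = 0"
  shows "fps_X ^ K dvd F"
proof (rule ccontr)
  assume K: "\<not> fps_X ^ K dvd F"
  then have "F \<noteq> 0" by auto
  define d where "d = subdegree F"
  have "d < K" using K \<open>F \<noteq> 0\<close> by (subst (asm) fps_dvd_iff) (auto simp: d_def)
  have dF: "fps_X ^ d dvd F" using \<open>F \<noteq> 0\<close> by (subst fps_dvd_iff) (auto simp: d_def)
  have "fps_X ^ Suc (d * N) dvd E i * F ^ (N - i)" if i: "i \<in> {1..N}" for i
  proof -
    have i': "1 \<le> i" "i \<le> N" using i by (auto simp: atLeastAtMost_iff)
    have "fps_X ^ (K * i + d * (N - i)) dvd E i * F ^ (N - i)"
      unfolding power_add power_mult[of _ d] by (intro mult_dvd_mono E i dvd_power_same dF)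
    moreover have "Suc (d * N) \<le> K * i + d * (N - i)"
    proof -
      have "d * N = d * i + d * (N - i)" using i' by (simp add: distrib_left[symmetric])
      moreover have "d * i + i \<le> K * i" using \<open>d < K\<close> by (metis Suc_leI add.commute mult_Suc mult_le_mono1)
      ultimately show ?thesis using i' by linarith
    qed
    ultimately show ?thesis by (meson dvd_trans le_imp_power_dvd)
  qed
  then have "fps_X ^ Suc (d * N) dvd (\<Sum>i=1..N. E i * F ^ (N - i))" by (intro dvd_sum)
  then have "fps_X ^ Suc (d * N) dvd F ^ N"
    using eq by (metis add_eq_0_iff dvd_minus_iff add.commute)
  then have "Suc (d * N) \<le> subdegree (F ^ N)"
    using \<open>F \<noteq> 0\<close> by (subst (asm) fps_dvd_iff) (auto simp: fps_X_power_subdegree simp del: power_Suc subdegree_power)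
  then show False by (simp add: d_def mult.commute)
qed

context brieskorn_alg
begin

definition wcs :: "nat \<Rightarrow> pseries set" where
  "wcs n = {f \<in> cs m. wc (n * L) f}"

lemma is_ideal_wcs: "is_ideal (wcs n)"
  unfolding is_ideal_def wcs_def using wc_mult[OF wc_0] by (auto intro: wc_add)

lemma wc_integral:
  assumes N: "1 \<le> N" and E: "\<And>i. i \<in> {1..N} \<Longrightarrow> E i \<in> ord (n * i)"
    and J: "f ^ N + (\<Sum>i=1..N. E i * f ^ (N - i)) \<in> J"
  shows "wc (n * L) f"
  unfolding wc_def
proof (intro allI impI)
  fix y z \<eta> assume arc: "arc y z \<eta>"
  show "fps_X ^ (n * L) dvd ev m \<eta> f"
  proof (rule fps_integral_dvd[OF N])
    show "ev m \<eta> f ^ N + (\<Sum>i=1..N. ev m \<eta> (E i) * ev m \<eta> f ^ (N - i)) = 0"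
      using ev_J[OF arc J] by (simp add: ev_arc_add[OF arc] ev_arc_sum[OF arc] ev_arc_mult[OF arc] ev_arc_power[OF arc])
    fix i assume "i \<in> {1..N}"
    then have "wc (n * i * L) (E i)" using E wc_ordge unfolding ord_def by blast
    then show "fps_X ^ (n * L * i) dvd ev m \<eta> (E i)"
      using arc unfolding wc_def by (metis mult.assoc mult.commute)
  qed
qed

text \<open>The i-th elementary symmetric function of the \<open>- tw m \<zeta> f\<close>, written
  over i-element subsets of the group so that translations permute its summands.\<close>

definition orb :: "pseries \<Rightarrow> nat \<Rightarrow> pseries" where
  "orb f i = (\<Sum>T\<in>{T \<in> Pow grp. card T = i}. \<Prod>\<zeta>\<in>T. - tw m \<zeta> f)"

lemma orb_cs: "f \<in> cs m \<Longrightarrow> orb f i \<in> cs m"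
  unfolding orb_def by (auto intro!: cs_sum cs_prod cs_uminus cs_tw grp_norm)

lemma orb_wc: "wc K f \<Longrightarrow> wc (i * K) (orb f i)"
  unfolding orb_def
proof (rule wc_sum)
  fix T assume wc: "wc K f" and T: "T \<in> {T \<in> Pow grp. card T = i}"
  have "wc (card T * K) (\<Prod>\<zeta>\<in>T. - tw m \<zeta> f)"
    using T wc by (intro wc_prod finite_subset[OF _ finite_grp] wc_uminus wc_tw) auto
  then show "wc (i * K) (\<Prod>\<zeta>\<in>T. - tw m \<zeta> f)" using T by simp
qed

lemma orb_tw:
  assumes "\<tau> \<in> grp"
  shows "tw m \<tau> (orb f i) = orb f i"
proof -
  let ?a = "\<lambda>\<zeta> j. \<tau> j * \<zeta> j"
  let ?S = "{T \<in> Pow grp. card T = i}"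
  have bij: "bij_betw ?a grp grp" by (rule bij_grp[OF assms])
  have inj: "inj_on ?a T" if "T \<subseteq> grp" for T
    using bij that by (metis bij_betw_def inj_on_subset)
  have "bij_betw ((`) ?a) (Pow grp) (Pow grp)" by (rule bij_betw_Pow[OF bij])
  then have bijS: "bij_betw ((`) ?a) ?S ?S"
    by (rule bij_betw_Collect) (use inj in \<open>auto simp: card_image\<close>)
  have "tw m \<tau> (orb f i) = (\<Sum>T\<in>?S. \<Prod>\<zeta>\<in>T. - tw m (?a \<zeta>) f)"
    by (simp add: orb_def tw_sum tw_prod tw_uminus tw_tw)
  also have "\<dots> = (\<Sum>T\<in>?S. \<Prod>\<zeta>\<in>?a ` T. - tw m \<zeta> f)"
    by (intro sum.cong) (auto simp: prod.reindex[OF inj])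
  also have "\<dots> = orb f i"
    unfolding orb_def by (rule sum.reindex_bij_betw[OF bijS])
  finally show ?thesis .
qed

text \<open>Expand the product of all f - \<open>tw m \<zeta> f\<close> by subset size; the identity
  of the group contributes a zero factor.\<close>

lemma orb_root: "(\<Sum>i\<le>card grp. orb f i * f ^ (card grp - i)) = 0"
proof -
  have "tw m (\<lambda>_. 1) f = f" by (rule pseries_eqI) (simp add: chi_def)
  then have "0 = (\<Prod>\<zeta>\<in>grp. - tw m \<zeta> f + f)"
    using one_grp by (intro prod_zero[symmetric]) (auto intro!: bexI[of _ "\<lambda>_. 1"])
  also have "\<dots> = (\<Sum>T\<in>Pow grp. (\<Prod>\<zeta>\<in>T. - tw m \<zeta> f) * f ^ (card grp - card T))"
    unfolding prod_add[OF finite_grp]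
    by (intro sum.cong) (auto simp: card_Diff_subset finite_subset[OF _ finite_grp])
  also have "\<dots> = (\<Sum>i\<le>card grp. \<Sum>T\<in>{T \<in> Pow grp. card T = i}. (\<Prod>\<zeta>\<in>T. - tw m \<zeta> f) * f ^ (card grp - card T))"
    by (rule sum.group[symmetric]) (auto intro: card_mono)
  also have "\<dots> = (\<Sum>i\<le>card grp. orb f i * f ^ (card grp - i))"
    by (simp add: orb_def sum_distrib_right)
  finally show ?thesis by simp
qed

text \<open>The coefficients of the polynomial with roots \<open>tw m \<zeta> f\<close> are invariant under \<open>grp\<close>, so their
  normal forms only involve the last two variables, where the weight is \<open>L\<close> times the degree.\<close>

lemma orb_nf_ord:
  assumes f: "f \<in> wcs n"
  shows "nf (orb f i) \<in> ord (n * i)"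
proof -
  have fc: "f \<in> cs m" and fw: "wc (n * L) f" using f by (auto simp: wcs_def)
  let ?N = "nf (orb f i)"
  note N = nf_cs[OF orb_cs[OF fc]] nf_reduced[OF orb_cs[OF fc]] nf_J[OF orb_cs[OF fc]]
  \<comment> \<open>Twists preserve both J and reducedness, so uniqueness of normal forms transports
    the invariance of \<open>orb f i\<close>.\<close>
  have inv: "tw m \<tau> ?N = ?N" if \<tau>: "\<tau> \<in> grp" for \<tau>
  proof -
    have "tw m \<tau> (orb f i - ?N) \<in> J" using N(3) \<tau> by (rule J_tw)
    then have "orb f i - tw m \<tau> ?N \<in> J" by (simp add: tw_diff orb_tw[OF \<tau>])
    moreover have "reduced (tw m \<tau> ?N)" using N(2) by (auto simp: reduced_def)
    ultimately show ?thesis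
      by (intro nf_unique[OF cs_tw[OF N(1) grp_norm[OF \<tau>]], symmetric])
  qed
  have "ordge m (n * i) ?N"
    unfolding ordge_def
  proof (intro allI impI)
    fix \<alpha> assume nz: "cf ?N \<alpha> \<noteq> 0"
    \<comment> \<open>An exponent strictly between 0 and a_j is detected by some twist,
      contradicting invariance.\<close>
    have low: "lookup \<alpha> j = 0" if j: "j \<in> {1..m-2}" for j
    proof (rule ccontr)
      assume "lookup \<alpha> j \<noteq> 0"
      moreover have "lookup \<alpha> j < a j" using N(2) nz j by (auto simp: reduced_def)
      ultimately have "lookup \<alpha> j mod a j \<noteq> lookup 0 j mod a j" by simp
      then obtain \<tau> where \<tau>: "\<tau> \<in> grp" "chi m \<tau> \<alpha> \<noteq> chi m \<tau> 0" using chi_separates[OF j] by blast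
      have "chi m \<tau> \<alpha> * cf ?N \<alpha> = cf ?N \<alpha>" using inv[OF \<tau>(1)] by (metis cf_tw)
      then show False using nz \<tau>(2) by (simp add: chi_def)
    qed
    have "wt j * lookup \<alpha> j = L * lookup \<alpha> j" for j
      using low[of j] by (cases "j \<in> {1..m-2}") (auto simp: wt_def)
    then have "Wt \<alpha> = L * deg m \<alpha>" by (simp only: Wt_def deg_def sum_distrib_left)
    moreover have "i * (n * L) \<le> Wt \<alpha>"
      using orb_wc[OF fw] nz wc_nf[OF orb_cs[OF fc]] by blast
    ultimately have "L * (n * i) \<le> L * deg m \<alpha>" by (simp add: algebra_simps)
    then show "keys \<alpha> \<subseteq> {1..m} \<and> n * i \<le> deg m \<alpha>"
      using L_pos cs_ordge[OF N(1)] nz by (auto simp: ordge_def)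
  qed
  then show ?thesis using N(1) by (simp add: ord_def)
qed

lemma res_polynomial:
  assumes "f \<in> cs m" "\<And>i. i \<in> {1..N} \<Longrightarrow> E i \<in> cs m" "\<And>i. i \<in> {1..N} \<Longrightarrow> c i = res (E i)"
  shows "res f [^]\<^bsub>A\<^esub> N \<oplus>\<^bsub>A\<^esub> (\<Oplus>\<^bsub>A\<^esub>i\<in>{1..N}. c i \<otimes>\<^bsub>A\<^esub> res f [^]\<^bsub>A\<^esub> (N - i))
    = res (f ^ N + (\<Sum>i=1..N. E i * f ^ (N - i)))"
proof -
  interpret A: cring A by (rule cring_A)
  have "(\<Oplus>\<^bsub>A\<^esub>i\<in>{1..N}. c i \<otimes>\<^bsub>A\<^esub> res f [^]\<^bsub>A\<^esub> (N - i)) = (\<Oplus>\<^bsub>A\<^esub>i\<in>{1..N}. res (E i * f ^ (N - i)))"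
    using assms by (intro A.finsum_cong') (auto simp: res_pow res_mult cs_power)
  also have "\<dots> = res (\<Sum>i=1..N. E i * f ^ (N - i))"
    using assms by (intro res_finsum) auto
  finally show ?thesis
    using assms by (simp add: res_pow res_add cs_power cs_sum cs_mult)
qed

lemma res_nf: "f \<in> cs m \<Longrightarrow> res (nf f) = res f"
  using res_eq_iff[of f "nf f"] nf by auto

text \<open>Arcs bound the closure from above, the orbit polynomial from below. In the latter the
  coefficients are exchanged for their normal forms, since \<open>orb f i\<close> itself may have
  order below n i: high weight is compatible with low degree in the x_i.\<close>

lemma closed_power_eq: "closed_power A (res ` ord 1) n = res ` wcs n"
proof -
  have pow: "(res ` ord 1 [^]\<^bsub>ideals_set A\<^esub> n) [^]\<^bsub>ideals_set A\<^esub> i = res ` ord (n * i)" for i :: nat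
    using ord_pow[of 1 n] ord_pow[of n i] by simp
  show ?thesis
  proof
    show "closed_power A (res ` ord 1) n \<subseteq> res ` wcs n"
    proof
      fix x assume "x \<in> closed_power A (res ` ord 1) n"
      then obtain N c where x: "x \<in> carrier A" and N: "1 \<le> N"
        and c: "\<And>i. i \<in> {1..N} \<Longrightarrow> c i \<in> res ` ord (n * i)"
        and eq: "x [^]\<^bsub>A\<^esub> N \<oplus>\<^bsub>A\<^esub> (\<Oplus>\<^bsub>A\<^esub>i\<in>{1..N}. c i \<otimes>\<^bsub>A\<^esub> x [^]\<^bsub>A\<^esub> (N - i)) = \<zero>\<^bsub>A\<^esub>"
        unfolding closed_power_def integral_closure_def pow by blast
      obtain f where f: "x = res f" "f \<in> cs m" using x by (auto simp: carrier_A)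
      have "\<forall>i\<in>{1..N}. \<exists>g. g \<in> ord (n * i) \<and> c i = res g" using c by blast
      then obtain E where E: "\<And>i. i \<in> {1..N} \<Longrightarrow> E i \<in> ord (n * i)" "\<And>i. i \<in> {1..N} \<Longrightarrow> c i = res (E i)"
        by metis
      have Ecs: "E i \<in> cs m" if "i \<in> {1..N}" for i using E(1)[OF that] by (simp add: ord_def)
      have "res (f ^ N + (\<Sum>i=1..N. E i * f ^ (N - i))) = res 0"
        using eq res_polynomial[OF f(2) Ecs E(2)] f(1) res_zero by simp
      then have "f ^ N + (\<Sum>i=1..N. E i * f ^ (N - i)) \<in> J"
        using f(2) Ecs by (subst (asm) res_eq_iff) auto
      then show "x \<in> res ` wcs n"
        using wc_integral[OF N E(1)] f by (auto simp: wcs_def)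
    qed
    show "res ` wcs n \<subseteq> closed_power A (res ` ord 1) n"
    proof clarify
      fix f assume f: "f \<in> wcs n"
      then have fc: "f \<in> cs m" by (simp add: wcs_def)
      define N where "N = card grp"
      have N: "1 \<le> N" using one_grp finite_grp by (auto simp: N_def Suc_le_eq card_gt_0_iff One_nat_def)
      have "orb f 0 = 1"
      proof -
        have "{T \<in> Pow grp. card T = 0} = {{}}" using finite_subset[OF _ finite_grp] by auto
        then show ?thesis by (simp add: orb_def)
      qed
      then have "0 = f ^ N + (\<Sum>i=1..N. orb f i * f ^ (N - i))"
        using orb_root[of f] by (simp add: N_def atMost_atLeast0 sum.atLeast_Suc_atMost One_nat_def)
      moreover have "res (nf (orb f i)) = res (orb f i)" for i
        by (rule res_nf[OF orb_cs[OF fc]])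
      ultimately have "res f [^]\<^bsub>A\<^esub> N \<oplus>\<^bsub>A\<^esub>
          (\<Oplus>\<^bsub>A\<^esub>i\<in>{1..N}. res (nf (orb f i)) \<otimes>\<^bsub>A\<^esub> res f [^]\<^bsub>A\<^esub> (N - i)) = \<zero>\<^bsub>A\<^esub>"
        using res_polynomial[OF fc orb_cs[OF fc], of N "\<lambda>i. res (nf (orb f i))" "\<lambda>i. i"] res_zero by simp
      then show "res f \<in> closed_power A (res ` ord 1) n"
        unfolding closed_power_def integral_closure_def pow
        using N fc orb_nf_ord[OF f]
        by (intro CollectI conjI exI[of _ N] exI[of _ "\<lambda>i. res (nf (orb f i))"] res_in ballI imageI)
    qed
  qed
qed

section \<open>Multiplication by the minimal reduction\<close>

definition qi :: "pseries set" where
  "qi = {var (m-1) * f + var m * g | f g. f \<in> cs m \<and> g \<in> cs m}"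

definition yz :: "(nat \<Rightarrow>\<^sub>0 nat) \<Rightarrow> nat" where
  "yz \<alpha> = lookup \<alpha> (m-1) + lookup \<alpha> m"

text \<open>The description of Q times the n-th closed power by normal forms: weight at least n + 1
  and every monomial divisible by one of the last two variables. \<open>qi_prod\<close> confirms
  it.\<close>

definition qw :: "nat \<Rightarrow> pseries set" where
  "qw n = {f \<in> cs m. \<forall>\<alpha>. cf (nf f) \<alpha> \<noteq> 0 \<longrightarrow> Suc n * L \<le> Wt \<alpha> \<and> 1 \<le> yz \<alpha>}"

lemma qw_cs: "qw n \<subseteq> cs m" and wcs_cs: "wcs n \<subseteq> cs m"
  by (auto simp: qw_def wcs_def)

lemma qi_cs: "qi \<subseteq> cs m"
  unfolding qi_def by (auto intro!: cs_add cs_mult cs_var)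

lemma is_ideal_qi: "is_ideal qi"
  unfolding is_ideal_def
proof (intro conjI ballI)
  show "0 \<in> qi" unfolding qi_def by (auto intro!: exI[of _ 0])
  show "qi \<subseteq> cs m" by (rule qi_cs)
  fix f g assume "f \<in> qi"
  then obtain u v where f: "f = var (m-1) * u + var m * v" "u \<in> cs m" "v \<in> cs m" by (auto simp: qi_def)
  {
    assume "g \<in> qi"
    then obtain u' v' where "g = var (m-1) * u' + var m * v'" "u' \<in> cs m" "v' \<in> cs m" by (auto simp: qi_def)
    then have "f + g = var (m-1) * (u + u') + var m * (v + v')" "u + u' \<in> cs m" "v + v' \<in> cs m"
      using f by (auto simp: algebra_simps)
    then show "f + g \<in> qi" unfolding qi_def by blast
  }
  {
    assume "g \<in> cs m"
    then have "g * f = var (m-1) * (g * u) + var m * (g * v)" "g * u \<in> cs m" "g * v \<in> cs m"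
      using f by (auto simp: algebra_simps)
    then show "g * f \<in> qi" unfolding qi_def by blast
  }
qed

lemma var_qi: "var (m-1) \<in> qi" "var m \<in> qi"
proof -
  have "var (m-1) = var (m-1) * 1 + var m * 0" "var m = var (m-1) * 0 + var m * 1" by auto
  then show "var (m-1) \<in> qi" "var m \<in> qi" unfolding qi_def by blast+
qed

lemma qi_eq: "Idl\<^bsub>A\<^esub> {brieskorn_coord m a q (m-1), brieskorn_coord m a q m} = res ` qi"
proof -
  interpret A: cring A by (rule cring_A)
  let ?S = "{res (var (m-1)), res (var m)}"
  have c: "?S \<subseteq> carrier A" by (auto intro!: res_in cs_var)
  have "res ` qi \<subseteq> Idl\<^bsub>A\<^esub> ?S"
  proof clarify
    fix f assume "f \<in> qi"
    then obtain u v where f: "f = var (m-1) * u + var m * v" "u \<in> cs m" "v \<in> cs m" by (auto simp: qi_def)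
    interpret I: ideal "Idl\<^bsub>A\<^esub> ?S" A by (rule A.genideal_ideal[OF c])
    have "res (var (m-1)) \<in> Idl\<^bsub>A\<^esub> ?S" "res (var m) \<in> Idl\<^bsub>A\<^esub> ?S" using A.genideal_self[OF c] by auto
    then have "res (var (m-1)) \<otimes>\<^bsub>A\<^esub> res u \<oplus>\<^bsub>A\<^esub> res (var m) \<otimes>\<^bsub>A\<^esub> res v \<in> Idl\<^bsub>A\<^esub> ?S"
      using f by (intro I.a_closed I.I_r_closed) auto
    then show "res f \<in> Idl\<^bsub>A\<^esub> ?S"
      using f by (simp add: res_mult res_add cs_mult cs_var)
  qed
  moreover have "Idl\<^bsub>A\<^esub> ?S \<subseteq> res ` qi"
    using var_qi by (intro A.genideal_minimal ideal_res is_ideal_qi) auto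
  ultimately show ?thesis unfolding coord_eq by blast
qed

lemma
  assumes "j \<in> {m-1, m}"
  shows Wt_var_add: "Wt (single j 1 + \<beta>) = L + Wt \<beta>"
    and yz_var_add: "yz (single j 1 + \<beta>) = Suc (yz \<beta>)"
    and lookup_var_add: "i \<in> {1..m-2} \<Longrightarrow> lookup (single j 1 + \<beta>) i = lookup \<beta> i"
proof -
  have j: "j \<in> {1..m}" using assms by auto
  have "(\<Sum>i=1..m. wt i * lookup (single j 1) i) = (\<Sum>i=1..m. if i = j then wt j else 0)"
    by (intro sum.cong) (auto simp: lookup_single when_def)
  then have "Wt (single j 1) = wt j" using j by (simp add: Wt_def)
  then show "Wt (single j 1 + \<beta>) = L + Wt \<beta>" using assms wt_simps by (auto simp: Wt_add)
  show "yz (single j 1 + \<beta>) = Suc (yz \<beta>)"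
    using assms by (auto simp: yz_def lookup_add lookup_single when_def)
  show "lookup (single j 1 + \<beta>) i = lookup \<beta> i" if "i \<in> {1..m-2}"
    using assms that by (auto simp: lookup_add lookup_single when_def)
qed

text \<open>Multiplying a normal form by one of the last two variables keeps it reduced, so no
  further division occurs and each weight rises by exactly L.\<close>

lemma var_mult_wcs:
  assumes f: "f \<in> wcs n" and j: "j \<in> {m-1, m}"
  shows "var j * f \<in> qw n"
proof -
  have fc: "f \<in> cs m" and fw: "\<And>\<alpha>. cf (nf f) \<alpha> \<noteq> 0 \<Longrightarrow> n * L \<le> Wt \<alpha>"
    using f wc_nf by (auto simp: wcs_def)
  have vc: "var j \<in> cs m" using j by (intro cs_var) auto
  have supp: "\<exists>\<beta>. \<alpha> = single j 1 + \<beta> \<and> cf (nf f) \<beta> \<noteq> 0"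
    if "cf (var j * nf f) \<alpha> \<noteq> 0" for \<alpha>
  proof (cases "\<exists>\<beta>. \<alpha> = single j 1 + \<beta>")
    case True
    then obtain \<beta> where "\<alpha> = single j 1 + \<beta>" ..
    then show ?thesis using that by (intro exI[of _ \<beta>]) (simp del: One_nat_def)
  qed (use that cf_mon_mult_eq_0 in blast)
  have red: "reduced (var j * nf f)"
    unfolding reduced_def
  proof (intro allI impI ballI)
    fix \<alpha> i assume "cf (var j * nf f) \<alpha> \<noteq> 0" "i \<in> {1..m-2}"
    then show "lookup \<alpha> i < a i"
      using supp[of \<alpha>] nf_reduced[OF fc] lookup_var_add[OF j] by (auto simp: reduced_def)
  qed
  have "var j * f - var j * nf f \<in> J"
    using J_mult'[OF nf_J[OF fc] vc] by (simp add: algebra_simps)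
  then have nf: "nf (var j * f) = var j * nf f"
    using nf_cs[OF fc] vc red by (intro nf_unique) auto
  have "Suc n * L \<le> Wt \<alpha> \<and> 1 \<le> yz \<alpha>" if "cf (var j * nf f) \<alpha> \<noteq> 0" for \<alpha>
    using supp[OF that] fw Wt_var_add[OF j] yz_var_add[OF j] by fastforce
  then show ?thesis unfolding qw_def mem_Collect_eq nf using fc vc by auto
qed

lemma qw_add: "f \<in> qw n \<Longrightarrow> g \<in> qw n \<Longrightarrow> f + g \<in> qw n"
  unfolding qw_def mem_Collect_eq using nf_add[of f g] cs_add[of f m g] by (metis add.left_neutral cf_add)

lemma yz_decompose:
  assumes "\<And>\<alpha>. cf f \<alpha> \<noteq> 0 \<Longrightarrow> 1 \<le> yz \<alpha>"
  shows "f = (\<Sum>i\<in>{m-1, m}. var i * quotx (\<lambda>j. single j 1) {m-1, m} i f)"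
proof -
  have "restx (\<lambda>j. single j 1) {m-1, m} f = 0"
  proof (rule pseries_eqI)
    fix \<alpha>
    have "\<exists>i\<in>{m-1, m}. \<exists>\<beta>. \<alpha> = single i 1 + \<beta>" if "cf f \<alpha> \<noteq> 0"
    proof -
      have "1 \<le> lookup \<alpha> (m-1) \<or> 1 \<le> lookup \<alpha> m"
        using assms[OF that] by (auto simp: yz_def)
      then show ?thesis by (metis add_single_iff insertI1 insertI2)
    qed
    then show "cf (restx (\<lambda>j. single j 1) {m-1, m} f) \<alpha> = cf 0 \<alpha>"
      unfolding cf_restx cf_zero by (auto split: if_splits)
  qed
  then show ?thesis
    using quotx_decompose[of "{m-1, m}" f "\<lambda>j. single j 1"] by simp
qed

text \<open>For the converse inclusion, splitting y or z off each monomial of a normal form lowers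
  its weight by exactly L, which lands in the n-th closed power.\<close>

lemma qi_prod: "res ` qi \<cdot>\<^bsub>A\<^esub> res ` wcs n = res ` qw n"
proof
  show "res ` qi \<cdot>\<^bsub>A\<^esub> res ` wcs n \<subseteq> res ` qw n"
  proof (rule ideal_prod_res_subset)
    fix f g assume "f \<in> qi" and g: "g \<in> wcs n"
    then obtain u v where f: "f = var (m-1) * u + var m * v" "u \<in> cs m" "v \<in> cs m" by (auto simp: qi_def)
    have "u * g \<in> wcs n" "v * g \<in> wcs n" using f g is_ideal_wcs by (auto simp: is_ideal_def)
    then have "var (m-1) * (u * g) + var m * (v * g) \<in> qw n"
      by (intro qw_add var_mult_wcs) auto
    then show "f * g \<in> qw n" using f by (simp add: algebra_simps)
  qed (simp_all add: qw_cs qi_cs wcs_cs qw_add)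
  show "res ` qw n \<subseteq> res ` qi \<cdot>\<^bsub>A\<^esub> res ` wcs n"
  proof clarify
    fix f assume f: "f \<in> qw n"
    then have fc: "f \<in> cs m" by (simp add: qw_def)
    define I where "I = {m-1, m}"
    define e where "e j = single j (1::nat)" for j :: nat
    have "nf f = (\<Sum>i\<in>I. var i * quotx e I i (nf f))"
      unfolding I_def e_def using f by (intro yz_decompose) (auto simp: qw_def)
    moreover have "res (\<Sum>i\<in>I. var i * quotx e I i (nf f)) \<in> res ` qi \<cdot>\<^bsub>A\<^esub> res ` wcs n"
    proof (rule ideal_prod_sum_mem)
      fix i assume i: "i \<in> I"
      have "quotx e I i (nf f) \<in> wcs n"
        unfolding wcs_def
      proof (intro CollectI conjI cs_quotx nf_cs fc wc_Wt)
        fix \<beta> assume "cf (quotx e I i (nf f)) \<beta> \<noteq> 0"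
        then have "cf (nf f) (e i + \<beta>) \<noteq> 0" by (simp add: cf_quotx split: if_splits)
        then have "Suc n * L \<le> Wt (e i + \<beta>)" using f by (simp add: qw_def)
        then show "n * L \<le> Wt \<beta>" using Wt_var_add[of i \<beta>] i by (simp add: e_def I_def)
      qed
      then show "var i \<in> qi \<and> quotx e I i (nf f) \<in> wcs n"
        using i var_qi by (auto simp: I_def)
    qed (simp_all add: I_def qi_cs wcs_cs)
    ultimately show "res f \<in> res ` qi \<cdot>\<^bsub>A\<^esub> res ` wcs n" using res_nf[OF fc] by simp
  qed
qed

end

section \<open>Vector spaces presented by power series\<close>

text \<open>A space given as the image of a linear map \<kappa> on a set of series. Questions about
  cosets thereby become questions about series.\<close>

locale presented_space =
  fixes V :: "(complex, 'v, 'z) module_scheme" and \<kappa> :: "pseries \<Rightarrow> 'v" and H :: "pseries set"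
  assumes H0: "0 \<in> H" and H_add: "f \<in> H \<Longrightarrow> g \<in> H \<Longrightarrow> f + g \<in> H"
    and H_cst: "f \<in> H \<Longrightarrow> cst c * f \<in> H"
    and carrier_V: "carrier V = \<kappa> ` H"
    and add_V: "f \<in> H \<Longrightarrow> g \<in> H \<Longrightarrow> \<kappa> f \<oplus>\<^bsub>V\<^esub> \<kappa> g = \<kappa> (f + g)"
    and zero_V: "\<zero>\<^bsub>V\<^esub> = \<kappa> 0"
    and smult_V: "f \<in> H \<Longrightarrow> c \<odot>\<^bsub>V\<^esub> \<kappa> f = \<kappa> (cst c * f)"
begin

lemma module_V: "module class_ring V"
proof (rule moduleI)
  show "cring (class_ring :: complex ring)" by (meson class_field field.axioms(1) domain.axioms(1))
  show "abelian_group V"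
  proof (rule abelian_groupI)
    fix x assume "x \<in> carrier V"
    then obtain f where f: "x = \<kappa> f" "f \<in> H" by (auto simp: carrier_V)
    then have "\<kappa> (cst (- 1) * f) \<oplus>\<^bsub>V\<^esub> x = \<zero>\<^bsub>V\<^esub>"
      unfolding f(1) zero_V add_V[OF H_cst[OF f(2)] f(2)] by (simp add: cst_minus cst_1)
    then show "\<exists>y\<in>carrier V. y \<oplus>\<^bsub>V\<^esub> x = \<zero>\<^bsub>V\<^esub>"
      using H_cst[OF f(2)] by (auto simp: carrier_V)
  qed (auto simp: carrier_V add_V zero_V H_add H0 add_ac)
qed (auto simp: carrier_V smult_V add_V H_add H_cst cst_add cst_mult cst_1 distrib_left distrib_right mult.assoc)

lemma vectorspace_V: "vectorspace class_ring V"
  unfolding vectorspace_def using module_V class_field by blast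

lemma H_sum: "(\<And>i. i \<in> I \<Longrightarrow> F i \<in> H) \<Longrightarrow> sum F I \<in> H"
  by (induction I rule: infinite_finite_induct) (auto intro: H0 H_add)

interpretation V: vectorspace class_ring V
  by (rule vectorspace_V)

lemma lincomb_V:
  assumes "finite U" "\<And>u. u \<in> U \<Longrightarrow> F u \<in> H" "inj_on (\<lambda>u. \<kappa> (F u)) U"
  shows "V.lincomb c ((\<lambda>u. \<kappa> (F u)) ` U) = \<kappa> (\<Sum>u\<in>U. cst (c (\<kappa> (F u))) * F u)"
proof -
  have "(\<Oplus>\<^bsub>V\<^esub>u\<in>U. c (\<kappa> (F u)) \<odot>\<^bsub>V\<^esub> \<kappa> (F u)) = \<kappa> (\<Sum>u\<in>U. cst (c (\<kappa> (F u))) * F u)"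
    using assms(1,2)
  proof (induction U rule: finite_induct)
    case (insert u U)
    have "(\<lambda>u. c (\<kappa> (F u)) \<odot>\<^bsub>V\<^esub> \<kappa> (F u)) \<in> insert u U \<rightarrow> carrier V"
      using insert.prems by (auto simp: smult_V carrier_V H_cst)
    moreover have "(\<Sum>u\<in>U. cst (c (\<kappa> (F u))) * F u) \<in> H"
      using insert.prems by (intro H_sum H_cst) auto
    ultimately show ?case
      using insert by (subst V.finsum_insert) (simp_all add: Pi_def smult_V add_V H_cst)
  qed (simp add: zero_V)
  moreover have "(\<lambda>v. c v \<odot>\<^bsub>V\<^esub> v) \<in> (\<lambda>u. \<kappa> (F u)) ` U \<rightarrow> carrier V"
    using assms(2) by (auto simp: smult_V carrier_V H_cst)
  ultimately show ?thesis
    unfolding V.lincomb_def using V.finsum_reindex[OF _ assms(3)] by simp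
qed

text \<open>The functionals \<open>x _ u\<close> act as coordinates: their common zeros are the
  kernel of \<kappa>, and the \<open>F u\<close> are dual to them. Both independence and spanning
  follow by reading coordinates.\<close>

lemma basis_V:
  assumes fin: "finite E" and F: "\<And>u. u \<in> E \<Longrightarrow> F u \<in> H"
    and ker: "\<And>f. f \<in> H \<Longrightarrow> \<kappa> f = \<kappa> 0 \<longleftrightarrow> (\<forall>u\<in>E. x f u = 0)"
    and lin: "\<And>f g u. f \<in> H \<Longrightarrow> g \<in> H \<Longrightarrow> x (f + g) u = x f u + x g u"
      "\<And>f c u. f \<in> H \<Longrightarrow> x (cst c * f) u = c * x f u"
    and dual: "\<And>u v. u \<in> E \<Longrightarrow> v \<in> E \<Longrightarrow> x (F u) v = (if v = u then (1 :: complex) else 0)"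
  shows "inj_on (\<lambda>u. \<kappa> (F u)) E" "V.basis ((\<lambda>u. \<kappa> (F u)) ` E)"
proof -
  have x_sum: "x (\<Sum>u\<in>U. cst (c u) * F u) v = (if v \<in> U then c v else 0)" if "U \<subseteq> E" "v \<in> E" for U c v
  proof -
    have "finite U" using that(1) fin finite_subset by blast
    then show ?thesis using that
    proof (induction U rule: finite_induct)
      case empty
      then show ?case using lin(2)[OF H0, of 0 v] by simp
    next
      case (insert u U)
      have "(\<Sum>u\<in>U. cst (c u) * F u) \<in> H" using insert.prems F by (intro H_sum H_cst) auto
      then show ?case
        using insert F by (auto simp: lin H_cst dual)
    qed
  qed
  have diff: "x (f - g) u = x f u - x g u" "f - g \<in> H" if "f \<in> H" "g \<in> H" for f g u
    using lin(1)[OF that(1) H_cst[OF that(2)], of "- 1" u] lin(2)[OF that(2), of "- 1" u]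
      H_add[OF that(1) H_cst[OF that(2), of "- 1"]]
    by (simp_all add: cst_minus cst_1)
  have eq: "\<kappa> f = \<kappa> g" if "f \<in> H" "g \<in> H" "\<And>u. u \<in> E \<Longrightarrow> x f u = x g u" for f g
  proof -
    have "\<kappa> (f - g) = \<kappa> 0" using ker diff that by simp
    then have "\<kappa> (f - g) \<oplus>\<^bsub>V\<^esub> \<kappa> g = \<kappa> 0 \<oplus>\<^bsub>V\<^esub> \<kappa> g" by simp
    then show ?thesis using that diff H0 by (simp add: add_V)
  qed
  have x_eq: "x f u = x g u" if "f \<in> H" "g \<in> H" "\<kappa> f = \<kappa> g" "u \<in> E" for f g u
  proof -
    have "\<kappa> (f + cst (- 1) * g) = \<kappa> (g + cst (- 1) * g)"
      using that H_cst[OF that(2), of "- 1"] add_V by metis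
    then have "\<kappa> (f - g) = \<kappa> 0" by (simp add: cst_minus cst_1)
    then have "x (f - g) u = 0" using ker diff that by blast
    then show ?thesis using diff that by simp
  qed
  show inj: "inj_on (\<lambda>u. \<kappa> (F u)) E"
  proof (rule inj_onI)
    fix u v assume "u \<in> E" "v \<in> E" "\<kappa> (F u) = \<kappa> (F v)"
    then have "x (F u) u = x (F v) u" using x_eq F by blast
    then show "u = v" using dual \<open>u \<in> E\<close> \<open>v \<in> E\<close> by (simp split: if_splits)
  qed
  show "V.basis ((\<lambda>u. \<kappa> (F u)) ` E)"
    unfolding V.basis_def
  proof (intro conjI)
    show sub: "(\<lambda>u. \<kappa> (F u)) ` E \<subseteq> carrier V" using F by (auto simp: carrier_V)
    show "V.lin_indpt ((\<lambda>u. \<kappa> (F u)) ` E)"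
    proof
      assume "V.lin_dep ((\<lambda>u. \<kappa> (F u)) ` E)"
      then obtain B c v where B: "B \<subseteq> (\<lambda>u. \<kappa> (F u)) ` E" "V.lincomb c B = \<zero>\<^bsub>V\<^esub>" "v \<in> B" "c v \<noteq> 0"
        unfolding V.lin_dep_def by auto
      obtain U where U: "U \<subseteq> E" "B = (\<lambda>u. \<kappa> (F u)) ` U" using B(1) by (meson subset_image_iff)
      then obtain u where u: "u \<in> U" "v = \<kappa> (F u)" using B(3) by auto
      let ?s = "\<Sum>u\<in>U. cst (c (\<kappa> (F u))) * F u"
      have "V.lincomb c B = \<kappa> ?s"
        unfolding U(2) using U(1) fin F inj by (intro lincomb_V) (auto intro: finite_subset inj_on_subset)
      then have "\<kappa> ?s = \<kappa> 0" using B(2) zero_V by simp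
      moreover have "?s \<in> H" using U F by (intro H_sum H_cst) auto
      ultimately have "x ?s u = 0" using ker u(1) U(1) by blast
      then show False using x_sum[OF U(1), of u "\<lambda>u. c (\<kappa> (F u))"] u U(1) B(4) by auto
    qed
    show "V.gen_set ((\<lambda>u. \<kappa> (F u)) ` E)"
    proof
      show "V.span ((\<lambda>u. \<kappa> (F u)) ` E) \<subseteq> carrier V" by (rule V.span_is_subset2[OF sub])
      show "carrier V \<subseteq> V.span ((\<lambda>u. \<kappa> (F u)) ` E)"
      proof
        fix y assume "y \<in> carrier V"
        then obtain f where f: "y = \<kappa> f" "f \<in> H" by (auto simp: carrier_V)
        \<comment> \<open>Coefficients of a linear combination are indexed by vectors, so the
          coordinate is looked up through the inverse of the injective family.\<close>
        define c where "c v = x f (inv_into E (\<lambda>u. \<kappa> (F u)) v)" for v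
        have "V.lincomb c ((\<lambda>u. \<kappa> (F u)) ` E) = \<kappa> (\<Sum>u\<in>E. cst (c (\<kappa> (F u))) * F u)"
          using fin F inj by (rule lincomb_V)
        also have "\<dots> = \<kappa> f"
        proof (rule eq[OF _ f(2)])
          show "(\<Sum>u\<in>E. cst (c (\<kappa> (F u))) * F u) \<in> H" using F by (intro H_sum H_cst) auto
          fix u assume "u \<in> E"
          then show "x (\<Sum>u\<in>E. cst (c (\<kappa> (F u))) * F u) u = x f u"
            using x_sum[of E u "\<lambda>u. c (\<kappa> (F u))"] inv_into_f_f[OF inj \<open>u \<in> E\<close>] by (simp add: c_def)
        qed
        finally have "y = V.lincomb c ((\<lambda>u. \<kappa> (F u)) ` E)" using f(1) by simp
        then show "y \<in> V.span ((\<lambda>u. \<kappa> (F u)) ` E)"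
          unfolding V.span_def mem_Collect_eq
          by (intro exI[of _ c] exI[of _ "(\<lambda>u. \<kappa> (F u)) ` E"]) (simp add: fin)
      qed
    qed
  qed
qed

end

section \<open>The quotients and the reduction numbers\<close>

context brieskorn_alg
begin

definition kap :: "nat \<Rightarrow> pseries \<Rightarrow> series set set" where
  "kap n f = (res ` qw n) +>\<^bsub>A\<^esub> res f"

lemma ideal_qw: "ideal (res ` qw n) A"
proof -
  interpret A: cring A by (rule cring_A)
  show ?thesis
    unfolding qi_prod[symmetric]
    by (intro A.ideal_prod_is_ideal ideal_res is_ideal_qi is_ideal_wcs)
qed

text \<open>\<open>qw n\<close> is defined through normal forms and is therefore a union of classes
  modulo J.\<close>

lemma res_mem_qw: "f \<in> cs m \<Longrightarrow> res f \<in> res ` qw n \<longleftrightarrow> f \<in> qw n"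
proof
  assume f: "f \<in> cs m" "res f \<in> res ` qw n"
  then obtain g where g: "g \<in> qw n" "res f = res g" by auto
  then have "nf f = nf g" using f qw_cs nf_eq_iff res_eq_iff by blast
  then show "f \<in> qw n" using f g by (simp add: qw_def)
qed auto

lemma kap_eq_iff:
  assumes "f \<in> cs m" "g \<in> cs m"
  shows "kap n f = kap n g \<longleftrightarrow> f - g \<in> qw n"
proof -
  interpret A: cring A by (rule cring_A)
  interpret I: ideal "res ` qw n" A by (rule ideal_qw)
  have "res f \<oplus>\<^bsub>A\<^esub> \<ominus>\<^bsub>A\<^esub> res g = res (f - g)"
    using assms by (simp add: res_uminus res_add cs_uminus)
  then have mem: "res f \<in> kap n g \<longleftrightarrow> f - g \<in> qw n"
    unfolding kap_def using I.a_rcos_module[of "res g" "res f"] assms res_mem_qw[of "f - g" n] by auto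
  show ?thesis
  proof
    assume "kap n f = kap n g"
    moreover have "res f \<in> kap n f"
      unfolding kap_def using assms by (intro I.a_rcos_self) auto
    ultimately show "f - g \<in> qw n" using mem by simp
  next
    assume "f - g \<in> qw n"
    then have "res f \<in> kap n g" using mem by simp
    then show "kap n f = kap n g"
      unfolding kap_def using A.a_repr_independence[of "res f" "res ` qw n" "res g"] assms I.a_subgroup by auto
  qed
qed

lemma kap_hom:
  assumes "f \<in> cs m" "g \<in> cs m"
  shows "kap n f \<oplus>\<^bsub>A Quot (res ` qw n)\<^esub> kap n g = kap n (f + g)"
    and "kap n f \<otimes>\<^bsub>A Quot (res ` qw n)\<^esub> kap n g = kap n (f * g)"
  using ring_hom_add[OF ideal.rcos_ring_hom[OF ideal_qw], of "res f" "res g"]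
    ring_hom_mult[OF ideal.rcos_ring_hom[OF ideal_qw], of "res f" "res g"] assms
  by (simp_all add: kap_def res_add res_mult res_in)

abbreviation V :: "nat \<Rightarrow> (complex, series set set) module" where
  "V n \<equiv> quot_space (brieskorn_const m a q) A (res ` wcs (n + 1)) (res ` qw n)"

lemma presented_V: "presented_space (V n) (kap n) (wcs (n + 1))"
proof
  show "\<zero>\<^bsub>V n\<^esub> = kap n 0"
  proof -
    interpret A: cring A by (rule cring_A)
    interpret I: ideal "res ` qw n" A by (rule ideal_qw)
    have "kap n 0 = res ` qw n"
      unfolding kap_def res_zero[symmetric] by (rule I.a_rcos_const) (rule I.zero_closed)
    then show ?thesis by (simp add: quot_space_def FactRing_def)
  qed
  show "c \<odot>\<^bsub>V n\<^esub> kap n f = kap n (cst c * f)" if "f \<in> wcs (n + 1)" for c f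
    using kap_hom(2)[of "cst c" f n] that wcs_cs by (auto simp: quot_space_def const_eq kap_def[symmetric])
  show "cst c * f \<in> wcs (n + 1)" if "f \<in> wcs (n + 1)" for c f
    using is_ideal_wcs[of "n + 1"] that cs_cst unfolding is_ideal_def by blast
qed (use is_ideal_wcs[of "n + 1"] wcs_cs kap_hom(1) in
    \<open>auto simp: is_ideal_def quot_space_def kap_def image_image subset_iff\<close>)

section \<open>The monomials of the basis\<close>

definition pm :: "(nat \<Rightarrow> nat) \<Rightarrow> (nat \<Rightarrow>\<^sub>0 nat)" where
  "pm u = (\<Sum>i=1..m-2. single i (u i))"

lemma lookup_pm: "lookup (pm u) j = (if j \<in> {1..m-2} then u j else 0)"
  by (simp add: pm_def lookup_sum lookup_single when_def)

lemma keys_pm: "keys (pm u) \<subseteq> {1..m}"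
  by (auto simp: in_keys_iff lookup_pm split: if_splits)

lemma yz_pm: "yz (pm u) = 0"
  by (simp add: yz_def lookup_pm)

lemma mon_pm: "mon (pm u) = (\<Prod>i=1..m-2. var i ^ u i)"
proof -
  have "mon (\<Sum>i\<in>I. single i (u i)) = (\<Prod>i\<in>I. var i ^ u i)" for I
    by (induction I rule: infinite_finite_induct) (auto simp: mon_0 mon_mult[symmetric] var_power)
  then show ?thesis by (simp add: pm_def)
qed

lemma monomial_eq: "brieskorn_monomial m a q u = res (mon (pm u))"
proof -
  interpret A: cring A by (rule cring_A)
  have "brieskorn_monomial m a q u = (\<Otimes>\<^bsub>A\<^esub>i\<in>{1..m-2}. res (var i ^ u i))"
    unfolding brieskorn_monomial_def Let_def coord_eq
    by (intro A.finprod_cong') (auto simp: res_pow cs_var cs_power)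
  then show ?thesis by (simp add: mon_pm res_finprod cs_power cs_var)
qed

abbreviation Ex :: "nat \<Rightarrow> (nat \<Rightarrow> nat) set" where
  "Ex n \<equiv> brieskorn_exponents m a n"

lemma finite_Ex: "finite (Ex n)"
  unfolding brieskorn_exponents_def
  by (rule finite_subset[OF _ finite_PiE[of "{1..m-2}" "\<lambda>i. {0..a i - 1}"]]) auto

text \<open>Both sides differ by the factor L a_(m-1), because wt_j = L a_(m-1) / a_j for j \<le>
  m-2.\<close>

lemma Wt_pm: "(real n + 1) / real (a (m-1)) \<le> (\<Sum>i=1..m-2. real (u i) / real (a i))
    \<longleftrightarrow> (n + 1) * L \<le> Wt (pm u)"
proof -
  have "real (Wt (pm u)) = (\<Sum>j=1..m. real (wt j * (if j \<in> {1..m-2} then u j else 0)))"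
    by (simp add: Wt_def lookup_pm)
  also have "\<dots> = (\<Sum>j=1..m-2. real (wt j * u j))"
    by (rule sum.mono_neutral_cong_right) auto
  also have "\<dots> = (\<Sum>j=1..m-2. real L * real (a (m-1)) * (real (u j) / real (a j)))"
  proof (rule sum.cong)
    fix j assume j: "j \<in> {1..m-2}"
    then have "real (a j) * real (wt j) = real L * real (a (m-1))"
      using a_wt[OF j] by (metis of_nat_mult)
    moreover have "real (a j) \<noteq> 0" using a_pos[OF in_vars(3)[OF j]] by simp
    ultimately show "real (wt j * u j) = real L * real (a (m-1)) * (real (u j) / real (a j))"
      by (simp add: field_simps)
  qed simp
  finally have W: "real (Wt (pm u)) = real L * (real (a (m-1)) * (\<Sum>i=1..m-2. real (u i) / real (a i)))"
    by (simp add: sum_distrib_left mult.assoc)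
  have b: "0 < real (a (m-1))" using a_pos[of "m-1"] by simp
  have "(n + 1) * L \<le> Wt (pm u) \<longleftrightarrow> real L * (real n + 1) \<le> real (Wt (pm u))"
    by (metis (no_types, lifting) of_nat_1 of_nat_add of_nat_le_iff of_nat_mult mult.commute)
  also have "\<dots> \<longleftrightarrow> real n + 1 \<le> real (a (m-1)) * (\<Sum>i=1..m-2. real (u i) / real (a i))"
    unfolding W using L_pos by simp
  finally show ?thesis using b by (simp add: pos_divide_le_eq mult.commute)
qed

lemma Ex_iff: "u \<in> Ex n \<longleftrightarrow> u \<in> (\<Pi>\<^sub>E i\<in>{1..m-2}. {0..a i - 1}) \<and> (n + 1) * L \<le> Wt (pm u)"
  unfolding brieskorn_exponents_def using Wt_pm by auto

lemma Ex_less: "u \<in> Ex n \<Longrightarrow> i \<in> {1..m-2} \<Longrightarrow> u i < a i"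
proof -
  assume "u \<in> Ex n" "i \<in> {1..m-2}"
  then have "u i \<le> a i - 1" "0 < a i" by (auto simp: Ex_iff PiE_def Pi_def atLeastAtMost_iff a_pos)
  then show "u i < a i" by simp
qed

lemma reduced_pm: "u \<in> Ex n \<Longrightarrow> reduced (mon (pm u))"
  using Ex_less by (auto simp: reduced_def cf_mon lookup_pm)

lemma nf_pm: "u \<in> Ex n \<Longrightarrow> nf (mon (pm u)) = mon (pm u)"
  using keys_pm by (intro nf_unique reduced_pm) auto

lemma pm_wcs: "u \<in> Ex n \<Longrightarrow> mon (pm u) \<in> wcs (n + 1)"
  unfolding wcs_def Ex_iff using keys_pm by (auto intro!: wc_Wt simp: cf_mon split: if_splits)

lemma pm_inj: "u \<in> Ex n \<Longrightarrow> v \<in> Ex n \<Longrightarrow> pm u = pm v \<Longrightarrow> u = v"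
proof (rule ext)
  fix i assume *: "u \<in> Ex n" "v \<in> Ex n" "pm u = pm v"
  show "u i = v i"
  proof (cases "i \<in> {1..m-2}")
    case True
    then show ?thesis using *(3) lookup_pm[of u i] lookup_pm[of v i] by simp
  next
    case False
    then show ?thesis using * unfolding Ex_iff by (auto simp: PiE_def extensional_def)
  qed
qed

lemma qw_altdef: "qw n = {f \<in> cs m. \<forall>\<alpha>. cf (nf f) \<alpha> \<noteq> 0 \<longrightarrow> (n + 1) * L \<le> Wt \<alpha> \<and> 1 \<le> yz \<alpha>}"
  by (simp only: qw_def Suc_eq_plus1)

lemma wcs_csD: "f \<in> wcs n \<Longrightarrow> f \<in> cs m"
  using wcs_cs by blast

text \<open>The weight condition is already granted by the hypothesis. What can fail is divisibility
  by y or z, and the reduced monomials free of both with sufficient weight are the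
  \<open>pm u\<close> with u in \<open>Ex n\<close>.\<close>

lemma qw_iff:
  assumes f: "f \<in> wcs (n + 1)"
  shows "f \<in> qw n \<longleftrightarrow> (\<forall>u\<in>Ex n. cf (nf f) (pm u) = 0)"
proof
  assume "f \<in> qw n"
  then show "\<forall>u\<in>Ex n. cf (nf f) (pm u) = 0" using yz_pm by (fastforce simp: qw_def)
next
  assume *: "\<forall>u\<in>Ex n. cf (nf f) (pm u) = 0"
  have fc: "f \<in> cs m" and Wt: "\<And>\<alpha>. cf (nf f) \<alpha> \<noteq> 0 \<Longrightarrow> (n + 1) * L \<le> Wt \<alpha>"
    using f wc_nf[of f] by (auto simp: wcs_def)
  have "1 \<le> yz \<alpha>" if nz: "cf (nf f) \<alpha> \<noteq> 0" for \<alpha>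
  proof (rule ccontr)
    assume "\<not> 1 \<le> yz \<alpha>"
    then have 0: "lookup \<alpha> (m-1) = 0" "lookup \<alpha> m = 0" by (auto simp: yz_def)
    define u where "u = restrict (lookup \<alpha>) {1..m-2}"
    have "\<alpha> = pm u"
    proof (rule poly_mapping_eqI)
      fix j
      have "keys \<alpha> \<subseteq> {1..m}" using cs_ordge[OF nf_cs[OF fc]] nz by (auto simp: ordge_def)
      then have "lookup \<alpha> j = 0" if "j \<notin> {1..m-2}"
        using that 0 by (cases "j \<in> {1..m}") (auto simp: vars_split in_keys_iff subset_iff)
      then show "lookup \<alpha> j = lookup (pm u) j"
        by (simp add: lookup_pm u_def)
    qed
    moreover have "u \<in> Ex n"
      unfolding Ex_iff
    proof
      show "(n + 1) * L \<le> Wt (pm u)" using Wt[OF nz] \<open>\<alpha> = pm u\<close> by simp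
      have "lookup \<alpha> i \<le> a i - 1" if "i \<in> {1..m-2}" for i
        using nf_reduced[OF fc] nz that by (fastforce simp: reduced_def)
      then show "u \<in> (\<Pi>\<^sub>E i\<in>{1..m-2}. {0..a i - 1})"
        by (auto simp: u_def atLeastAtMost_iff)
    qed
    ultimately show False using * nz by blast
  qed
  then show "f \<in> qw n" using fc Wt by (simp add: qw_altdef)
qed

lemma basis_quot:
  shows "vectorspace class_ring (V n)"
    and "inj_on (\<lambda>u. (res ` qw n) +>\<^bsub>A\<^esub> brieskorn_monomial m a q u) (Ex n)"
    and "vectorspace.basis class_ring (V n) ((\<lambda>u. (res ` qw n) +>\<^bsub>A\<^esub> brieskorn_monomial m a q u) ` Ex n)"
proof -
  interpret P: presented_space "V n" "kap n" "wcs (n + 1)" by (rule presented_V)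
  show "vectorspace class_ring (V n)" by (rule P.vectorspace_V)
  let ?x = "\<lambda>f u. cf (nf f) (pm u)"
  have ker: "kap n f = kap n 0 \<longleftrightarrow> (\<forall>u\<in>Ex n. ?x f u = 0)" if "f \<in> wcs (n + 1)" for f
    using kap_eq_iff[OF wcs_csD[OF that] cs_0] qw_iff[OF that] by simp
  have add: "?x (f + g) u = ?x f u + ?x g u" if "f \<in> wcs (n + 1)" "g \<in> wcs (n + 1)" for f g u
    using nf_add[OF wcs_csD[OF that(1)] wcs_csD[OF that(2)]] by simp
  have cst: "?x (cst c * f) u = c * ?x f u" if "f \<in> wcs (n + 1)" for f c u
    using nf_cst_mult[OF wcs_csD[OF that]] by simp
  have dual: "?x (mon (pm u)) v = (if v = u then 1 else 0)" if "u \<in> Ex n" "v \<in> Ex n" for u v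
    using nf_pm[OF that(1)] pm_inj[OF that] by (auto simp: cf_mon)
  have eq: "(\<lambda>u. (res ` qw n) +>\<^bsub>A\<^esub> brieskorn_monomial m a q u) = (\<lambda>u. kap n (mon (pm u)))"
    by (simp add: kap_def monomial_eq)
  note B = P.basis_V[of "Ex n" "\<lambda>u. mon (pm u)" ?x, OF finite_Ex pm_wcs ker add cst dual]
  show "inj_on (\<lambda>u. (res ` qw n) +>\<^bsub>A\<^esub> brieskorn_monomial m a q u) (Ex n)"
    "vectorspace.basis class_ring (V n) ((\<lambda>u. (res ` qw n) +>\<^bsub>A\<^esub> brieskorn_monomial m a q u) ` Ex n)"
    unfolding eq using B by auto
qed

lemma dim_quot: "vectorspace.dim class_ring (V n) = card (Ex n)"
  using vectorspace.dim_basis[OF basis_quot(1) _ basis_quot(3)] finite_Ex card_image[OF basis_quot(2)]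
  by (metis finite_imageI)

lemma Ex_antimono: "n \<le> n' \<Longrightarrow> Ex n' \<subseteq> Ex n"
proof
  fix u assume "n \<le> n'" "u \<in> Ex n'"
  moreover from this have "(n + 1) * L \<le> (n' + 1) * L" by (intro mult_le_mono1) simp
  ultimately show "u \<in> Ex n" unfolding Ex_iff using le_trans by blast
qed

section \<open>The reduction numbers\<close>

definition slope :: real where
  "slope = real (a (m-1)) * (\<Sum>i=1..m-2. (real (a i) - 1) / real (a i))"

lemma slope_nonneg: "0 \<le> slope"
  unfolding slope_def by (intro mult_nonneg_nonneg sum_nonneg divide_nonneg_nonneg)
    (use a2 in_vars in \<open>fastforce+\<close>)

text \<open>The defining inequality is monotone in u, so only the largest vector u_i = a_i - 1 has
  to be tested; its weighted sum times a_(m-1) is \<open>slope\<close>.\<close>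

lemma Ex_empty_iff: "Ex n = {} \<longleftrightarrow> nat \<lfloor>slope\<rfloor> \<le> n"
proof -
  define t where "t = (\<lambda>i\<in>{1..m-2}. a i - 1)"
  have t: "real (t i) = real (a i) - 1" if "i \<in> {1..m-2}" for i
    using that a_pos[OF in_vars(3)[OF that]] by (simp add: t_def of_nat_diff Suc_leI One_nat_def)
  have b: "0 < real (a (m-1))" using a_pos[of "m-1"] by simp
  have sl: "slope = real (a (m-1)) * (\<Sum>i=1..m-2. real (t i) / real (a i))"
    unfolding slope_def by (simp add: t)
  have "Ex n = {} \<longleftrightarrow> t \<notin> Ex n"
  proof
    assume t': "t \<notin> Ex n"
    have "u \<notin> Ex n" for u
    proof
      assume u: "u \<in> Ex n"
      have "(\<Sum>i=1..m-2. real (u i) / real (a i)) \<le> (\<Sum>i=1..m-2. real (t i) / real (a i))"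
      proof (intro sum_mono divide_right_mono)
        fix i assume i: "i \<in> {1..m-2}"
        then show "real (u i) \<le> real (t i)" using Ex_less[OF u i] by (simp add: t_def)
      qed simp
      then have "t \<in> Ex n"
        using u unfolding brieskorn_exponents_def by (auto simp: t_def atLeastAtMost_iff)
      then show False using t' by simp
    qed
    then show "Ex n = {}" by blast
  qed auto
  also have "\<dots> \<longleftrightarrow> slope < real n + 1"
    using b unfolding brieskorn_exponents_def sl
    by (auto simp: t_def atLeastAtMost_iff pos_divide_le_eq mult.commute not_le)
  also have "\<dots> \<longleftrightarrow> \<lfloor>slope\<rfloor> < int n + 1"
    using floor_less_iff[of slope "int n + 1"] by simp
  also have "\<dots> \<longleftrightarrow> nat \<lfloor>slope\<rfloor> \<le> n" by auto
  finally show ?thesis .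
qed

text \<open>The step condition turns out to be upward closed in n, which is why the two reduction
  numbers agree.\<close>

lemma closed_power_step_iff:
  "closed_power A (res ` ord 1) (n + 1) = res ` qi \<cdot>\<^bsub>A\<^esub> closed_power A (res ` ord 1) n \<longleftrightarrow> nat \<lfloor>slope\<rfloor> \<le> n"
proof -
  have "res ` wcs (n + 1) = res ` qw n \<longleftrightarrow> Ex n = {}"
  proof
    assume eq: "res ` wcs (n + 1) = res ` qw n"
    have "u \<notin> Ex n" for u
    proof
      assume u: "u \<in> Ex n"
      then have "res (mon (pm u)) \<in> res ` qw n" using pm_wcs eq by blast
      then have "mon (pm u) \<in> qw n" using res_mem_qw keys_pm by blast
      then show False using qw_iff[OF pm_wcs[OF u]] u nf_pm[OF u] by (auto simp: cf_mon)
    qed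
    then show "Ex n = {}" by blast
  next
    assume E: "Ex n = {}"
    have "qw n \<subseteq> wcs (n + 1)"
      unfolding qw_altdef wcs_def using wc_nf by auto
    moreover have "wcs (n + 1) \<subseteq> qw n" using qw_iff E by blast
    ultimately show "res ` wcs (n + 1) = res ` qw n" by blast
  qed
  then show ?thesis unfolding closed_power_eq qi_prod Ex_empty_iff by simp
qed

lemma nr_eq: "int (nr A (res ` ord 1) (res ` qi)) = \<lfloor>slope\<rfloor>"
  and r_bar_eq: "int (r_bar A (res ` ord 1) (res ` qi)) = \<lfloor>slope\<rfloor>"
proof -
  have "(LEAST n. nat \<lfloor>slope\<rfloor> \<le> n) = nat \<lfloor>slope\<rfloor>" by (rule Least_equality) auto
  moreover have "(LEAST n. \<forall>N\<ge>n. nat \<lfloor>slope\<rfloor> \<le> N) = nat \<lfloor>slope\<rfloor>"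
    by (rule Least_equality) auto
  ultimately show "int (nr A (res ` ord 1) (res ` qi)) = \<lfloor>slope\<rfloor>"
    "int (r_bar A (res ` ord 1) (res ` qi)) = \<lfloor>slope\<rfloor>"
    unfolding nr_def r_bar_def closed_power_step_iff using slope_nonneg by simp_all
qed

section \<open>The minimal reduction\<close>

lemma qi_ord: "qi \<subseteq> ord 1"
proof -
  have "(0 :: nat \<Rightarrow>\<^sub>0 nat) \<noteq> single j 1" for j
    by (metis lookup_single_eq lookup_zero zero_neq_one)
  then show ?thesis using qi_cs by (auto simp: ord_1_iff) (auto simp: qi_def cf_mon)
qed

text \<open>A reduced monomial free of y and z has degree at most \<Sum> (a_i - 1). From order n + 1
  with n = \<Sum> a_i on, every monomial of a normal form therefore contains y or z.\<close>

lemma reduction_qi: "reduction A (res ` ord 1) (res ` qi)"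
proof -
  define n where "n = (\<Sum>i=1..m-2. a i)"
  have "res ` ord (n + 1) = res ` qi \<cdot>\<^bsub>A\<^esub> res ` ord n"
  proof
    show "res ` qi \<cdot>\<^bsub>A\<^esub> res ` ord n \<subseteq> res ` ord (n + 1)"
    proof (rule ideal_prod_res_subset)
      fix f g assume "f \<in> qi" "g \<in> ord n"
      then show "f * g \<in> ord (n + 1)"
        using ordge_mult[of m 1 f n g] qi_ord by (auto simp: ord_def add.commute)
    qed (use qi_cs in \<open>auto simp: ord_def intro: ordge_add\<close>)
    show "res ` ord (n + 1) \<subseteq> res ` qi \<cdot>\<^bsub>A\<^esub> res ` ord n"
    proof clarify
      fix f assume f: "f \<in> ord (n + 1)"
      then have fc: "f \<in> cs m" and "ordge m (n + 1) f" by (auto simp: ord_def)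
      then have No: "ordge m (n + 1) (nf f)" by (intro nf_ordge)
      have "1 \<le> yz \<alpha>" if nz: "cf (nf f) \<alpha> \<noteq> 0" for \<alpha>
      proof (rule ccontr)
        assume "\<not> 1 \<le> yz \<alpha>"
        then have 0: "lookup \<alpha> (m-1) = 0" "lookup \<alpha> m = 0" by (auto simp: yz_def)
        have "deg m \<alpha> = (\<Sum>j=1..m-2. lookup \<alpha> j)"
          unfolding deg_def using 0 by (intro sum.mono_neutral_right) (auto simp: vars_split)
        also have "\<dots> \<le> n"
          unfolding n_def using nf_reduced[OF fc] nz by (intro sum_mono) (fastforce simp: reduced_def)
        finally show False using No nz by (auto simp: ordge_def)
      qed
      note dec = yz_decompose[OF this]
      have "res (\<Sum>i\<in>{m-1, m}. var i * quotx (\<lambda>j. single j 1) {m-1, m} i (nf f))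
          \<in> res ` qi \<cdot>\<^bsub>A\<^esub> res ` ord n"
      proof (rule ideal_prod_sum_mem)
        fix i assume i: "i \<in> {m-1, m}"
        have "ordge m (n + 1 - deg m (single i 1)) (quotx (\<lambda>j. single j 1) {m-1, m} i (nf f))"
          using ordge_quotx[OF No, of "\<lambda>j. single j 1"] by simp
        then have "quotx (\<lambda>j. single j 1) {m-1, m} i (nf f) \<in> ord n"
          using i nf_cs[OF fc] deg_single[of i m 1] by (auto simp: ord_def)
        then show "var i \<in> qi \<and> quotx (\<lambda>j. single j 1) {m-1, m} i (nf f) \<in> ord n"
          using i var_qi by auto
      qed (use qi_cs in \<open>auto simp: ord_def\<close>)
      then show "res f \<in> res ` qi \<cdot>\<^bsub>A\<^esub> res ` ord n" using dec res_nf[OF fc] by simp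
    qed
  qed
  then have "res ` ord 1 [^]\<^bsub>ideals_set A\<^esub> (n + 1) = res ` qi \<cdot>\<^bsub>A\<^esub> (res ` ord 1 [^]\<^bsub>ideals_set A\<^esub> n)"
    unfolding ord_pow by simp
  then show ?thesis
    unfolding reduction_def using ideal_res[OF is_ideal_qi] qi_ord by blast
qed

text \<open>Either two elements of \<open>K\<close> have linearly independent linear parts, and then Cramer's rule
  recovers the generators of the reduction, or all linear parts vanish along some arc, whose order
  then detects that \<open>K\<close> is not a reduction.\<close>

lemma minimal_qi:
  assumes red: "reduction A (res ` ord 1) K" and sub: "K \<subseteq> res ` qi"
  shows "K = res ` qi"
proof -
  interpret A: cring A by (rule cring_A)
  interpret K: ideal K A using red by (simp add: reduction_def)
  define lf where "lf u v = var (m-1) * u + var m * v" for u v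
  have lf_cs: "lf u v \<in> cs m" if "u \<in> cs m" "v \<in> cs m" for u v
    using that unfolding lf_def by (intro cs_add cs_mult cs_var) auto
  \<comment> \<open>Coefficient pairs of the elements y u + z v of K; the constant terms of u and v
    form the linear part.\<close>
  define B where "B = {(u, v). u \<in> cs m \<and> v \<in> cs m \<and> res (lf u v) \<in> K}"
  have "\<exists>u v u' v'. (u, v) \<in> B \<and> (u', v') \<in> B \<and> cf (u * v' - v * u') 0 \<noteq> 0"
  proof (rule ccontr)
    assume "\<not> ?thesis"
    then have dep: "cf u 0 * cf v' 0 = cf v 0 * cf u' 0" if "(u, v) \<in> B" "(u', v') \<in> B" for u v u' v'
      using that by auto
    \<comment> \<open>Pairwise dependent linear parts have a common zero (y, z): orthogonal to a
      nonzero one if there is any, arbitrary otherwise.\<close>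
    obtain y z where yz: "y \<noteq> 0 \<or> z \<noteq> 0" "\<And>u v. (u, v) \<in> B \<Longrightarrow> y * cf u 0 + z * cf v 0 = 0"
    proof (cases "\<exists>u v. (u, v) \<in> B \<and> (cf u 0 \<noteq> 0 \<or> cf v 0 \<noteq> 0)")
      case True
      then obtain u v where uv: "(u, v) \<in> B" "cf u 0 \<noteq> 0 \<or> cf v 0 \<noteq> 0" by blast
      show ?thesis
        by (rule that[of "- cf v 0" "cf u 0"]) (use uv dep[OF uv(1)] in \<open>auto simp: algebra_simps\<close>)
    next
      case False
      then show ?thesis by (intro that[of 1 0]) auto
    qed
    obtain \<eta> where arc: "arc y z \<eta>" by (rule arc_exists)
    obtain n :: nat where n: "res ` ord (n + 1) = K \<cdot>\<^bsub>A\<^esub> res ` ord n"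
      using red unfolding reduction_def ord_pow by auto
    define K' where "K' = {f \<in> cs m. res f \<in> K}"
    have K': "K = res ` K'" using K.a_subset by (auto simp: K'_def carrier_A)
    \<comment> \<open>Along this arc the linear parts cancel, so elements of K have order at least L
      + 1 instead of L. The product with the n-th power inherits the extra order.\<close>
    define H where "H = {f \<in> cs m. fps_X ^ (L + 1 + n * L) dvd ev m \<eta> f}"
    have "K \<cdot>\<^bsub>A\<^esub> res ` ord n \<subseteq> res ` H"
      unfolding K'
    proof (rule ideal_prod_res_subset)
      fix f g assume f: "f \<in> K'" and g: "g \<in> ord n"
      then have fc: "f \<in> cs m" and "res f \<in> res ` qi" using sub by (auto simp: K'_def)
      then obtain h where h: "h \<in> qi" "res f = res h" by auto
      then obtain u v where uv: "h = lf u v" "u \<in> cs m" "v \<in> cs m" by (auto simp: qi_def lf_def)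
      have "(u, v) \<in> B" using f h uv by (simp add: B_def K'_def)
      have "f - h \<in> J" using h uv lf_cs fc res_eq_iff by blast
      then have "ev m \<eta> f = ev m \<eta> h"
        using ev_J[OF arc] arc_X_dvd[OF arc] by (metis ev_diff eq_iff_diff_eq_0)
      also have "\<dots> = fps_X ^ L * (fps_const y * ev m \<eta> u + fps_const z * ev m \<eta> v)"
        using arc arc_X_dvd[OF arc]
        by (simp add: uv lf_def ev_arc_add[OF arc] ev_arc_mult[OF arc] ev_var arc_def algebra_simps)
      finally have f': "ev m \<eta> f = fps_X ^ L * (fps_const y * ev m \<eta> u + fps_const z * ev m \<eta> v)" .
      have "(fps_const y * ev m \<eta> u + fps_const z * ev m \<eta> v) $ 0 = 0"
        using yz(2)[OF \<open>(u, v) \<in> B\<close>] arc_X_dvd[OF arc] by (simp add: ev_nth_zero)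
      then have "fps_X ^ 1 dvd fps_const y * ev m \<eta> u + fps_const z * ev m \<eta> v"
        unfolding fps_X_power_dvd_iff by simp
      then have "fps_X ^ (L + 1) dvd ev m \<eta> f"
        unfolding f' power_add by (intro mult_dvd_mono) auto
      moreover have "fps_X ^ (n * L) dvd ev m \<eta> g"
        using wc_ordge[of n g] g arc unfolding wc_def ord_def by blast
      ultimately show "f * g \<in> H"
        using fc g unfolding H_def ord_def
        by (auto simp: ev_arc_mult[OF arc] power_add[of _ "L + 1"] intro!: mult_dvd_mono)
    qed (auto simp: H_def K'_def ord_def ev_arc_add[OF arc])
    then have sub': "res ` ord (n + 1) \<subseteq> res ` H" using n by simp
    \<comment> \<open>The power \<open>var j ^ (n + 1)\<close> would have order exactly L (n + 1)
      for nonzero c, one less than membership in \<open>H\<close> demands.\<close>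
    have zero: "c = 0" if j: "j \<in> {1..m}" and c: "\<eta> j = fps_const c * fps_X ^ L" for j c
    proof -
      have "var j ^ (n + 1) \<in> ord (n + 1)"
        using j unfolding var_power ord_def by (auto intro!: ordge_mon simp: deg_single)
      then obtain h where h: "h \<in> H" "res (var j ^ (n + 1)) = res h" using sub' by blast
      then have "var j ^ (n + 1) - h \<in> J"
        using res_eq_iff[of "var j ^ (n + 1)" h] j by (auto simp: H_def)
      then have "ev m \<eta> (var j ^ (n + 1)) = ev m \<eta> h"
        using ev_J[OF arc] arc_X_dvd[OF arc] by (metis ev_diff eq_iff_diff_eq_0)
      then have "fps_X ^ (L + 1 + n * L) dvd fps_const (c ^ (n + 1)) * fps_X ^ (L * (n + 1))"
        using h(1) j c arc_X_dvd[OF arc]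
        by (simp only: H_def mem_Collect_eq ev_arc_power[OF arc] ev_var power_mult_distrib fps_const_power power_mult)
      then have "(fps_const (c ^ (n + 1)) * fps_X ^ (L * (n + 1))) $ (L * (n + 1)) = 0"
      proof -
        have "L * (n + 1) < L + 1 + n * L" by (simp add: algebra_simps)
        then show ?thesis
          using \<open>fps_X ^ (L + 1 + n * L) dvd _\<close> unfolding fps_X_power_dvd_iff by blast
      qed
      then have "c ^ (n + 1) = 0"
        by (simp only: fps_mult_left_const_nth fps_X_power_nth) simp
      then show "c = 0" by simp
    qed
    have "y = 0" "z = 0" using zero[of "m-1" y] zero[of m z] arc by (auto simp: arc_def)
    then show False using yz(1) by simp
  qed
  then obtain u v u' v' where uv: "(u, v) \<in> B" "(u', v') \<in> B" and det: "cf (u * v' - v * u') 0 \<noteq> 0" by blast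
  then have c: "u \<in> cs m" "v \<in> cs m" "u' \<in> cs m" "v' \<in> cs m"
    and K: "res (lf u v) \<in> K" "res (lf u' v') \<in> K" by (auto simp: B_def)
  define d where "d = u * v' - v * u'"
  have "d \<in> cs m" using c by (auto simp: d_def)
  then obtain e where e: "e \<in> cs m" "d * e = 1" using cs_inverse det d_def by metis
  have comb: "res (s * lf u v + t * lf u' v') \<in> K" if "s \<in> cs m" "t \<in> cs m" for s t
  proof -
    have "res s \<otimes>\<^bsub>A\<^esub> res (lf u v) \<oplus>\<^bsub>A\<^esub> res t \<otimes>\<^bsub>A\<^esub> res (lf u' v') \<in> K"
      using that K by (intro K.a_closed K.I_l_closed) auto
    then show ?thesis using that c by (simp add: res_mult res_add lf_cs cs_mult)
  qed
  have "(e * v') * lf u v + (- (e * v)) * lf u' v' = var (m-1) * (d * e)"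
    "(- (e * u')) * lf u v + (e * u) * lf u' v' = var m * (d * e)"
    by (simp_all add: lf_def d_def algebra_simps)
  then have "res (var (m-1)) \<in> K" "res (var m) \<in> K"
    using comb[of "e * v'" "- (e * v)"] comb[of "- (e * u')" "e * u"] e c by auto
  then have "Idl\<^bsub>A\<^esub> {res (var (m-1)), res (var m)} \<subseteq> K"
    by (intro A.genideal_minimal K.ideal_axioms) auto
  then show ?thesis using sub qi_eq coord_eq by auto
qed

lemma minimal_reduction_qi: "minimal_reduction A (res ` ord 1) (res ` qi)"
  unfolding minimal_reduction_def using reduction_qi minimal_qi by blast

end

section \<open>Minors of the coefficient matrix\<close>

lemma (in vec_space) rank_le_card_columns:
  assumes A: "A \<in> carrier_mat n nc" and T: "T \<subseteq> set (cols A)" "set (cols A) \<subseteq> span T"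
  shows "rank A \<le> card T"
proof -
  let ?S = "set (cols A)"
  have S: "?S \<subseteq> carrier_vec n" using A cols_dim by blast
  then have Tc: "T \<subseteq> carrier_vec n" using T(1) by blast
  have sub: "submodule class_ring (span ?S) V" using S by (intro span_is_submodule) simp
  have TS: "T \<subseteq> span ?S" using T(1) in_own_span[of ?S] S by auto
  interpret W: vectorspace class_ring "span_vs ?S"
    using submodule_is_module[OF sub] class_field by (simp add: vectorspace_def)
  have "span T = span ?S"
    using span_subsetI[OF Tc T(2)] span_is_monotone[OF T(1)] by blast
  then have "W.gen_set T" using span_li_not_depend(1)[OF TS sub] by simp
  then show ?thesis
    unfolding rank_def using T(1) TS by (intro W.gen_ge_dim) (auto intro: finite_subset)
qed

lemma (in vec_space) zero_vec_in_span: "0\<^sub>v n \<in> span T"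
  by (rule in_spanI[of _ "\<lambda>_. 0" "{}"]) (auto simp: lincomb_def)

lemma (in vec_space) sum_columns_in_span:
  assumes A: "A \<in> carrier_mat n nc" and T: "T \<subseteq> carrier_vec n" and "finite D"
    and D: "\<And>c. c \<in> D \<Longrightarrow> c < nc \<and> col A c \<in> span T"
  shows "vec n (\<lambda>i. \<Sum>c\<in>D. t c * A $$ (i, c)) \<in> span T"
  using assms(3) D
proof (induction D rule: finite_induct)
  case empty
  have "vec n (\<lambda>i. \<Sum>c\<in>{}. t c * A $$ (i, c)) = 0\<^sub>v n" by auto
  then show ?case using zero_vec_in_span by simp
next
  case (insert c D)
  have "vec n (\<lambda>i. \<Sum>c\<in>insert c D. t c * A $$ (i, c))
      = t c \<cdot>\<^sub>v col A c + vec n (\<lambda>i. \<Sum>c\<in>D. t c * A $$ (i, c))"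
    using insert A by (intro eq_vecI) auto
  moreover have "t c \<cdot>\<^sub>v col A c \<in> span T" using smult_in_span[OF T] insert.prems by auto
  moreover have "vec n (\<lambda>i. \<Sum>c\<in>D. t c * A $$ (i, c)) \<in> span T" using insert by auto
  ultimately show ?case using span_add1[of T] T by simp
qed

lemma partial_brieskorn_fun:
  assumes "j \<in> {1..m}"
  shows "partial j (brieskorn_fun m a q l) x = q l j * (of_nat (a j) * x j ^ (a j - 1))"
proof -
  have "((\<lambda>t. \<Sum>i=1..m. q l i * (x(j := t)) i ^ a i) has_field_derivative
      (\<Sum>i=1..m. if i = j then q l j * (of_nat (a j) * x j ^ (a j - 1)) else 0)) (at (x j))"
  proof (rule DERIV_sum)
    fix i
    show "((\<lambda>t. q l i * (x(j := t)) i ^ a i) has_field_derivative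
        (if i = j then q l j * (of_nat (a j) * x j ^ (a j - 1)) else 0)) (at (x j))"
      by (auto intro!: derivative_eq_intros simp: One_nat_def)
  qed
  then show ?thesis
    unfolding partial_def brieskorn_fun_def using assms by (simp add: DERIV_imp_deriv)
qed

text \<open>A vector \<open>w\<close> in the kernel of the coefficient matrix gives the curve
  \<open>x\<^sub>j = (w\<^sub>j \<tau>\<^bsup>E\<^esup>)\<^bsup>1/a j\<^esup>\<close> in the zero locus. If two entries of \<open>w\<close> vanish, the Jacobian matrix has
  two zero columns along the curve, and Euler's formula makes the other columns dependent.\<close>

lemma singular_point_kernel:
  assumes m: "3 \<le> m" and a: "\<forall>j\<in>{1..m}. 2 \<le> a j"
    and x: "x \<in> complex_space m"
    and zero: "\<And>l. l \<in> {3..m} \<Longrightarrow> (\<Sum>j=1..m. q l j * x j ^ a j) = 0"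
    and rs: "r \<in> {1..m}" "s \<in> {1..m}" "r \<noteq> s" "x r = 0" "x s = 0"
    and jz: "jz \<in> {1..m}" "x jz \<noteq> 0"
  shows "singular_point m (m - 2) (\<lambda>i. brieskorn_fun m a q (i + 3)) x"
proof -
  let ?k = "m - 2"
  define B where "B = jacobian_matrix m ?k (\<lambda>i. brieskorn_fun m a q (i + 3)) x"
  have Bc: "B \<in> carrier_mat ?k m" by (simp add: B_def jacobian_matrix_def)
  have Be: "B $$ (i, c) = q (i + 3) (c + 1) * (of_nat (a (c + 1)) * x (c + 1) ^ (a (c + 1) - 1))"
    if "i < ?k" "c < m" for i c
    using that partial_brieskorn_fun[of "c + 1" m a q "i + 3" x]
    by (simp add: B_def jacobian_matrix_def atLeastAtMost_iff)
  interpret vec_space "TYPE(complex)" ?k .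
  \<comment> \<open>Column r and column s vanish and column jz will be dependent on the rest, which
    leaves m - 3 columns for rank m - 2.\<close>
  define D where "D = {0..<m} - {jz - 1, r - 1, s - 1}"
  define T where "T = col B ` D"
  have dist: "jz - 1 \<noteq> r - 1" "jz - 1 \<noteq> s - 1" "r - 1 \<noteq> s - 1" "jz - 1 < m" "r - 1 < m" "s - 1 < m"
    using rs jz by (auto simp: atLeastAtMost_iff) (metis le_add_diff_inverse2)+
  have Dm: "c \<in> D \<Longrightarrow> c < m" for c by (simp add: D_def)
  have Tc: "T \<subseteq> carrier_vec ?k" using Bc by (auto simp: T_def intro!: carrier_vecI)
  have "T \<subseteq> span T" using Tc in_own_span[of T] by simp
  then have D_span: "col B c \<in> span T" if "c \<in> D" for c
    unfolding T_def using that by blast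
  have zero_col: "col B (i - 1) \<in> span T" if "i \<in> {1..m}" "x i = 0" for i
  proof -
    have "a i - 1 \<noteq> 0" using a that(1) by fastforce
    then have "col B (i - 1) = 0\<^sub>v ?k"
      using Bc that Be[of _ "i - 1"] by (intro eq_vecI) (auto simp: atLeastAtMost_iff)
    then show ?thesis using zero_vec_in_span by simp
  qed
  have "col B (jz - 1) \<in> span T"
  proof -
    \<comment> \<open>Euler weights: the combination of the columns with coefficients x_j / a_j
      returns the equations themselves, which vanish at x.\<close>
    define y where "y c = x (c + 1) / of_nat (a (c + 1))" for c
    have a_nz: "of_nat (a (c + 1)) \<noteq> (0 :: complex)" if "c < m" for c
      using bspec[OF a, of "c + 1"] that by (auto simp: atLeastAtMost_iff)
    have y0: "y (jz - 1) \<noteq> 0"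
      using jz a_nz[of "jz - 1"] dist by (auto simp: y_def atLeastAtMost_iff)
    have rel: "(\<Sum>c\<in>D. y c * B $$ (i, c)) = - (y (jz - 1) * B $$ (i, jz - 1))" if i: "i < ?k" for i
    proof -
      have yB: "y c * B $$ (i, c) = q (i + 3) (c + 1) * x (c + 1) ^ a (c + 1)" if "c < m" for c
      proof -
        have "0 < a (c + 1)" using a_nz[OF that] by auto
        then have "x (c + 1) * x (c + 1) ^ (a (c + 1) - 1) = x (c + 1) ^ a (c + 1)"
          by (simp add: power_eq_if)
        then show ?thesis using a_nz[OF that] Be[OF i that] by (simp add: y_def)
      qed
      have "(\<Sum>c\<in>{0..<m}. y c * B $$ (i, c)) = (\<Sum>c\<in>{0..<m}. q (i + 3) (c + 1) * x (c + 1) ^ a (c + 1))"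
        by (intro sum.cong) (auto simp: yB)
      also have "\<dots> = (\<Sum>j=1..m. q (i + 3) j * x j ^ a j)"
        by (rule sum.reindex_bij_witness[where i = "\<lambda>j. j - 1" and j = "\<lambda>c. c + 1"]) (auto simp: atLeastAtMost_iff)
      also have "\<dots> = 0" using zero[of "i + 3"] i by (simp add: atLeastAtMost_iff)
      finally have tot: "(\<Sum>c\<in>{0..<m}. y c * B $$ (i, c)) = 0" .
      have "{0..<m} = D \<union> {jz - 1, r - 1, s - 1}" using dist by (auto simp: D_def)
      then have "(\<Sum>c\<in>{0..<m}. y c * B $$ (i, c)) = (\<Sum>c\<in>D. y c * B $$ (i, c)) + (\<Sum>c\<in>{jz - 1, r - 1, s - 1}. y c * B $$ (i, c))"
        by (simp only:) (rule sum.union_disjoint; auto simp: D_def)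
      moreover have "y (r - 1) = 0" "y (s - 1) = 0" using rs by (auto simp: y_def atLeastAtMost_iff)
      ultimately show ?thesis using tot dist by (simp add: eq_neg_iff_add_eq_0)
    qed
    have "col B (jz - 1) = vec ?k (\<lambda>i. \<Sum>c\<in>D. (- y c / y (jz - 1)) * B $$ (i, c))"
    proof (rule eq_vecI)
      fix i assume "i < dim_vec (vec ?k (\<lambda>i. \<Sum>c\<in>D. (- y c / y (jz - 1)) * B $$ (i, c)))"
      then have i: "i < ?k" by simp
      have "(\<Sum>c\<in>D. (- y c / y (jz - 1)) * B $$ (i, c)) = - (\<Sum>c\<in>D. y c * B $$ (i, c)) / y (jz - 1)"
        by (simp add: sum_divide_distrib sum_negf)
      also have "\<dots> = B $$ (i, jz - 1)" using rel[OF i] y0 by simp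
      finally show "vec_index (col B (jz - 1)) i = vec_index (vec ?k (\<lambda>i. \<Sum>c\<in>D. (- y c / y (jz - 1)) * B $$ (i, c))) i"
        using i Bc dist by simp
    qed (use Bc in simp)
    moreover have "vec ?k (\<lambda>i. \<Sum>c\<in>D. (- y c / y (jz - 1)) * B $$ (i, c)) \<in> span T"
      by (rule sum_columns_in_span[OF Bc Tc]) (simp_all add: Dm D_span, simp add: D_def)
    ultimately show ?thesis by simp
  qed
  then have "col B c \<in> span T" if "c < m" for c
  proof (cases "c \<in> D")
    case False
    then have "c = jz - 1 \<or> c = r - 1 \<or> c = s - 1" using that by (auto simp: D_def)
    then show ?thesis using \<open>col B (jz - 1) \<in> span T\<close> zero_col[OF rs(1,4)] zero_col[OF rs(2,5)] by blast
  qed (rule D_span)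
  then have "set (cols B) \<subseteq> span T" using Bc by (auto simp: cols_def)
  moreover have "T \<subseteq> set (cols B)" using Bc by (auto simp: T_def D_def cols_def)
  ultimately have "rank B \<le> card T" by (intro rank_le_card_columns[OF Bc])
  also have "\<dots> \<le> card D" unfolding T_def by (rule card_image_le) (simp add: D_def)
  also have "\<dots> = m - 3" using dist by (simp add: D_def card_Diff_subset numeral_3_eq_3)
  also have "\<dots> < ?k" using m by simp
  finally have "rank B < ?k" .
  moreover have "x \<in> zero_locus m ?k (\<lambda>i. brieskorn_fun m a q (i + 3))"
    unfolding zero_locus_def brieskorn_fun_def using x zero by (auto simp: atLeastAtMost_iff)
  ultimately show ?thesis unfolding singular_point_def B_def by simp
qed

text \<open>This is how isolatedness enters: a nonzero kernel vector with two zero entries would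
  yield singular points other than the origin in every neighbourhood.\<close>

lemma kernel_two_zeros:
  assumes m: "3 \<le> m" and a: "\<forall>j\<in>{1..m}. 2 \<le> a j"
    and iso: "isolated_ci_singularity m (m - 2) (\<lambda>i. brieskorn_fun m a q (i + 3))"
    and ker: "\<And>l. l \<in> {3..m} \<Longrightarrow> (\<Sum>j=1..m. q l j * w j) = 0"
    and rs: "r \<in> {1..m}" "s \<in> {1..m}" "r \<noteq> s" "w r = 0" "w s = 0" and j0: "j0 \<in> {1..m}"
  shows "w j0 = 0"
proof (rule ccontr)
  assume nz: "w j0 \<noteq> 0"
  have a_pos: "0 < a j" if "j \<in> {1..m}" for j using a that by fastforce
  obtain \<epsilon> where \<epsilon>: "0 < \<epsilon>"
    "\<And>x. singular_point m (m - 2) (\<lambda>i. brieskorn_fun m a q (i + 3)) x \<Longrightarrow> (\<forall>j\<in>{1..m}. norm (x j) < \<epsilon>) \<Longrightarrow> x = origin m"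
    using iso unfolding isolated_ci_singularity_def by blast
  have "\<exists>v. v ^ a j = w j" if "j \<in> {1..m}" for j
    using exists_complex_root[of "a j" "w j"] a_pos[OF that] by (metis less_numeral_extra(3))
  then obtain v where v: "\<And>j. j \<in> {1..m} \<Longrightarrow> v j ^ a j = w j" by metis
  define C where "C = (\<Sum>j=1..m. norm (v j))"
  have C: "0 \<le> C" "norm (v j) \<le> C" if "j \<in> {1..m}" for j
    using that unfolding C_def by (auto intro!: sum_nonneg member_le_sum)
  have C0: "0 \<le> C" unfolding C_def by (rule sum_nonneg) simp
  \<comment> \<open>Small enough for C * \<tau> < \<epsilon>; being at most 1 makes every positive
    power of \<tau> at most \<tau>.\<close>
  define \<tau> where "\<tau> = min 1 (\<epsilon> / (C + 1))"
  have \<tau>: "0 < \<tau>" "\<tau> \<le> 1" "C * \<tau> < \<epsilon>"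
  proof -
    show "0 < \<tau>" "\<tau> \<le> 1" using \<epsilon>(1) C0 by (auto simp: \<tau>_def)
    have "C * \<tau> \<le> C * (\<epsilon> / (C + 1))" using C0 by (intro mult_left_mono) (auto simp: \<tau>_def)
    also have "\<dots> < \<epsilon>" using C0 \<epsilon>(1) by (simp add: field_simps)
    finally show "C * \<tau> < \<epsilon>" .
  qed
  \<comment> \<open>A common multiple of all exponents: each x_j^(a_j) acquires the same factor
    \<tau>^E, which pulls out of the linear equations.\<close>
  define E where "E = (\<Prod>j=1..m. a j)"
  have E: "E div a j * a j = E" "1 \<le> E div a j" if "j \<in> {1..m}" for j
  proof -
    have dvd: "a j dvd E" unfolding E_def using that by (intro dvd_prodI) auto
    then show "E div a j * a j = E" by simp
    have "0 < E" unfolding E_def using a_pos by (intro prod_pos) auto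
    then show "1 \<le> E div a j" using dvd a_pos[OF that] by (metis One_nat_def Suc_leI dvd_div_eq_0_iff gr0I less_numeral_extra(3))
  qed
  define x where "x = (\<lambda>j\<in>{1..m}. v j * of_real \<tau> ^ (E div a j))"
  have xa: "x j ^ a j = w j * of_real \<tau> ^ E" if "j \<in> {1..m}" for j
    using that v[OF that] E(1)[OF that] by (simp add: x_def power_mult_distrib power_mult[symmetric])
  have xz: "x j = 0 \<longleftrightarrow> w j = 0" if "j \<in> {1..m}" for j
    using xa[OF that] a_pos[OF that] \<tau>(1) by (metis mult_eq_0_iff of_real_eq_0_iff order_less_irrefl power_eq_0_iff)
  have "singular_point m (m - 2) (\<lambda>i. brieskorn_fun m a q (i + 3)) x"
  proof (rule singular_point_kernel[OF m a, where r = r and s = s and jz = j0])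
    show "x \<in> complex_space m" by (simp add: x_def complex_space_def)
    fix l assume l: "l \<in> {3..m}"
    have "(\<Sum>j=1..m. q l j * x j ^ a j) = (\<Sum>j=1..m. q l j * w j) * of_real \<tau> ^ E"
      unfolding sum_distrib_right by (intro sum.cong) (auto simp: xa)
    then show "(\<Sum>j=1..m. q l j * x j ^ a j) = 0" using ker[OF l] by simp
  qed (use rs j0 nz xz in auto)
  moreover have "\<forall>j\<in>{1..m}. norm (x j) < \<epsilon>"
  proof
    fix j assume j: "j \<in> {1..m}"
    have "norm (x j) = norm (v j) * \<tau> ^ (E div a j)" using j \<tau> by (simp add: x_def norm_mult norm_power)
    also have "\<dots> \<le> C * \<tau> ^ 1"
      using C(2)[OF j] C0 \<tau> E(2)[OF j] by (intro mult_mono power_decreasing) auto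
    finally show "norm (x j) < \<epsilon>" using \<tau>(3) by simp
  qed
  ultimately have "x = origin m" by (rule \<epsilon>(2))
  then show False using xz[OF j0] nz j0 by (simp add: origin_def)
qed

text \<open>The square block of the first m-2 columns is injective, hence invertible. Matrices count
  from 0, variables from 1 and equations from 3, which accounts for the shifts.\<close>

lemma left_right_inverse:
  fixes q :: "nat \<Rightarrow> nat \<Rightarrow> complex"
  assumes m: "3 \<le> m"
    and inj: "\<And>w. (\<And>l. l \<in> {3..m} \<Longrightarrow> (\<Sum>j=1..m-2. q l j * w j) = 0) \<Longrightarrow> \<forall>j\<in>{1..m-2}. w j = 0"
  obtains B where "\<And>i j. i \<in> {1..m-2} \<Longrightarrow> j \<in> {1..m-2} \<Longrightarrow> (\<Sum>l=3..m. B i l * q l j) = (if i = j then 1 else 0)"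
    "\<And>l l'. l \<in> {3..m} \<Longrightarrow> l' \<in> {3..m} \<Longrightarrow> (\<Sum>i=1..m-2. q l i * B i l') = (if l = l' then 1 else 0)"
proof -
  let ?k = "m - 2"
  define A where "A = Matrix.mat ?k ?k (\<lambda>(l, j). q (l + 3) (j + 1))"
  have A: "A \<in> carrier_mat ?k ?k" by (simp add: A_def)
  have shift1: "(\<Sum>j=1..m-2. h j) = (\<Sum>j\<in>{0..<?k}. h (j + 1))" for h :: "nat \<Rightarrow> complex"
    by (rule sum.reindex_bij_witness[where i = "\<lambda>j. j + 1" and j = "\<lambda>j. j - 1"]) (auto simp: atLeastAtMost_iff)
  have shift3: "(\<Sum>l=3..m. h l) = (\<Sum>l\<in>{0..<?k}. h (l + 3))" for h :: "nat \<Rightarrow> complex"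
    by (rule sum.reindex_bij_witness[where i = "\<lambda>j. j + 3" and j = "\<lambda>j. j - 3"]) (auto simp: atLeastAtMost_iff)
  have "det A \<noteq> 0"
  proof
    assume "det A = 0"
    then obtain v where v: "v \<in> carrier_vec ?k" "v \<noteq> 0\<^sub>v ?k" "A *\<^sub>v v = 0\<^sub>v ?k"
      using det_0_iff_vec_prod_zero[OF A] by blast
    have "\<forall>j\<in>{1..m-2}. vec_index v (j - 1) = 0"
    proof (rule inj)
      fix l assume l: "l \<in> {3..m}"
      then have l': "l - 3 < ?k" "l - 3 + 3 = l" by (auto simp: atLeastAtMost_iff)
      have "vec_index (A *\<^sub>v v) (l - 3) = (\<Sum>j\<in>{0..<?k}. q l (j + 1) * vec_index v j)"
        using l' v(1) A by (simp add: scalar_prod_def A_def)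
      then show "(\<Sum>j=1..m-2. q l j * vec_index v (j - 1)) = 0"
        using v(3) l' by (simp add: shift1)
    qed
    then have "vec_index v j = 0" if "j < ?k" for j
      using that by (auto simp: atLeastAtMost_iff dest: bspec[of _ _ "j + 1"])
    then have "v = 0\<^sub>v ?k" using v(1) by (intro eq_vecI) auto
    then show False using v(2) by simp
  qed
  then have "A \<in> Units (ring_mat TYPE(complex) ?k ())" by (rule det_non_zero_imp_unit[OF A])
  then obtain B where B: "B \<in> carrier_mat ?k ?k" "B * A = 1\<^sub>m ?k" "A * B = 1\<^sub>m ?k"
    unfolding Units_def ring_mat_def by auto
  show ?thesis
  proof (rule that[of "\<lambda>i l. B $$ (i - 1, l - 3)"])
    fix i j assume ij: "i \<in> {1..m-2}" "j \<in> {1..m-2}"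
    then have ij': "i - 1 < ?k" "j - 1 < ?k" "j - 1 + 1 = j" "i - 1 = j - 1 \<longleftrightarrow> i = j" by (auto simp: atLeastAtMost_iff)
    have "(B * A) $$ (i - 1, j - 1) = (\<Sum>l\<in>{0..<?k}. B $$ (i - 1, l) * q (l + 3) j)"
      using ij' A B(1) by (simp add: scalar_prod_def A_def)
    then show "(\<Sum>l=3..m. B $$ (i - 1, l - 3) * q l j) = (if i = j then 1 else 0)"
      using B(2) ij' by (simp add: shift3)
  next
    fix l l' assume l: "l \<in> {3..m}" "l' \<in> {3..m}"
    then have ll: "l - 3 < ?k" "l' - 3 < ?k" "l - 3 + 3 = l" "l - 3 = l' - 3 \<longleftrightarrow> l = l'" by (auto simp: atLeastAtMost_iff)
    have "(A * B) $$ (l - 3, l' - 3) = (\<Sum>i\<in>{0..<?k}. q l (i + 1) * B $$ (i, l' - 3))"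
      using ll A B(1) by (simp add: scalar_prod_def A_def)
    then show "(\<Sum>i=1..m-2. q l i * B $$ (i - 1, l' - 3)) = (if l = l' then 1 else 0)"
      using B(3) ll by (simp add: shift1)
  qed
qed

section \<open>The defining ideal\<close>

definition brieskorn_ps :: "nat \<Rightarrow> (nat \<Rightarrow> nat) \<Rightarrow> (nat \<Rightarrow> nat \<Rightarrow> complex) \<Rightarrow> nat \<Rightarrow> pseries" where
  "brieskorn_ps m a q l = (\<Sum>j=1..m. cst (q l j) * var j ^ a j)"

lemma brieskorn_series_eq: "brieskorn_series m a q l = cf (brieskorn_ps m a q l)"
proof -
  interpret R: cring "conv_ring m" by (rule cring_conv_ring)
  have const: "series_const c = cf (cst c)" for c by (auto simp: series_const_def cf_cst fun_eq_iff)
  have var: "series_var j = cf (var j)" for j by (auto simp: series_var_def cf_mon fun_eq_iff)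
  have pow: "cf f [^]\<^bsub>conv_ring m\<^esub> (n::nat) = cf (f ^ n)" for f n
    by (induction n) (auto simp: conv_ring_simps mult.commute)
  have "(\<Oplus>\<^bsub>conv_ring m\<^esub>j\<in>I. cf (F j)) = cf (\<Sum>j\<in>I. F j)" if "finite I" "\<And>j. j \<in> I \<Longrightarrow> F j \<in> cs m" for I F
    using that
  proof (induction I rule: finite_induct)
    case (insert i I)
    then show ?case by (subst R.finsum_insert) (auto simp: conv_ring_simps)
  qed (simp add: conv_ring_simps)
  from this[of "{1..m}" "\<lambda>j. cst (q l j) * var j ^ a j"] show ?thesis
    unfolding brieskorn_series_def brieskorn_ps_def const var pow conv_ring_simps(2)
    by (simp add: cs_mult cs_power cs_var cs_cst)
qed

lemma (in brieskorn_nf) brieskorn_ideal_eq: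
  assumes GF: "\<And>i. i \<in> {1..m-2} \<Longrightarrow> G i = (\<Sum>l=3..m. cst (B i l) * brieskorn_ps m a q l)"
    and FG: "\<And>l. l \<in> {3..m} \<Longrightarrow> brieskorn_ps m a q l = (\<Sum>i=1..m-2. G i * cst (q l i))"
  shows "brieskorn_ideal m a q = cf ` J"
proof -
  interpret R: cring "conv_ring m" by (rule cring_conv_ring)
  let ?S = "brieskorn_series m a q ` {3..m}"
  have Fc: "brieskorn_ps m a q l \<in> cs m" for l
    unfolding brieskorn_ps_def by (auto intro!: cs_sum cs_mult cs_power cs_var)
  then have Sc: "?S \<subseteq> carrier (conv_ring m)" by (auto simp: brieskorn_series_eq conv_ring_simps)
  interpret I: ideal "Idl\<^bsub>conv_ring m\<^esub> ?S" "conv_ring m" by (rule R.genideal_ideal[OF Sc])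
  have I_sum: "cf (\<Sum>i\<in>K. H i) \<in> Idl\<^bsub>conv_ring m\<^esub> ?S"
    if "\<And>i. i \<in> K \<Longrightarrow> cf (H i) \<in> Idl\<^bsub>conv_ring m\<^esub> ?S" for H and K :: "nat set"
    using that
  proof (induction K rule: infinite_finite_induct)
    case (insert i K)
    then show ?case using I.a_closed[of "cf (H i)" "cf (sum H K)"] by (simp add: conv_ring_simps del: cf_add)
  qed (use I.zero_closed in \<open>simp_all add: conv_ring_simps\<close>)
  have I_mult: "cf (f * g) \<in> Idl\<^bsub>conv_ring m\<^esub> ?S" if "cf f \<in> Idl\<^bsub>conv_ring m\<^esub> ?S" "g \<in> cs m" for f g
    using I.I_r_closed[OF that(1), of "cf g"] that(2) by (simp add: conv_ring_simps)
  show ?thesis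
    unfolding brieskorn_ideal_def
  proof
    have "brieskorn_ps m a q l \<in> J" if "l \<in> {3..m}" for l
      using FG[OF that] unfolding J_def mem_Collect_eq by (intro exI[of _ "\<lambda>i. cst (q l i)"]) auto
    then show "Idl\<^bsub>conv_ring m\<^esub> ?S \<subseteq> cf ` J"
      by (intro R.genideal_minimal ideal_cf_J) (auto simp: brieskorn_series_eq)
    show "cf ` J \<subseteq> Idl\<^bsub>conv_ring m\<^esub> ?S"
    proof clarify
      fix f assume "f \<in> J"
      then obtain F where F: "f = (\<Sum>i=1..m-2. G i * F i)" "\<forall>i. F i \<in> cs m" by (auto simp: J_def)
      have F_mem: "cf (brieskorn_ps m a q l) \<in> Idl\<^bsub>conv_ring m\<^esub> ?S" if "l \<in> {3..m}" for l
        using R.genideal_self[OF Sc] that unfolding brieskorn_series_eq by blast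
      have "cf (G i) \<in> Idl\<^bsub>conv_ring m\<^esub> ?S" if "i \<in> {1..m-2}" for i
        unfolding GF[OF that]
      proof (rule I_sum)
        fix l assume "l \<in> {3..m}"
        then show "cf (cst (B i l) * brieskorn_ps m a q l) \<in> Idl\<^bsub>conv_ring m\<^esub> ?S"
          using I_mult[OF F_mem cs_cst, of l "B i l"] by (simp add: mult.commute)
      qed
      then show "cf f \<in> Idl\<^bsub>conv_ring m\<^esub> ?S" unfolding F(1) using F(2) by (intro I_sum I_mult) auto
    qed
  qed
qed

text \<open>A kernel vector supported on the first m-2 coordinates has two zero entries and so
  vanishes. Hence that block is invertible, and its inverse combines the given equations into the
  \<open>G i\<close>.\<close>

lemma brieskorn_alg_exists:
  assumes m: "3 \<le> m" and a: "\<forall>j\<in>{1..m}. 2 \<le> a j" and mono: "mono_on {1..m} a"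
    and iso: "isolated_ci_singularity m (m - 2) (\<lambda>i. brieskorn_fun m a q (i + 3))"
  obtains p r where "brieskorn_alg m a p r q"
proof -
  note ker = kernel_two_zeros[OF m a iso]
  have vars: "{1..m} = {1..m-2} \<union> {m-1, m}" using m by (auto simp: atLeastAtMost_iff)
  have nin: "m - 1 \<notin> {1..m-2}" "m \<notin> {1..m-2}" "m - 1 \<noteq> m" using m by (auto simp: atLeastAtMost_iff)
  have split: "(\<Sum>j=1..m. h j) = (\<Sum>j=1..m-2. h j) + (h (m-1) + h m)" for h :: "nat \<Rightarrow> 'a::comm_monoid_add"
  proof -
    have "(\<Sum>j=1..m. h j) = sum h {1..m-2} + sum h {m-1, m}"
      unfolding vars by (rule sum.union_disjoint) (use nin in auto)
    then show ?thesis using nin by simp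
  qed
  obtain B where B1: "\<And>i j. i \<in> {1..m-2} \<Longrightarrow> j \<in> {1..m-2} \<Longrightarrow> (\<Sum>l=3..m. B i l * q l j) = (if i = j then 1 else 0)"
    and B2: "\<And>l l'. l \<in> {3..m} \<Longrightarrow> l' \<in> {3..m} \<Longrightarrow> (\<Sum>i=1..m-2. q l i * B i l') = (if l = l' then 1 else 0)"
  proof (rule left_right_inverse[OF m, of q])
    fix w assume w: "\<And>l. l \<in> {3..m} \<Longrightarrow> (\<Sum>j=1..m-2. q l j * w j) = 0"
    define w' where "w' = (\<lambda>j. if j \<in> {1..m-2} then w j else 0)"
    have "(\<Sum>j=1..m. q l j * w' j) = 0" if "l \<in> {3..m}" for l
      using w[OF that] nin by (simp add: split w'_def)
    then have "w' j = 0" if "j \<in> {1..m}" for j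
      using ker[of w' "m-1" m j] that nin m by (simp add: w'_def atLeastAtMost_iff)
    then show "\<forall>j\<in>{1..m-2}. w j = 0" unfolding w'_def vars by (metis UnI1)
  qed blast
  define p where "p i = (\<Sum>l=3..m. B i l * q l (m-1))" for i
  define r where "r i = (\<Sum>l=3..m. B i l * q l m)" for i
  have qB: "(\<Sum>i=1..m-2. q l i * (\<Sum>l'=3..m. B i l' * q l' j)) = q l j" if l: "l \<in> {3..m}" for l j
  proof -
    have "(\<Sum>i=1..m-2. q l i * (\<Sum>l'=3..m. B i l' * q l' j)) = (\<Sum>l'=3..m. (\<Sum>i=1..m-2. q l i * B i l') * q l' j)"
      unfolding sum_distrib_left sum_distrib_right mult.assoc by (rule sum.swap)
    also have "\<dots> = (\<Sum>l'=3..m. if l = l' then q l j else 0)"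
      by (intro sum.cong) (auto simp: B2[OF l])
    finally show ?thesis using l by simp
  qed
  have "p i \<noteq> 0" if i: "i \<in> {1..m-2}" for i
  proof
    assume pi: "p i = 0"
    \<comment> \<open>The kernel vector with entries 1 and 0 at m-1 and m. Its i-th entry - p_i
      would be a second zero, forcing the entry 1 to vanish.\<close>
    define w where "w = (\<lambda>j. if j \<in> {1..m-2} then - p j else if j = m-1 then 1 else 0)"
    have "(\<Sum>j=1..m. q l j * w j) = 0" if "l \<in> {3..m}" for l
    proof -
      have "(\<Sum>j=1..m. q l j * w j) = - (\<Sum>j=1..m-2. q l j * p j) + q l (m-1)"
        using nin by (simp add: split w_def sum_negf)
      then show ?thesis using qB[OF that, of "m-1"] by (simp add: p_def)
    qed
    then have "w (m-1) = 0"
      using ker[of w i m "m-1"] i nin m pi by (auto simp: w_def vars)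
    then show False using nin by (simp add: w_def)
  qed
  then interpret brieskorn_nf m a p r
    using m a mono by unfold_locales auto
  have GF: "G i = (\<Sum>l=3..m. cst (B i l) * brieskorn_ps m a q l)" if i: "i \<in> {1..m-2}" for i
  proof -
    have cst_sum: "cst (\<Sum>l\<in>S. h l) = (\<Sum>l\<in>S. cst (h l))" for h and S :: "nat set"
      by (induction S rule: infinite_finite_induct) (auto simp: cst_add)
    have "(\<Sum>l=3..m. cst (B i l) * brieskorn_ps m a q l) = (\<Sum>j=1..m. cst (\<Sum>l=3..m. B i l * q l j) * var j ^ a j)"
      unfolding brieskorn_ps_def sum_distrib_left cst_sum sum_distrib_right cst_mult mult.assoc
      by (rule sum.swap)
    also have "\<dots> = (\<Sum>j=1..m-2. cst (\<Sum>l=3..m. B i l * q l j) * var j ^ a j)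
        + (cst (p i) * var (m-1) ^ a (m-1) + cst (r i) * var m ^ a m)"
      by (simp add: split p_def r_def)
    also have "(\<Sum>j=1..m-2. cst (\<Sum>l=3..m. B i l * q l j) * var j ^ a j) = (\<Sum>j=1..m-2. if j = i then var i ^ a i else 0)"
      by (intro sum.cong) (auto simp: B1[OF i] cst_1)
    finally show ?thesis using i by (simp add: G_def)
  qed
  have FG: "brieskorn_ps m a q l = (\<Sum>i=1..m-2. G i * cst (q l i))" if l: "l \<in> {3..m}" for l
  proof -
    have cst_sum: "cst (\<Sum>i\<in>S. h i) = (\<Sum>i\<in>S. cst (h i))" for h and S :: "nat set"
      by (induction S rule: infinite_finite_induct) (auto simp: cst_add)
    have "(\<Sum>i=1..m-2. G i * cst (q l i)) = (\<Sum>i=1..m-2. cst (q l i) * var i ^ a i)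
        + (cst (\<Sum>i=1..m-2. q l i * p i) * var (m-1) ^ a (m-1) + cst (\<Sum>i=1..m-2. q l i * r i) * var m ^ a m)"
      by (simp add: G_def cst_sum sum_distrib_right sum_distrib_left sum.distrib cst_mult distrib_left distrib_right mult_ac)
    then show ?thesis
      using qB[OF l, of "m-1"] qB[OF l, of m] by (simp add: brieskorn_ps_def split p_def r_def)
  qed
  have "brieskorn_alg m a p r q"
    using brieskorn_ideal_eq[OF GF FG] by unfold_locales auto
  then show ?thesis by (rule that)
qed

theorem theorem5p8:
  fixes m :: nat and a :: "nat \<Rightarrow> nat" and q :: "nat \<Rightarrow> nat \<Rightarrow> complex"
    and A :: "series set ring" and M Q :: "series set set"
  assumes "m \<ge> 3"
    and "\<forall>i\<in>{1..m}. 2 \<le> a i"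
    and "mono_on {1..m} a"
    and "isolated_ci_singularity m (m - 2) (\<lambda>i. brieskorn_fun m a q (i + 3))"
    and "A = brieskorn_ring m a q"
    and "maximalideal M A"
    and "Q = Idl\<^bsub>A\<^esub> {brieskorn_coord m a q (m - 1), brieskorn_coord m a q m}"
  shows "minimal_reduction A M Q
    \<and> (int (nr A M Q) = \<lfloor>real (a (m - 1)) * (\<Sum>i=1..m-2. (real (a i) - 1) / real (a i))\<rfloor>
       \<and> int (r_bar A M Q) = \<lfloor>real (a (m - 1)) * (\<Sum>i=1..m-2. (real (a i) - 1) / real (a i))\<rfloor>)
    \<and> (\<forall>n. vectorspace class_ring (brieskorn_quot m a q M Q n)
         \<and> inj_on (\<lambda>u. (Q \<cdot>\<^bsub>A\<^esub> closed_power A M n) +>\<^bsub>A\<^esub> brieskorn_monomial m a q u)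
             (brieskorn_exponents m a n)
         \<and> vectorspace.basis class_ring (brieskorn_quot m a q M Q n)
             ((\<lambda>u. (Q \<cdot>\<^bsub>A\<^esub> closed_power A M n) +>\<^bsub>A\<^esub> brieskorn_monomial m a q u)
                ` brieskorn_exponents m a n))
    \<and> antimono (\<lambda>n. vectorspace.dim class_ring (brieskorn_quot m a q M Q n))"
proof -
  obtain p r where "brieskorn_alg m a p r q"
    using brieskorn_alg_exists assms(1-4) by blast
  then interpret brieskorn_alg m a p r q .
  have M: "M = res ` ord 1" using maximal_eq assms(5,6) by simp
  have Q: "Q = res ` qi" unfolding assms(5,7) by (rule qi_eq)
  have W: "Q \<cdot>\<^bsub>A\<^esub> closed_power A M n = res ` qw n" for n
    unfolding M Q assms(5) closed_power_eq by (rule qi_prod)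
  have quot: "brieskorn_quot m a q M Q n = V n" for n
    using W[of n] unfolding brieskorn_quot_def Let_def assms(5) M closed_power_eq by simp
  have "antimono (\<lambda>n. vectorspace.dim class_ring (brieskorn_quot m a q M Q n))"
    unfolding quot dim_quot by (intro antimonoI card_mono finite_Ex Ex_antimono)
  then show ?thesis
    using minimal_reduction_qi nr_eq r_bar_eq basis_quot W quot unfolding M Q assms(5) slope_def by simp
qed

end
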